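(* Consider midpoint routing, i.e. the total picking time $$T=\sum_{i=1}^{M}P_i+\frac lv\sum_{i=k^-+1}^{k^+-1}\big(A_i^f+A_i^b\big)+\frac{2l}{v}+\frac2v w_a(k^+-1),$$ and let $S^f=\sum_{i=k^-+1}^{k^+-1}A_i^f$, $S^b=\sum_{i=k^-+1}^{k^+-1}A_i^b$. Then $$\mathbb{E}[T]=\mathbb{E}[M]\mathbb{E}[P]+\frac{2l}v\mathbb{E}[S^f]+\frac{2w_a}v\big(\mathbb{E}[k^+]-1\big)+\frac{2l}v$$ and $$\begin{aligned}\mathbb{E}[T^2]&=\mathbb{E}[M(M-1)]\mathbb{E}[P]^2+\mathbb{E}[M]\mathbb{E}[P^2]+\frac{l^2}{v^2}\mathbb{E}\big[(S^f+S^b)^2\big]+\frac{4w_a^2}{v^2}\Big(\mathbb{E}[(k^+)^2]-2\mathbb{E}[k^+]+1\Big)+\frac{4l^2}{v^2}\\ &\quad+\frac{4l}v\mathbb{E}[P]\,\mathbb{E}[MS^f]+\frac{4w_a}v\mathbb{E}[P]\Big(\mathbb{E}[Mk^+]-\mathbb{E}[M]\Big)+\frac{8w_al}{v^2}\Big(\mathbb{E}[k^+S^f]-\mathbb{E}[S^f]\Big)+\frac{4l}v\Big(\mathbb{E}[T]-\frac{2l}v\Big).\end{aligned}$$ Here $$\mathbb{E}[k^+]=k-\sum_{r=0}^{k-1}P_M\Big(\frac rk\Big),\quad \mathbb{E}[(k^+)^2]=k^2-\sum_{r=0}^{k-1}(2r+1)P_M\Big(\frac rk\Big),\quad \mathbb{E}[Mk^+]=k\mathbb{E}[M]-\sum_{r=0}^{k-1}\frac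 rkP_M'\Big(\frac rk\Big),$$ $$\mathbb{E}[S^f]=\sum_{m=2}^{k-1}(m-1)(k-m)\,a_m,$$ $$\mathbb{E}\big[(S^f+S^b)^2\big]=\sum_{m=2}^{k-1}(2m-2)(k-m)\,b_m+\sum_{m=2}^{k-1}(2m-2)(2m-3)(k-m)\,c_m,$$ $$\mathbb{E}[k^+S^f]=\sum_{m=2}^{k-1}\tfrac12(k-m)(k+m+1)(m-1)\,a_m,$$ $$\mathbb{E}[MS^f]=\sum_{m=2}^{k-1}(k-m)(m-1)(2m-1)\,d_m+\sum_{m=2}^{k-1}(k-m)(m-1)\,e_m+\sum_{m=2}^{k-1}4(k-m)(m-1)\,f_m,$$ where, with $$G_m(z,y)=P_M\Big(\frac{2m+y+z}{2k}\Big)-2P_M\Big(\frac{2m-2+y+z}{2k}\Big)+P_M\Big(\frac{2m-4+y+z}{2k}\Big)$$ and $g_m(z)=G_m(z,1)$ (so that $g_m(1)=\mathbb{P}(k^+=m+1,k^-=1)$), for $2\le m\le k-1$: $$a_m=\mathbb{E}\big[A_2^f\mathbf 1\{k^+=m+1,k^-=1\}\big]=g_m(1)-\int_0^1g_m(z)dz,$$ $$b_m=\mathbb{E}\big[(A_2^f)^2\mathbf 1\{k^+=m+1,k^-=1\}\big]=g_m(1)-2\int_0^1zg_m(z)dz,$$ $$c_m=\mathbb{E}\big[A_2^fA_2^b\mathbf 1\{k^+=m+1,k^-=1\}\big]=g_m(1)-2\int_0^1g_m(z)dz+\int_0^1\!\!\int_0^1G_m(z,y)dy\,dz,$$ $$d_m=\mathbb{E}\big[A_2^fN_2^b\mathbf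 1\{k^+=m+1,k^-=1\}\big]=g_m'(1)-g_m(1)+g_m(0),$$ $$e_m=\mathbb{E}\big[A_2^fN_2^f\mathbf 1\{k^+=m+1,k^-=1\}\big]=g_m'(1)-g_m(1)+\int_0^1g_m(z)dz,$$ $$f_m=\mathbb{E}\big[A_2^fN_1^f\mathbf 1\{k^+=m+1,k^-=1\}\big].$$
   Context: Model. $k\ge1$ is an integer (number of aisles, numbered $1,\dots,k$); $l>0$ (aisle length), $w_a>0$ (distance between the middles of adjacent aisles), $v>0$ (walking speed) are constants. The order size $M$ is a nonnegative-integer-valued random variable with $\mathbb{E}[M^2]<\infty$ and probability generating function $P_M(x)=\mathbb{E}[x^M]$ (with $0^0=1$); derivatives at $1$ are one-sided. Given $M$, each of the $M$ items is, independently of the others, placed in an aisle uniformly distributed on $\{1,\dots,k\}$ and, independently, at a location uniformly distributed on $[0,1]$ in that aisle (fraction of the aisle length measured from the front cross-aisle). The item picking times $P_1,P_2,\dots$ are i.i.d. copies of a nonnegative random variable $P$ with $\mathbb{E}[P^2]<\infty$, independent of $M$ and of all item locations. $N_i$ is the number of items in aisle $i$; $N_i^f$ (resp. $N_i^b$) is the number of items in the front half (location in $[0,1/2]$) (resp. back half) of aisle $i$. $k^+=\max\{i:N_i>0\}$ and $k^-=\min\{i:N_i>0\}$ (both $0$ if $M=0$). $A_i^f$ is the largest distance from the front cross-aisle of an item in the front half of aisle $i$, and $A_i^b$ the largest distance from the back cross-aisle of an item in the back half of aisle $i$, both as a fraction of the half-aisle length (so in $[0,1]$), and $0$ if the half-aisle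 is empty. Empty sums are $0$.
   Formalization: In the formula for E[M S^f], the coefficient of d_m is 2m-3 instead of the printed 2m-1, which is false: for k=3 and M=4 one has E[M S^f]=44/81, while the printed formula gives 50/81. *)

theory Defs
  imports "HOL-Probability.Probability"
begin

text \<open>
  Items are numbered from 0, so the items of an order of size \<^term>\<open>M \<omega>\<close> are the
  \<^term>\<open>j < M \<omega>\<close>. Item \<open>j\<close> lies in aisle \<^term>\<open>aisle j \<omega>\<close> at the fraction
  \<^term>\<open>loc j \<omega>\<close> of the aisle length, measured from the front cross-aisle, and takes
  \<^term>\<open>pick j \<omega>\<close> to pick. The three sequences are infinite, but only the first
  \<^term>\<open>M \<omega>\<close> entries are ever used.
\<close>

datatype source = Order_Size | Item_Aisle nat | Item_Loc nat | Item_Pick nat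

text \<open>
  The predicate \<^term>\<open>indep_vars\<close> needs a common value type: the integer-valued
  variables are embedded into the reals, which does not change the generated sigma-algebras.
\<close>

locale order_picking = prob_space \<Omega>
  for \<Omega> :: "'a measure" +
  fixes k :: nat
    and l w\<^sub>a v :: real
    and M :: "'a \<Rightarrow> nat"
    and aisle :: "nat \<Rightarrow> 'a \<Rightarrow> nat"
    and loc :: "nat \<Rightarrow> 'a \<Rightarrow> real"
    and P :: "'a \<Rightarrow> real"
    and pick :: "nat \<Rightarrow> 'a \<Rightarrow> real"
  assumes k_ge_1: "k \<ge> 1"
    and l_pos: "l > 0"
    and w\<^sub>a_pos: "w\<^sub>a > 0"
    and v_pos: "v > 0"
    and M_measurable: "random_variable (count_space UNIV) M"
    and M_square_integrable: "integrable \<Omega> (\<lambda>\<omega>. (real (M \<omega>))\<^sup>2)"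
    and aisle_measurable: "random_variable (count_space UNIV) (aisle j)"
    and aisle_uniform: "distr \<Omega> (count_space UNIV) (aisle j) = measure_pmf (pmf_of_set {1..k})"
    and loc_measurable: "random_variable borel (loc j)"
    and loc_uniform: "distr \<Omega> borel (loc j) = uniform_measure lborel {0..1}"
    and P_measurable: "random_variable borel P"
    and P_nonneg: "AE \<omega> in \<Omega>. 0 \<le> P \<omega>"
    and P_square_integrable: "integrable \<Omega> (\<lambda>\<omega>. (P \<omega>)\<^sup>2)"
    and pick_measurable: "random_variable borel (pick j)"
    and pick_distr: "distr \<Omega> borel (pick j) = distr \<Omega> borel P"
    and independent: "indep_vars (\<lambda>_. borel)
      (\<lambda>s \<omega>. case s of
          Order_Size \<Rightarrow> real (M \<omega>)
        | Item_Aisle j \<Rightarrow> real (aisle j \<omega>)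
        | Item_Loc j \<Rightarrow> loc j \<omega>
        | Item_Pick j \<Rightarrow> pick j \<omega>) UNIV"

definition front_items ::
  "('a \<Rightarrow> nat) \<Rightarrow> (nat \<Rightarrow> 'a \<Rightarrow> nat) \<Rightarrow> (nat \<Rightarrow> 'a \<Rightarrow> real) \<Rightarrow> nat \<Rightarrow> 'a \<Rightarrow> nat set" where
  "front_items M aisle loc i \<omega> = {j. j < M \<omega> \<and> aisle j \<omega> = i \<and> 0 \<le> loc j \<omega> \<and> loc j \<omega> \<le> 1/2}"

definition back_items ::
  "('a \<Rightarrow> nat) \<Rightarrow> (nat \<Rightarrow> 'a \<Rightarrow> nat) \<Rightarrow> (nat \<Rightarrow> 'a \<Rightarrow> real) \<Rightarrow> nat \<Rightarrow> 'a \<Rightarrow> nat set" where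
  "back_items M aisle loc i \<omega> = {j. j < M \<omega> \<and> aisle j \<omega> = i \<and> 1/2 < loc j \<omega> \<and> loc j \<omega> \<le> 1}"

definition num_items ::
  "('a \<Rightarrow> nat) \<Rightarrow> (nat \<Rightarrow> 'a \<Rightarrow> nat) \<Rightarrow> nat \<Rightarrow> 'a \<Rightarrow> nat" where
  "num_items M aisle i \<omega> = card {j. j < M \<omega> \<and> aisle j \<omega> = i}"

definition num_front ::
  "('a \<Rightarrow> nat) \<Rightarrow> (nat \<Rightarrow> 'a \<Rightarrow> nat) \<Rightarrow> (nat \<Rightarrow> 'a \<Rightarrow> real) \<Rightarrow> nat \<Rightarrow> 'a \<Rightarrow> nat" where
  "num_front M aisle loc i \<omega> = card (front_items M aisle loc i \<omega>)"

definition num_back ::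
  "('a \<Rightarrow> nat) \<Rightarrow> (nat \<Rightarrow> 'a \<Rightarrow> nat) \<Rightarrow> (nat \<Rightarrow> 'a \<Rightarrow> real) \<Rightarrow> nat \<Rightarrow> 'a \<Rightarrow> nat" where
  "num_back M aisle loc i \<omega> = card (back_items M aisle loc i \<omega>)"

definition last_aisle :: "('a \<Rightarrow> nat) \<Rightarrow> (nat \<Rightarrow> 'a \<Rightarrow> nat) \<Rightarrow> 'a \<Rightarrow> nat" where
  "last_aisle M aisle \<omega> = (if M \<omega> = 0 then 0 else Max {i. num_items M aisle i \<omega> > 0})"

definition first_aisle :: "('a \<Rightarrow> nat) \<Rightarrow> (nat \<Rightarrow> 'a \<Rightarrow> nat) \<Rightarrow> 'a \<Rightarrow> nat" where
  "first_aisle M aisle \<omega> = (if M \<omega> = 0 then 0 else Min {i. num_items M aisle i \<omega> > 0})"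

text \<open>Distances to the nearer cross-aisle, in units of half an aisle length.\<close>

definition front_reach ::
  "('a \<Rightarrow> nat) \<Rightarrow> (nat \<Rightarrow> 'a \<Rightarrow> nat) \<Rightarrow> (nat \<Rightarrow> 'a \<Rightarrow> real) \<Rightarrow> nat \<Rightarrow> 'a \<Rightarrow> real" where
  "front_reach M aisle loc i \<omega> =
    (if front_items M aisle loc i \<omega> = {} then 0
     else Max ((\<lambda>j. loc j \<omega> / (1/2)) ` front_items M aisle loc i \<omega>))"

definition back_reach ::
  "('a \<Rightarrow> nat) \<Rightarrow> (nat \<Rightarrow> 'a \<Rightarrow> nat) \<Rightarrow> (nat \<Rightarrow> 'a \<Rightarrow> real) \<Rightarrow> nat \<Rightarrow> 'a \<Rightarrow> real" where
  "back_reach M aisle loc i \<omega> =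
    (if back_items M aisle loc i \<omega> = {} then 0
     else Max ((\<lambda>j. (1 - loc j \<omega>) / (1/2)) ` back_items M aisle loc i \<omega>))"

definition interior_aisles :: "('a \<Rightarrow> nat) \<Rightarrow> (nat \<Rightarrow> 'a \<Rightarrow> nat) \<Rightarrow> 'a \<Rightarrow> nat set" where
  "interior_aisles M aisle \<omega> = {first_aisle M aisle \<omega> <..< last_aisle M aisle \<omega>}"

definition front_sum ::
  "('a \<Rightarrow> nat) \<Rightarrow> (nat \<Rightarrow> 'a \<Rightarrow> nat) \<Rightarrow> (nat \<Rightarrow> 'a \<Rightarrow> real) \<Rightarrow> 'a \<Rightarrow> real" where
  "front_sum M aisle loc \<omega> = (\<Sum>i\<in>interior_aisles M aisle \<omega>. front_reach M aisle loc i \<omega>)"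

definition back_sum ::
  "('a \<Rightarrow> nat) \<Rightarrow> (nat \<Rightarrow> 'a \<Rightarrow> nat) \<Rightarrow> (nat \<Rightarrow> 'a \<Rightarrow> real) \<Rightarrow> 'a \<Rightarrow> real" where
  "back_sum M aisle loc \<omega> = (\<Sum>i\<in>interior_aisles M aisle \<omega>. back_reach M aisle loc i \<omega>)"

text \<open>For the empty order the last summand below is \<open>- 2 / v * w\<^sub>a\<close>, as in the displayed
  formula for the total picking time.\<close>

definition midpoint_time ::
  "real \<Rightarrow> real \<Rightarrow> real \<Rightarrow> ('a \<Rightarrow> nat) \<Rightarrow> (nat \<Rightarrow> 'a \<Rightarrow> nat) \<Rightarrow> (nat \<Rightarrow> 'a \<Rightarrow> real) \<Rightarrow>
    (nat \<Rightarrow> 'a \<Rightarrow> real) \<Rightarrow> 'a \<Rightarrow> real" where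
  "midpoint_time l w\<^sub>a v M aisle loc pick \<omega> =
     (\<Sum>j<M \<omega>. pick j \<omega>)
     + l / v * (\<Sum>i\<in>interior_aisles M aisle \<omega>.
                   front_reach M aisle loc i \<omega> + back_reach M aisle loc i \<omega>)
     + 2 * l / v
     + 2 / v * w\<^sub>a * (real (last_aisle M aisle \<omega>) - 1)"

definition pgf :: "'a measure \<Rightarrow> ('a \<Rightarrow> nat) \<Rightarrow> real \<Rightarrow> real" where
  "pgf \<Omega> M x = (\<integral>\<omega>. x ^ M \<omega> \<partial>\<Omega>)"

text \<open>Derivative relative to the unit interval: two-sided at interior points, one-sided at the
  end points. A probability generating function need not be defined to the right of 1.\<close>

definition deriv01 :: "(real \<Rightarrow> real) \<Rightarrow> real \<Rightarrow> real" where
  "deriv01 f x = vector_derivative f (at x within {0..1})"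

definition span_pgf :: "'a measure \<Rightarrow> ('a \<Rightarrow> nat) \<Rightarrow> nat \<Rightarrow> nat \<Rightarrow> real \<Rightarrow> real \<Rightarrow> real" where
  "span_pgf \<Omega> M k m z y =
     pgf \<Omega> M ((2 * real m + y + z) / (2 * real k))
     - 2 * pgf \<Omega> M ((2 * real m - 2 + y + z) / (2 * real k))
     + pgf \<Omega> M ((2 * real m - 4 + y + z) / (2 * real k))"

text \<open>
  On the coefficient \<open>2 * m - 3\<close> in the formula for the mixed moment of \<open>M\<close> and \<open>S\<^sup>f\<close>:
  if the last and the first visited aisle differ by \<open>m\<close>, the \<open>2 * m + 2\<close> half-aisles in this
  range are, seen from a fixed interior front half-aisle, this half-aisle itself (term \<open>e\<close>), the
  \<open>2 * (m - 1) - 1 = 2 * m - 3\<close> other interior ones (term \<open>d\<close>), and the four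
  in the two extreme aisles (term \<open>f\<close>). The source prints \<open>2 * m - 1\<close>
  here, which is incorrect: for \<open>k = 3\<close> and \<open>M = 4\<close> the moment is \<open>44/81\<close>, whereas the
  printed coefficient gives \<open>50/81\<close>.
\<close>

end

theory Submission
  imports Defs
begin



text \<open>
  Cut every aisle into its two halves. An item lies in each of the \<open>2 * k\<close> half-aisles with
  probability \<open>1 / (2 * k)\<close>, at a depth (distance from the nearer cross-aisle) that is uniform on
  the unit interval and independent of the half-aisle. Let \<open>t\<close> prescribe a maximal depth in
  \<open>[0, 1]\<close> for each half-aisle of a set \<open>C\<close>. As the items are independent given their number,
  all of them lie in \<open>C\<close> and respect these bounds with probability
  \<open>P_M ((\<Sum>c\<in>C. t c) / (2 * k))\<close> (\<open>expectation_all_items_within\<close>). Marking one of the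
  items gives a companion formula for this event weighted by the number of items in a half-aisle,
  with the derivative of \<open>P_M\<close> in the place of \<open>P_M\<close>
  (\<open>expectation_num_cell_all_items_within\<close>). The moments that involve only the locations and
  the order size are consequences of these two formulas.

  That the visited aisles run exactly from \<open>i\<close> to \<open>i + m\<close> is an inclusion-exclusion of four
  events of this kind: all items lie between \<open>i\<close> and \<open>i + m\<close>, but neither of the two
  end aisles may be left out. Bounding in addition the reaches of two interior half-aisles by \<open>z\<close>
  and \<open>y\<close> yields the second difference \<open>G m z y\<close>. Neither \<open>i\<close> nor the choice of the
  half-aisles occurs in it, so this computation also replaces an argument by exchangeability.
  Integrating over the bounds (\<open>layer_cake_has_integral\<close>) turns these distribution functions into the
  moments of the reaches. With a count as weight the integrand is \<open>g'\<close> or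
  \<open>z * g' z\<close>, which the fundamental theorem of calculus integrates; for counts in the two end
  aisles one only needs that the result is the same for all of them.

  Finally one sums over the \<open>k - m\<close> positions of the interval and counts the interior half-aisles
  (\<open>expectation_half_sum\<close>, \<open>expectation_total_square\<close>, \<open>expectation_size_half_sum\<close>).
  The moments of the last visited aisle follow by summation of its tails, because it is at most
  \<open>r\<close> with probability \<open>P_M (r / k)\<close>. The picking times are independent of everything else,
  so their sum contributes \<open>E P\<close> times the order size to a mixed moment
  (\<open>expectation_sum_picks_times\<close>); expanding the square of the total time does the rest.
\<close>

section \<open>The visited aisles and the reaches as measurable functions\<close>

lemma occupied_aisles: "{i. num_items M aisle i \<omega> > 0} = (\<lambda>j. aisle j \<omega>) ` {..<M \<omega>}"
proof -
  have "num_items M aisle i \<omega> > 0 \<longleftrightarrow> (\<exists>j<M \<omega>. aisle j \<omega> = i)" for i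
  proof -
    have "finite {j. j < M \<omega> \<and> aisle j \<omega> = i}" by simp
    then show ?thesis unfolding num_items_def by (auto simp: card_gt_0_iff)
  qed
  then show ?thesis by auto
qed

lemma last_aisle_le_iff: "last_aisle M aisle \<omega> \<le> r \<longleftrightarrow> (\<forall>j<M \<omega>. aisle j \<omega> \<le> r)"
  by (cases "M \<omega> = 0") (auto simp: last_aisle_def occupied_aisles lessThan_empty_iff)

lemma first_aisle_le_iff: "first_aisle M aisle \<omega> \<le> r \<longleftrightarrow> M \<omega> = 0 \<or> (\<exists>j<M \<omega>. aisle j \<omega> \<le> r)"
  by (cases "M \<omega> = 0") (auto simp: first_aisle_def occupied_aisles lessThan_empty_iff Min_le_iff)

text \<open>
  The right-hand side uses only events of the form "all items lie in a given set of aisles", whose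
  probabilities factor over the items. An empty order satisfies all three of them and is therefore
  excluded, in agreement with \<open>1 \<le> i\<close>.
\<close>

lemma first_last_aisle_eq_iff:
  assumes "1 \<le> i" "i \<le> i'"
  shows "last_aisle M aisle \<omega> = i' \<and> first_aisle M aisle \<omega> = i \<longleftrightarrow>
    (\<forall>j<M \<omega>. i \<le> aisle j \<omega> \<and> aisle j \<omega> \<le> i')
    \<and> \<not> (\<forall>j<M \<omega>. i + 1 \<le> aisle j \<omega> \<and> aisle j \<omega> \<le> i')
    \<and> \<not> (\<forall>j<M \<omega>. i \<le> aisle j \<omega> \<and> aisle j \<omega> \<le> i' - 1)" (is "?L \<longleftrightarrow> ?R")
proof -
  have "last_aisle M aisle \<omega> = i' \<longleftrightarrow> last_aisle M aisle \<omega> \<le> i' \<and> \<not> last_aisle M aisle \<omega> \<le> i' - 1"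
    using assms by auto
  moreover have "first_aisle M aisle \<omega> = i
      \<longleftrightarrow> first_aisle M aisle \<omega> \<le> i \<and> \<not> first_aisle M aisle \<omega> \<le> i - 1"
    using assms by auto
  moreover have "i \<le> x \<longleftrightarrow> \<not> x \<le> i - 1" "i + 1 \<le> x \<longleftrightarrow> \<not> x \<le> i" for x
    using assms by auto
  moreover have "M \<omega> = 0 \<longleftrightarrow> (\<forall>j. \<not> j < M \<omega>)" by auto
  ultimately show ?thesis
    unfolding last_aisle_le_iff first_aisle_le_iff by (smt (verit))
qed

lemma front_reach_le_iff:
  "front_reach M aisle loc i \<omega> \<le> z \<longleftrightarrow>
    0 \<le> z \<and> (\<forall>j<M \<omega>. aisle j \<omega> = i \<and> 0 \<le> loc j \<omega> \<and> loc j \<omega> \<le> 1/2 \<longrightarrow> 2 * loc j \<omega> \<le> z)"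
proof (cases "front_items M aisle loc i \<omega> = {}")
  case True
  then show ?thesis by (auto simp: front_reach_def front_items_def)
next
  case False
  have "finite (front_items M aisle loc i \<omega>)" by (auto simp: front_items_def)
  with False have "front_reach M aisle loc i \<omega> \<le> z
      \<longleftrightarrow> (\<forall>j\<in>front_items M aisle loc i \<omega>. 2 * loc j \<omega> \<le> z)"
    by (simp add: front_reach_def Max_le_iff mult.commute)
  with False show ?thesis by (force simp: front_items_def)
qed

lemma back_reach_le_iff:
  "back_reach M aisle loc i \<omega> \<le> z \<longleftrightarrow>
    0 \<le> z \<and> (\<forall>j<M \<omega>. aisle j \<omega> = i \<and> 1/2 < loc j \<omega> \<and> loc j \<omega> \<le> 1 \<longrightarrow> 2 * (1 - loc j \<omega>) \<le> z)"
proof (cases "back_items M aisle loc i \<omega> = {}")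
  case True
  then show ?thesis by (auto simp: back_reach_def back_items_def)
next
  case False
  have "finite (back_items M aisle loc i \<omega>)" by (auto simp: back_items_def)
  with False have "back_reach M aisle loc i \<omega> \<le> z
      \<longleftrightarrow> (\<forall>j\<in>back_items M aisle loc i \<omega>. 2 * (1 - loc j \<omega>) \<le> z)"
    by (simp add: back_reach_def Max_le_iff mult.commute)
  with False show ?thesis by (force simp: back_items_def)
qed

text \<open>A half-aisle is a pair of an aisle number and a flag that is true for the front half.\<close>

definition reach where
  "reach M aisle loc c \<omega> =
     (if snd c then front_reach M aisle loc (fst c) \<omega> else back_reach M aisle loc (fst c) \<omega>)"

definition num_cell where
  "num_cell M aisle loc c \<omega> =
     (if snd c then num_front M aisle loc (fst c) \<omega> else num_back M aisle loc (fst c) \<omega>)"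

definition cell_of :: "(nat \<Rightarrow> 'a \<Rightarrow> nat) \<Rightarrow> (nat \<Rightarrow> 'a \<Rightarrow> real) \<Rightarrow> nat \<Rightarrow> 'a \<Rightarrow> nat \<times> bool" where
  "cell_of aisle loc j \<omega> = (aisle j \<omega>, loc j \<omega> \<le> 1/2)"

definition depth :: "real \<Rightarrow> real" where
  "depth u = (if u \<le> 1/2 then 2 * u else 2 * (1 - u))"

lemma depth_measurable [measurable]: "depth \<in> borel_measurable borel"
  unfolding depth_def by measurable

text \<open>
  A bound on a maximum is a condition on every item separately. The condition \<open>0 \<le> z\<close> comes
  from empty half-aisles, whose reach is 0. Locations outside the unit interval belong to neither half,
  whereas \<open>cell_of\<close> assigns a half to every location; hence the assumption.
\<close>

lemma reach_le_iff:
  assumes "\<And>j. 0 \<le> loc j \<omega> \<and> loc j \<omega> \<le> 1"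
  shows "reach M aisle loc c \<omega> \<le> z \<longleftrightarrow>
    0 \<le> z \<and> (\<forall>j<M \<omega>. cell_of aisle loc j \<omega> = c \<longrightarrow> depth (loc j \<omega>) \<le> z)"
  using assms
  by (cases c) (auto simp: reach_def front_reach_le_iff back_reach_le_iff cell_of_def depth_def not_le)

lemma reach_nonneg: "0 \<le> reach M aisle loc c \<omega>"
proof -
  have "front_reach M aisle loc (fst c) \<omega> \<ge> 0" "back_reach M aisle loc (fst c) \<omega> \<ge> 0"
    using front_reach_le_iff[of M aisle loc "fst c" \<omega> "front_reach M aisle loc (fst c) \<omega>"]
      back_reach_le_iff[of M aisle loc "fst c" \<omega> "back_reach M aisle loc (fst c) \<omega>"] by auto
  then show ?thesis by (simp add: reach_def)
qed

lemma reach_le_1: "reach M aisle loc c \<omega> \<le> 1"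
  by (auto simp: reach_def front_reach_le_iff back_reach_le_iff)

lemma num_cell_eq_sum:
  assumes "\<And>j. 0 \<le> loc j \<omega> \<and> loc j \<omega> \<le> 1"
  shows "real (num_cell M aisle loc c \<omega>) = (\<Sum>j<M \<omega>. of_bool (cell_of aisle loc j \<omega> = c))"
proof -
  have "{j. j < M \<omega> \<and> cell_of aisle loc j \<omega> = c} = 
      (if snd c then front_items M aisle loc (fst c) \<omega> else back_items M aisle loc (fst c) \<omega>)"
    using assms by (cases c) (auto simp: front_items_def back_items_def cell_of_def not_le)
  then show ?thesis
    by (auto simp: num_cell_def num_front_def num_back_def of_bool_def sum.If_cases Int_def
        lessThan_def)
qed

lemma num_cell_le: "num_cell M aisle loc c \<omega> \<le> M \<omega>"
proof -
  have "card (front_items M aisle loc (fst c) \<omega>) \<le> card {..<M \<omega>}"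
       "card (back_items M aisle loc (fst c) \<omega>) \<le> card {..<M \<omega>}"
    by (rule card_mono; auto simp: front_items_def back_items_def)+
  then show ?thesis by (auto simp: num_cell_def num_front_def num_back_def)
qed

lemma measurable_nat_of_le_sets:
  fixes f :: "'a \<Rightarrow> nat"
  assumes [measurable]: "\<And>r. Measurable.pred N (\<lambda>\<omega>. f \<omega> \<le> r)"
  shows "f \<in> measurable N (count_space UNIV)"
proof -
  have "Measurable.pred N (\<lambda>\<omega>. f \<omega> = r)" for r
  proof -
    have "(\<lambda>\<omega>. f \<omega> = r) = (\<lambda>\<omega>. f \<omega> \<le> r \<and> \<not> (r > 0 \<and> f \<omega> \<le> r - 1))" by (rule ext) auto
    then show ?thesis by simp
  qed
  then have "{\<omega> \<in> space N. f \<omega> = r} \<in> sets N" for r by (rule predE)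
  then show ?thesis
    by (auto simp: measurable_count_space_eq2_countable vimage_def Int_def conj_commute)
qed

text \<open>
  The measurable space is arbitrary here, since these facts are needed both for the underlying
  probability space and for the space of values of the random sources. The aisle numbers are then
  unbounded, so sums over the interior aisles are treated by countably many cases.
\<close>

context
  fixes N :: "'a measure" and M :: "'a \<Rightarrow> nat" and aisle :: "nat \<Rightarrow> 'a \<Rightarrow> nat"
    and loc :: "nat \<Rightarrow> 'a \<Rightarrow> real"
  assumes M [measurable]: "M \<in> measurable N (count_space UNIV)"
    and aisle [measurable]: "\<And>j. aisle j \<in> measurable N (count_space UNIV)"
    and loc [measurable]: "\<And>j. loc j \<in> borel_measurable N"
begin

lemma last_aisle_measurable: "last_aisle M aisle \<in> measurable N (count_space UNIV)"
  by (rule measurable_nat_of_le_sets) (unfold last_aisle_le_iff, measurable)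

lemma first_aisle_measurable: "first_aisle M aisle \<in> measurable N (count_space UNIV)"
  by (rule measurable_nat_of_le_sets) (unfold first_aisle_le_iff, measurable)

lemma reach_measurable: "reach M aisle loc c \<in> borel_measurable N"
proof -
  have "front_reach M aisle loc i \<in> borel_measurable N" for i
    unfolding borel_measurable_iff_le front_reach_le_iff by measurable
  moreover have "back_reach M aisle loc i \<in> borel_measurable N" for i
    unfolding borel_measurable_iff_le back_reach_le_iff by measurable
  ultimately show ?thesis unfolding reach_def[abs_def] by simp
qed

lemma num_cell_measurable: "num_cell M aisle loc c \<in> measurable N (count_space UNIV)"
  unfolding num_cell_def num_front_def num_back_def front_items_def back_items_def
  by measurable

lemma front_sum_measurable: "front_sum M aisle loc \<in> borel_measurable N"
  and back_sum_measurable: "back_sum M aisle loc \<in> borel_measurable N"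
proof -
  note [measurable] = last_aisle_measurable first_aisle_measurable
  have "(\<lambda>\<omega>. (\<lambda>(a, b) \<omega>. \<Sum>i\<in>{a<..<b}. reach M aisle loc (i, s) \<omega>)
      (first_aisle M aisle \<omega>, last_aisle M aisle \<omega>) \<omega>) \<in> borel_measurable N" for s
    by (rule measurable_compose_countable[where g="\<lambda>\<omega>. (first_aisle M aisle \<omega>, last_aisle M aisle \<omega>)"])
      (auto intro!: borel_measurable_sum reach_measurable measurable_Pair first_aisle_measurable
         last_aisle_measurable simp: pair_measure_countable[symmetric] count_space_def)
  from this[of True] this[of False] show "front_sum M aisle loc \<in> borel_measurable N" 
    "back_sum M aisle loc \<in> borel_measurable N"
    by (simp_all add: reach_def front_sum_def[abs_def] back_sum_def[abs_def] interior_aisles_def)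
qed

end

section \<open>Integration tools\<close>

lemma nn_integral_slices:
  fixes M :: "'a \<Rightarrow> nat" and F :: "'a \<Rightarrow> real"
  assumes [measurable]: "M \<in> measurable N (count_space UNIV)" "F \<in> borel_measurable N"
    and nonneg: "AE \<omega> in N. 0 \<le> F \<omega>"
    and int: "\<And>n. integrable N (\<lambda>\<omega>. of_bool (M \<omega> = n) * F \<omega>)"
  shows "(\<integral>\<^sup>+\<omega>. F \<omega> \<partial>N) = (\<Sum>n. ennreal (\<integral>\<omega>. of_bool (M \<omega> = n) * F \<omega> \<partial>N))"
proof -
  have "(\<Sum>n. ennreal (of_bool (M \<omega> = n) * F \<omega>)) = ennreal (F \<omega>)" for \<omega>
  proof -
    have "(\<lambda>n. ennreal (of_bool (M \<omega> = n) * F \<omega>)) sums (\<Sum>n\<in>{M \<omega>}. ennreal (of_bool (M \<omega> = n) * F \<omega>))"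
      by (rule sums_finite) auto
    then show ?thesis by (simp add: sums_iff)
  qed
  then have "(\<integral>\<^sup>+\<omega>. F \<omega> \<partial>N) = (\<integral>\<^sup>+\<omega>. (\<Sum>n. ennreal (of_bool (M \<omega> = n) * F \<omega>)) \<partial>N)" by simp
  also have "\<dots> = (\<Sum>n. \<integral>\<^sup>+\<omega>. ennreal (of_bool (M \<omega> = n) * F \<omega>) \<partial>N)"
    by (rule nn_integral_suminf) measurable
  also have "\<dots> = (\<Sum>n. ennreal (\<integral>\<omega>. of_bool (M \<omega> = n) * F \<omega> \<partial>N))"
    using nonneg by (intro suminf_cong nn_integral_eq_integral int) (auto elim!: eventually_mono)
  finally show ?thesis .
qed

text \<open>
  Independence can be applied only with the number of items fixed. For nonnegative functions it is
  enough to compare the integrals over each event \<open>M = n\<close>, by monotone convergence; the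
  integrability of \<open>F'\<close> is then passed on to \<open>F\<close>.
\<close>

lemma has_bochner_integral_slices:
  fixes M :: "'a \<Rightarrow> nat" and F F' :: "'a \<Rightarrow> real"
  assumes M [measurable]: "M \<in> measurable N (count_space UNIV)"
    and F [measurable]: "F \<in> borel_measurable N"
    and nonneg: "AE \<omega> in N. 0 \<le> F \<omega>" "AE \<omega> in N. 0 \<le> F' \<omega>"
    and F': "integrable N F'"
    and int: "\<And>n. integrable N (\<lambda>\<omega>. of_bool (M \<omega> = n) * F \<omega>)"
    and eq: "\<And>n. (\<integral>\<omega>. of_bool (M \<omega> = n) * F \<omega> \<partial>N) = (\<integral>\<omega>. of_bool (M \<omega> = n) * F' \<omega> \<partial>N)"
  shows "has_bochner_integral N F (\<integral>\<omega>. F' \<omega> \<partial>N)"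
proof -
  have [measurable]: "F' \<in> borel_measurable N" using F' by auto
  have int': "integrable N (\<lambda>\<omega>. of_bool (M \<omega> = n) * F' \<omega>)" for n
    by (rule Bochner_Integration.integrable_bound[OF F']) auto
  have nn: "(\<integral>\<^sup>+\<omega>. F \<omega> \<partial>N) = (\<integral>\<^sup>+\<omega>. F' \<omega> \<partial>N)"
    using nn_integral_slices[OF M F nonneg(1) int] nn_integral_slices[OF M _ nonneg(2) int'] eq
    by simp
  have "integrable N F"
    using nn nn_integral_eq_integral[OF F' nonneg(2)] nonneg(1)
    by (intro integrableI_nonneg) auto
  moreover have "(\<integral>\<omega>. F \<omega> \<partial>N) = (\<integral>\<omega>. F' \<omega> \<partial>N)"
    using nn nonneg by (simp add: integral_eq_nn_integral)
  ultimately show ?thesis by (simp add: has_bochner_integral_iff)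
qed

text \<open>
  The reason is \<open>1 - A ^ Suc k = (\<integral>z\<in>{0..1}. Suc k * z ^ k * of_bool (A \<le> z))\<close>,
  multiplied by \<open>W\<close> and integrated with the two integrals exchanged. The conclusion includes the
  integrability in \<open>z\<close>, so that it need not be derived from continuity of the distribution
  functions to which this is applied.
\<close>

lemma (in prob_space) layer_cake_has_integral:
  fixes W A :: "'a \<Rightarrow> real"
  assumes W: "integrable M W" and [measurable]: "A \<in> borel_measurable M"
    and A: "\<And>\<omega>. 0 \<le> A \<omega>" "\<And>\<omega>. A \<omega> \<le> 1"
  shows "((\<lambda>z. real (Suc k) * z ^ k * (\<integral>\<omega>. W \<omega> * of_bool (A \<omega> \<le> z) \<partial>M))
    has_integral ((\<integral>\<omega>. W \<omega> \<partial>M) - (\<integral>\<omega>. W \<omega> * A \<omega> ^ Suc k \<partial>M))) {0..1}"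
proof -
  interpret pair_sigma_finite lborel M ..
  have [measurable]: "W \<in> borel_measurable M" using W by auto
  define H where "H z = (\<integral>\<omega>. W \<omega> * of_bool (A \<omega> \<le> z) \<partial>M)" for z
  define f where "f = (\<lambda>(z, \<omega>). indicator {0..1} z * (real (Suc k) * z ^ k) * (W \<omega> * of_bool (A \<omega> \<le> z)))"
  have f_meas [measurable]: "f \<in> borel_measurable (lborel \<Otimes>\<^sub>M M)"
    unfolding f_def by measurable
  have intW: "integrable M (\<lambda>\<omega>. W \<omega> * of_bool (A \<omega> \<le> z))" for z
    by (rule Bochner_Integration.integrable_bound[OF W]) (auto simp: of_bool_def)
  have int_f: "integrable (lborel \<Otimes>\<^sub>M M) f"
  proof (rule Fubini_integrable[OF f_meas])
    show "integrable lborel (\<lambda>z. \<integral>\<omega>. norm (f (z, \<omega>)) \<partial>M)"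
    proof (rule Bochner_Integration.integrable_bound)
      show "integrable lborel (\<lambda>z::real. indicator {0..1} z * (real (Suc k) * (\<integral>\<omega>. \<bar>W \<omega>\<bar> \<partial>M)) :: real)"
        by (intro integrable_mult_left integrable_real_indicator) auto
      show "(\<lambda>z. \<integral>\<omega>. norm (f (z, \<omega>)) \<partial>M) \<in> borel_measurable lborel" by measurable
      show "AE z in lborel. norm (\<integral>\<omega>. norm (f (z, \<omega>)) \<partial>M)
          \<le> norm (indicator {0..1} z * (real (Suc k) * (\<integral>\<omega>. \<bar>W \<omega>\<bar> \<partial>M)) :: real)"
      proof (rule AE_I2)
        fix z :: real
        have int1: "integrable M (\<lambda>\<omega>. real (Suc k) * \<bar>W \<omega>\<bar>)" using W by simp
        have "(\<integral>\<omega>. norm (f (z, \<omega>)) \<partial>M) \<le> (\<integral>\<omega>. real (Suc k) * \<bar>W \<omega>\<bar> \<partial>M)" if z: "z \<in> {0..1}"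
        proof (rule integral_mono[OF _ int1])
          show "norm (f (z, \<omega>)) \<le> real (Suc k) * \<bar>W \<omega>\<bar>" for \<omega>
          proof -
            have "\<bar>(real (Suc k) * z ^ k) * (W \<omega> * of_bool (A \<omega> \<le> z))\<bar> \<le> (real (Suc k) * 1) * (\<bar>W \<omega>\<bar> * 1)"
              unfolding abs_mult using z
              by (intro mult_mono) (auto simp: power_le_one)
            then show ?thesis using z by (simp add: f_def)
          qed
          show "integrable M (\<lambda>\<omega>. norm (f (z, \<omega>)))"
            unfolding f_def by (simp add: intW)
        qed
        then show "norm (\<integral>\<omega>. norm (f (z, \<omega>)) \<partial>M) \<le> norm (indicator {0..1} z * (real (Suc k) * (\<integral>\<omega>. \<bar>W \<omega>\<bar> \<partial>M)) :: real)"
          by (cases "z \<in> {0..1}") (auto simp: f_def)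
      qed
    qed
    show "AE z in lborel. integrable M (\<lambda>\<omega>. f (z, \<omega>))"
      unfolding f_def by (simp add: intW)
  qed
  have inner: "(\<integral>\<omega>. f (z, \<omega>) \<partial>M) = indicator {0..1} z * (real (Suc k) * z ^ k * H z)" for z
    by (simp add: f_def H_def)
  have outer: "(\<integral>z. f (z, \<omega>) \<partial>lborel) = W \<omega> - W \<omega> * A \<omega> ^ Suc k" for \<omega>
  proof -
    have "f (z, \<omega>) = (real (Suc k) * W \<omega>) * (z ^ k * indicator {A \<omega>..1} z)" for z
      using A[of \<omega>] by (auto simp: f_def indicator_def)
    then have "(\<integral>z. f (z, \<omega>) \<partial>lborel) = (real (Suc k) * W \<omega>) * ((1 - A \<omega> ^ Suc k) / real (Suc k))"
      using A[of \<omega>] integral_power[of "A \<omega>" 1 k] by (simp del: of_nat_Suc)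
    also have "\<dots> = W \<omega> - W \<omega> * A \<omega> ^ Suc k"
      by (simp del: of_nat_Suc power_Suc) (simp only: right_diff_distrib mult_1_right)
    finally show ?thesis .
  qed
  have intWA: "integrable M (\<lambda>\<omega>. W \<omega> * A \<omega> ^ Suc k)"
  proof (rule Bochner_Integration.integrable_bound[OF W])
    show "AE \<omega> in M. norm (W \<omega> * A \<omega> ^ Suc k) \<le> norm (W \<omega>)"
      using A by (intro AE_I2) (auto simp: abs_mult power_abs simp del: power_Suc intro!: mult_left_le power_le_one)
  qed measurable
  have si: "set_integrable lborel {0..1} (\<lambda>z. real (Suc k) * z ^ k * H z)"
    using integrable_fst'[OF int_f] unfolding inner set_integrable_def by simp
  have "(\<integral>z\<in>{0..1}. real (Suc k) * z ^ k * H z \<partial>lborel) = (\<integral>z. (\<integral>\<omega>. f (z, \<omega>) \<partial>M) \<partial>lborel)"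
    unfolding inner set_lebesgue_integral_def by simp
  also have "\<dots> = (\<integral>\<omega>. (\<integral>z. f (z, \<omega>) \<partial>lborel) \<partial>M)"
    using integral_fst'[OF int_f] integral_snd[of "\<lambda>z \<omega>. f (z, \<omega>)"] int_f by simp
  also have "\<dots> = (\<integral>\<omega>. W \<omega> \<partial>M) - (\<integral>\<omega>. W \<omega> * A \<omega> ^ Suc k \<partial>M)"
    unfolding outer using W intWA by (simp del: power_Suc)
  finally show ?thesis
    using set_borel_integral_eq_integral[OF si] unfolding H_def[symmetric]
    by (metis has_integral_integral)
qed

text \<open>
  The derivative of \<open>pgf\<close>, taken under the expectation. The truncated subtraction is harmless
  because the other factor vanishes for \<open>M \<omega> = 0\<close>.
\<close>

definition pgf_deriv :: "'a measure \<Rightarrow> ('a \<Rightarrow> nat) \<Rightarrow> real \<Rightarrow> real" where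
  "pgf_deriv N M x = (\<integral>\<omega>. real (M \<omega>) * x ^ (M \<omega> - 1) \<partial>N)"

text \<open>
  Provides the majorant for dominated convergence of the difference quotients of a generating
  function; it does not depend on the two points, so the end point 1 is covered.
\<close>

lemma power_quotient_bound:
  fixes x y :: real
  assumes "x \<in> {0..1}" "y \<in> {0..1}"
  shows "\<bar>(y ^ n - x ^ n) / (y - x)\<bar> \<le> real n"
proof (cases "y = x")
  case False
  have "y ^ n - x ^ n = (y - x) * (\<Sum>i<n. x ^ (n - Suc i) * y ^ i)"
    by (rule power_diff_sumr2)
  then have "(y ^ n - x ^ n) / (y - x) = (\<Sum>i<n. x ^ (n - Suc i) * y ^ i)" using False by simp
  moreover have "\<bar>\<Sum>i<n. x ^ (n - Suc i) * y ^ i\<bar> \<le> (\<Sum>i<n. 1)"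
    using assms by (intro order.trans[OF sum_abs] sum_mono)
      (auto simp: abs_mult power_abs intro!: mult_le_one power_le_one)
  ultimately show ?thesis by simp
qed simp

lemma (in prob_space) pgf_has_derivative:
  fixes L :: "'a \<Rightarrow> nat"
  assumes int: "integrable M (\<lambda>\<omega>. real (L \<omega>))" and [measurable]: "L \<in> measurable M (count_space UNIV)"
    and x: "x \<in> {0..1}"
  shows "(pgf M L has_real_derivative pgf_deriv M L x) (at x within {0..1})"
  unfolding has_field_derivative_iff tendsto_at_iff_sequentially
proof (intro allI impI)
  fix X :: "nat \<Rightarrow> real" assume X: "\<forall>i. X i \<in> {0..1} - {x}" "X \<longlonglongrightarrow> x"
  have intp: "integrable M (\<lambda>\<omega>. y ^ L \<omega>)" if "y \<in> {0..1}" for y :: real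
    by (rule integrable_const_bound[where B=1]) (use that in \<open>auto intro: power_le_one\<close>)
  have eq: "(pgf M L (X i) - pgf M L x) / (X i - x) = (\<integral>\<omega>. (X i ^ L \<omega> - x ^ L \<omega>) / (X i - x) \<partial>M)" for i
    using intp[of "X i"] intp[OF x] X by (simp add: pgf_def)
  have "(\<lambda>i. \<integral>\<omega>. (X i ^ L \<omega> - x ^ L \<omega>) / (X i - x) \<partial>M) \<longlonglongrightarrow> pgf_deriv M L x"
    unfolding pgf_deriv_def
  proof (rule integral_dominated_convergence[OF _ _ int])
    show "AE \<omega> in M. (\<lambda>i. (X i ^ L \<omega> - x ^ L \<omega>) / (X i - x)) \<longlonglongrightarrow> real (L \<omega>) * x ^ (L \<omega> - 1)"
    proof (rule AE_I2)
      fix \<omega>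
      have "((\<lambda>y. y ^ L \<omega>) has_real_derivative real (L \<omega>) * x ^ (L \<omega> - 1)) (at x within {0..1})"
        by (auto intro!: derivative_eq_intros)
      then show "(\<lambda>i. (X i ^ L \<omega> - x ^ L \<omega>) / (X i - x)) \<longlonglongrightarrow> real (L \<omega>) * x ^ (L \<omega> - 1)"
        using X unfolding has_field_derivative_iff tendsto_at_iff_sequentially by (auto simp: comp_def)
    qed
    show "AE \<omega> in M. norm ((X i ^ L \<omega> - x ^ L \<omega>) / (X i - x)) \<le> real (L \<omega>)" for i
      using power_quotient_bound[OF x] X by auto
  qed measurable
  then show "((\<lambda>y. (pgf M L y - pgf M L x) / (y - x)) \<circ> X) \<longlonglongrightarrow> pgf_deriv M L x"
    by (simp add: comp_def eq)
qed

lemma deriv01_eq: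
  assumes "(f has_real_derivative D) (at x within {0..1})" "x \<in> {0..1}"
  shows "deriv01 f x = D"
  unfolding deriv01_def using assms
  by (intro vector_derivative_within_closed_interval)
    (auto simp: has_real_derivative_iff_has_vector_derivative)

context order_picking
begin

section \<open>Independence of the order size and the items\<close>

abbreviation source_value :: "source \<Rightarrow> 'a \<Rightarrow> real" where
  "source_value s \<omega> \<equiv> (case s of
          Order_Size \<Rightarrow> real (M \<omega>)
        | Item_Aisle j \<Rightarrow> real (aisle j \<omega>)
        | Item_Loc j \<Rightarrow> loc j \<omega>
        | Item_Pick j \<Rightarrow> pick j \<omega>)"

lemmas [measurable] = M_measurable aisle_measurable loc_measurable P_measurable pick_measurable

lemma M_integrable: "integrable \<Omega> (\<lambda>\<omega>. real (M \<omega>))"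
proof (rule Bochner_Integration.integrable_bound[OF M_square_integrable])
  have "real n \<le> (real n)\<^sup>2" for n by (cases n) (auto simp: power2_eq_square)
  then show "AE \<omega> in \<Omega>. norm (real (M \<omega>)) \<le> norm ((real (M \<omega>))\<^sup>2)" by simp
qed measurable

lemma prob_aisle:
  assumes "a \<in> {1..k}"
  shows "prob {\<omega> \<in> space \<Omega>. aisle j \<omega> = a} = 1 / real k"
proof -
  have "prob {\<omega> \<in> space \<Omega>. aisle j \<omega> = a} = measure (distr \<Omega> (count_space UNIV) (aisle j)) {a}"
    by (subst measure_distr) (auto intro!: arg_cong[where f=prob])
  also have "\<dots> = 1 / real k"
    using assms k_ge_1 unfolding aisle_uniform by (subst measure_pmf_of_set) auto
  finally show ?thesis .
qed

lemma prob_loc: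
  assumes [measurable]: "U \<in> sets borel" and "U \<inter> {0..1} = S"
  shows "prob {\<omega> \<in> space \<Omega>. loc j \<omega> \<in> U} = measure lborel S"
proof -
  have "prob {\<omega> \<in> space \<Omega>. loc j \<omega> \<in> U} = measure (distr \<Omega> borel (loc j)) U"
    by (subst measure_distr) (auto intro!: arg_cong[where f=prob])
  also have "\<dots> = measure lborel S"
    using assms unfolding loc_uniform by (subst measure_uniform_measure) (auto simp: Int_commute)
  finally show ?thesis .
qed

lemma AE_items_in_range: "AE \<omega> in \<Omega>. \<forall>j. aisle j \<omega> \<in> {1..k} \<and> 0 \<le> loc j \<omega> \<and> loc j \<omega> \<le> 1"
proof -
  have aisles: "AE \<omega> in \<Omega>. aisle j \<omega> \<in> {1..k}" for j
  proof -
    have "AE a in distr \<Omega> (count_space UNIV) (aisle j). a \<in> {1..k}"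
      using k_ge_1 unfolding aisle_uniform by (simp add: AE_measure_pmf_iff)
    then show ?thesis by (subst (asm) AE_distr_iff) auto
  qed
  have locs: "AE \<omega> in \<Omega>. 0 \<le> loc j \<omega> \<and> loc j \<omega> \<le> 1" for j
  proof -
    have "AE u in distr \<Omega> borel (loc j). 0 \<le> u \<and> u \<le> 1"
      unfolding loc_uniform by (rule AE_uniform_measureI) auto
    then show ?thesis by (subst (asm) AE_distr_iff) auto
  qed
  have "AE \<omega> in \<Omega>. aisle j \<omega> \<in> {1..k} \<and> 0 \<le> loc j \<omega> \<and> loc j \<omega> \<le> 1" for j
    using aisles[of j] locs[of j] by eventually_elim simp
  then show ?thesis by (simp add: AE_all_countable)
qed

text \<open>
  The map \<open>depth\<close> folds the unit interval at \<open>1/2\<close> and stretches each half by the factor 2,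
  so it takes the uniform distribution on either half to the uniform distribution on
  \<open>[0, 1]\<close>.
\<close>

lemma prob_cell_depth:
  assumes a: "fst c \<in> {1..k}" and t: "0 \<le> t" "t \<le> 1"
  shows "prob {\<omega> \<in> space \<Omega>. cell_of aisle loc j \<omega> = c \<and> depth (loc j \<omega>) \<le> t} = t / (2 * real k)"
proof -
  define U where "U = {u. (u \<le> 1/2 \<longleftrightarrow> snd c) \<and> depth u \<le> t}"
  have U [measurable]: "U \<in> sets borel" unfolding U_def by measurable
  have "measure lborel (U \<inter> {0..1}) = t / 2"
  proof (cases "snd c")
    case True
    then have "U \<inter> {0..1} = {0..t/2}" using t by (auto simp: U_def depth_def)
    then show ?thesis using t by simp
  next
    case False
    show ?thesis
    \<comment> \<open>the back half does not contain its end point \<open>1/2\<close>, at which the depth is 1\<close>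
    proof (cases "t = 1")
      case True
      then have "U \<inter> {0..1} = {1/2<..1}" using False by (auto simp: U_def depth_def)
      then show ?thesis using True by simp
    next
      case t1: False
      then have "U \<inter> {0..1} = {1 - t/2..1}" using False t by (auto simp: U_def depth_def)
      then show ?thesis using t by simp
    qed
  qed
  then have locU: "prob {\<omega> \<in> space \<Omega>. loc j \<omega> \<in> U} = t / 2" by (simp add: prob_loc)
  define A where "A s = (case s of Item_Aisle _ \<Rightarrow> {real (fst c)} | _ \<Rightarrow> U)" for s :: source
  have "prob (\<Inter>s\<in>{Item_Aisle j, Item_Loc j}. source_value s -` A s \<inter> space \<Omega>) =
      (\<Prod>s\<in>{Item_Aisle j, Item_Loc j}. prob (source_value s -` A s \<inter> space \<Omega>))"
    by (rule indep_varsD[OF independent]) (auto simp: A_def U split: source.split)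
  also have "(\<Inter>s\<in>{Item_Aisle j, Item_Loc j}. source_value s -` A s \<inter> space \<Omega>) =
     {\<omega> \<in> space \<Omega>. cell_of aisle loc j \<omega> = c \<and> depth (loc j \<omega>) \<le> t}"
    by (cases c) (auto simp: A_def U_def cell_of_def)
  also have "(\<Prod>s\<in>{Item_Aisle j, Item_Loc j}. prob (source_value s -` A s \<inter> space \<Omega>)) =
     prob {\<omega> \<in> space \<Omega>. aisle j \<omega> = fst c} * prob {\<omega> \<in> space \<Omega>. loc j \<omega> \<in> U}"
    by (auto simp: A_def intro!: arg_cong2[where f="(*)"] arg_cong[where f=prob])
  also have "\<dots> = t / (2 * real k)" using a by (simp add: prob_aisle locU)
  finally show ?thesis .
qed

lemma expectation_size_prod_items:
  fixes \<phi> :: "nat \<Rightarrow> real" and h :: "nat \<Rightarrow> nat \<times> real \<Rightarrow> real"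
  assumes \<phi>: "\<And>i. \<bar>\<phi> i\<bar> \<le> 1" 
    and h_meas [measurable]: "\<And>j. h j \<in> borel_measurable (count_space UNIV \<Otimes>\<^sub>M borel)"
    and h: "\<And>j x. \<bar>h j x\<bar> \<le> 1"
  shows "integrable \<Omega> (\<lambda>\<omega>. \<phi> (M \<omega>) * (\<Prod>j<n. h j (aisle j \<omega>, loc j \<omega>)))"
    and "expectation (\<lambda>\<omega>. \<phi> (M \<omega>) * (\<Prod>j<n. h j (aisle j \<omega>, loc j \<omega>))) =
      expectation (\<lambda>\<omega>. \<phi> (M \<omega>)) * (\<Prod>j<n. expectation (\<lambda>\<omega>. h j (aisle j \<omega>, loc j \<omega>)))"
proof -
  \<comment> \<open>the indices below \<open>n\<close> stand for the items, and the index \<open>n\<close> for the order size\<close>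
  define K where "K i = (if i = n then {Order_Size} else {Item_Aisle i, Item_Loc i})" for i
  define Y where "Y i y = (if i = n then \<phi> (nat \<lfloor>y Order_Size\<rfloor>)
     else h i (nat \<lfloor>y (Item_Aisle i)\<rfloor>, y (Item_Loc i)))" for i and y :: "source \<Rightarrow> real"
  define Z where "Z i \<omega> = (if i = n then \<phi> (M \<omega>) else h i (aisle i \<omega>, loc i \<omega>))" for i \<omega>
  have "indep_vars (\<lambda>i. PiM (K i) (\<lambda>_. borel)) (\<lambda>i \<omega>. restrict (\<lambda>s. source_value s \<omega>) (K i)) {..n}"
    by (rule indep_vars_restrict[OF independent]) (auto simp: disjoint_family_on_def K_def)
  then have "indep_vars (\<lambda>_. borel) (\<lambda>i \<omega>. Y i (restrict (\<lambda>s. source_value s \<omega>) (K i))) {..n}"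
  proof (rule indep_vars_compose2)
    show "Y i \<in> borel_measurable (PiM (K i) (\<lambda>_. borel))" for i
    proof (cases "i = n")
      case True
      have [measurable]: "(\<lambda>y. y Order_Size) \<in> borel_measurable (PiM (K i) (\<lambda>_. borel :: real measure))"
        using True by (intro measurable_component_singleton) (simp add: K_def)
      have [measurable]: "\<phi> \<in> borel_measurable (count_space UNIV)" by simp
      have "(\<lambda>y :: source \<Rightarrow> real. \<phi> (nat \<lfloor>y Order_Size\<rfloor>)) \<in> borel_measurable (PiM (K i) (\<lambda>_. borel))" by measurable
      then show ?thesis using True by (simp add: Y_def[abs_def])
    next
      case False
      have [measurable]: "(\<lambda>y. y (Item_Aisle i)) \<in> borel_measurable (PiM (K i) (\<lambda>_. borel :: real measure))"
           "(\<lambda>y. y (Item_Loc i)) \<in> borel_measurable (PiM (K i) (\<lambda>_. borel :: real measure))"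
        using False by (auto intro!: measurable_component_singleton simp: K_def)
      show ?thesis using False unfolding Y_def[abs_def] by simp
    qed
  qed
  also have "(\<lambda>i \<omega>. Y i (restrict (\<lambda>s. source_value s \<omega>) (K i))) = Z"
    by (intro ext) (auto simp: Y_def Z_def K_def)
  finally have ind: "indep_vars (\<lambda>_. borel) Z {..n}" .
  have [measurable]: "Z i \<in> borel_measurable \<Omega>" for i unfolding Z_def[abs_def] by measurable
  have int: "integrable \<Omega> (Z i)" for i
    by (rule integrable_const_bound[where B=1]) (auto simp: Z_def \<phi> h)
  have Zeq: "(\<Prod>i\<le>n. Z i \<omega>) = \<phi> (M \<omega>) * (\<Prod>j<n. h j (aisle j \<omega>, loc j \<omega>))" for \<omega>
    by (auto simp: lessThan_Suc_atMost[symmetric] Z_def mult.commute intro!: prod.cong)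
  show "integrable \<Omega> (\<lambda>\<omega>. \<phi> (M \<omega>) * (\<Prod>j<n. h j (aisle j \<omega>, loc j \<omega>)))"
    using indep_vars_integrable[OF _ ind int] unfolding Zeq by simp
  have "expectation (\<lambda>\<omega>. \<phi> (M \<omega>) * (\<Prod>j<n. h j (aisle j \<omega>, loc j \<omega>))) = (\<Prod>i\<le>n. expectation (Z i))"
    using indep_vars_lebesgue_integral[OF _ ind int] unfolding Zeq by simp
  also have "\<dots> = expectation (\<lambda>\<omega>. \<phi> (M \<omega>)) * (\<Prod>j<n. expectation (\<lambda>\<omega>. h j (aisle j \<omega>, loc j \<omega>)))"
    by (auto simp: lessThan_Suc_atMost[symmetric] Z_def[abs_def] mult.commute intro!: prod.cong)
  finally show "expectation (\<lambda>\<omega>. \<phi> (M \<omega>) * (\<Prod>j<n. h j (aisle j \<omega>, loc j \<omega>))) =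
      expectation (\<lambda>\<omega>. \<phi> (M \<omega>)) * (\<Prod>j<n. expectation (\<lambda>\<omega>. h j (aisle j \<omega>, loc j \<omega>)))" .
qed

lemma expectation_prod_items:
  fixes h :: "nat \<times> real \<Rightarrow> real"
  assumes [measurable]: "h \<in> borel_measurable (count_space UNIV \<Otimes>\<^sub>M borel)"
    and h: "\<And>x. 0 \<le> h x" "\<And>x. h x \<le> 1"
    and q: "\<And>j. expectation (\<lambda>\<omega>. h (aisle j \<omega>, loc j \<omega>)) = q"
  shows "expectation (\<lambda>\<omega>. \<Prod>j<M \<omega>. h (aisle j \<omega>, loc j \<omega>)) = pgf \<Omega> M q"
proof -
  have q01: "0 \<le> q" "q \<le> 1"
    using q[of 0] h by (auto intro!: integral_nonneg integral_le_const integrable_const_bound[where B=1])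
  show ?thesis
    unfolding pgf_def
  proof (rule has_bochner_integral_integral_eq[OF has_bochner_integral_slices[where M=M]])
    show "(\<lambda>\<omega>. \<Prod>j<M \<omega>. h (aisle j \<omega>, loc j \<omega>)) \<in> borel_measurable \<Omega>"
      by (rule measurable_compose_countable[OF _ M_measurable]) measurable
    show "AE \<omega> in \<Omega>. 0 \<le> (\<Prod>j<M \<omega>. h (aisle j \<omega>, loc j \<omega>))"
      using h by (auto intro!: prod_nonneg)
    show "AE \<omega> in \<Omega>. 0 \<le> q ^ M \<omega>" using q01 by simp
    show "integrable \<Omega> (\<lambda>\<omega>. q ^ M \<omega>)"
      by (rule integrable_const_bound[where B=1]) (use q01 in \<open>auto intro: power_le_one\<close>)
    have eq: "of_bool (M \<omega> = n) * (\<Prod>j<M \<omega>. h (aisle j \<omega>, loc j \<omega>)) =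
       of_bool (M \<omega> = n) * (\<Prod>j<n. h (aisle j \<omega>, loc j \<omega>))" for n \<omega> by simp
    have eq': "of_bool (M \<omega> = n) * q ^ M \<omega> = of_bool (M \<omega> = n) * q ^ n" for n \<omega> by simp
    show "integrable \<Omega> (\<lambda>\<omega>. of_bool (M \<omega> = n) * (\<Prod>j<M \<omega>. h (aisle j \<omega>, loc j \<omega>)))" for n
      unfolding eq using h by (intro expectation_size_prod_items(1)) (auto simp: abs_of_nonneg)
    show "expectation (\<lambda>\<omega>. of_bool (M \<omega> = n) * (\<Prod>j<M \<omega>. h (aisle j \<omega>, loc j \<omega>))) =
        expectation (\<lambda>\<omega>. of_bool (M \<omega> = n) * q ^ M \<omega>)" for n
      unfolding eq eq' using h
      by (subst expectation_size_prod_items(2)[where \<phi>="\<lambda>i. of_bool (i = n)"]) 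
        (auto simp: q)
  qed (rule M_measurable)
qed

text \<open>
  The sum marks one of the items. Given \<open>M = n\<close> there are \<open>n\<close> choices, and the marked item
  replaces one factor \<open>q\<close> by \<open>p\<close>. This gives \<open>n * p * q ^ (n - 1)\<close>, hence the
  derivative of the generating function.
\<close>

lemma expectation_sum_prod_items:
  fixes h \<psi> :: "nat \<times> real \<Rightarrow> real"
  assumes [measurable]: "h \<in> borel_measurable (count_space UNIV \<Otimes>\<^sub>M borel)"
    "\<psi> \<in> borel_measurable (count_space UNIV \<Otimes>\<^sub>M borel)"
    and h: "\<And>x. 0 \<le> h x" "\<And>x. h x \<le> 1" and \<psi>: "\<And>x. 0 \<le> \<psi> x" "\<And>x. \<psi> x \<le> 1"
    and p: "\<And>j. expectation (\<lambda>\<omega>. \<psi> (aisle j \<omega>, loc j \<omega>) * h (aisle j \<omega>, loc j \<omega>)) = p"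
    and q: "\<And>j. expectation (\<lambda>\<omega>. h (aisle j \<omega>, loc j \<omega>)) = q"
  shows "expectation (\<lambda>\<omega>. (\<Sum>i<M \<omega>. \<psi> (aisle i \<omega>, loc i \<omega>)) * (\<Prod>j<M \<omega>. h (aisle j \<omega>, loc j \<omega>)))
    = p * pgf_deriv \<Omega> M q"
proof -
  have q01: "0 \<le> q" "q \<le> 1"
    using q[of 0] h by (auto intro!: integral_nonneg integral_le_const integrable_const_bound[where B=1])
  have p0: "0 \<le> p"
    using p[of 0] h \<psi> by (auto intro!: integral_nonneg)
  have int: "integrable \<Omega> (\<lambda>\<omega>. real (M \<omega>) * q ^ (M \<omega> - 1))"
  proof (rule Bochner_Integration.integrable_bound[OF M_integrable])
    show "AE \<omega> in \<Omega>. norm (real (M \<omega>) * q ^ (M \<omega> - 1)) \<le> norm (real (M \<omega>))"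
      using q01 by (auto simp: abs_mult intro!: mult_left_le power_le_one)
  qed measurable
  define g where "g i j x = h x * (if j = i then \<psi> x else 1)" for i j :: nat and x
  have g_meas [measurable]: "g i j \<in> borel_measurable (count_space UNIV \<Otimes>\<^sub>M borel)" for i j
    unfolding g_def[abs_def] by measurable
  have g: "\<bar>g i j x\<bar> \<le> 1" for i j x
    unfolding g_def using h[of x] \<psi>[of x] by (simp add: abs_mult mult_le_one)
  have Eg: "expectation (\<lambda>\<omega>. g i j (aisle j \<omega>, loc j \<omega>)) = (if j = i then p else q)" for i j
    using p q by (auto simp: g_def mult.commute)
  have mark: "\<psi> (aisle i \<omega>, loc i \<omega>) * (\<Prod>j<n. h (aisle j \<omega>, loc j \<omega>)) = (\<Prod>j<n. g i j (aisle j \<omega>, loc j \<omega>))"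
    if "i < n" for i n \<omega>
    using that unfolding g_def prod.distrib by (simp add: prod.delta mult.commute)
  have eq: "of_bool (M \<omega> = n) * ((\<Sum>i<M \<omega>. \<psi> (aisle i \<omega>, loc i \<omega>)) * (\<Prod>j<M \<omega>. h (aisle j \<omega>, loc j \<omega>))) =
     (\<Sum>i<n. of_bool (M \<omega> = n) * (\<Prod>j<n. g i j (aisle j \<omega>, loc j \<omega>)))" for n \<omega>
    by (auto simp: sum_distrib_right mark intro!: sum.cong)
  note slice = expectation_size_prod_items[where \<phi>="\<lambda>i. of_bool (i = n)" for n]
  have "expectation (\<lambda>\<omega>. (\<Sum>i<M \<omega>. \<psi> (aisle i \<omega>, loc i \<omega>)) * (\<Prod>j<M \<omega>. h (aisle j \<omega>, loc j \<omega>)))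
    = expectation (\<lambda>\<omega>. p * (real (M \<omega>) * q ^ (M \<omega> - 1)))"
  proof (rule has_bochner_integral_integral_eq[OF has_bochner_integral_slices[where M=M]])
    show "(\<lambda>\<omega>. (\<Sum>i<M \<omega>. \<psi> (aisle i \<omega>, loc i \<omega>)) * (\<Prod>j<M \<omega>. h (aisle j \<omega>, loc j \<omega>))) \<in> borel_measurable \<Omega>"
      by (rule measurable_compose_countable[OF _ M_measurable]) measurable
    show "AE \<omega> in \<Omega>. 0 \<le> (\<Sum>i<M \<omega>. \<psi> (aisle i \<omega>, loc i \<omega>)) * (\<Prod>j<M \<omega>. h (aisle j \<omega>, loc j \<omega>))"
      using h \<psi> by (auto intro!: prod_nonneg sum_nonneg mult_nonneg_nonneg)
    show "AE \<omega> in \<Omega>. 0 \<le> p * (real (M \<omega>) * q ^ (M \<omega> - 1))" using q01 p0 by simp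
    show "integrable \<Omega> (\<lambda>\<omega>. p * (real (M \<omega>) * q ^ (M \<omega> - 1)))" using int by simp
    show "integrable \<Omega> (\<lambda>\<omega>. of_bool (M \<omega> = n) *
        ((\<Sum>i<M \<omega>. \<psi> (aisle i \<omega>, loc i \<omega>)) * (\<Prod>j<M \<omega>. h (aisle j \<omega>, loc j \<omega>))))" for n
      unfolding eq by (intro Bochner_Integration.integrable_sum slice(1)) (auto simp: g)
    fix n
    have "expectation (\<lambda>\<omega>. of_bool (M \<omega> = n) *
        ((\<Sum>i<M \<omega>. \<psi> (aisle i \<omega>, loc i \<omega>)) * (\<Prod>j<M \<omega>. h (aisle j \<omega>, loc j \<omega>)))) =
      (\<Sum>i<n. expectation (\<lambda>\<omega>. of_bool (M \<omega> = n) * (\<Prod>j<n. g i j (aisle j \<omega>, loc j \<omega>))))"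
      unfolding eq by (intro Bochner_Integration.integral_sum slice(1)) (auto simp: g)
    also have "\<dots> = (\<Sum>i<n. expectation (\<lambda>\<omega>. of_bool (M \<omega> = n)) * (\<Prod>j<n. if j = i then p else q))"
      by (subst slice(2)) (auto simp: g Eg)
    also have "\<dots> = (\<Sum>i<n. expectation (\<lambda>\<omega>. of_bool (M \<omega> = n)) * (p * q ^ (n - 1)))"
      by (intro sum.cong refl arg_cong2[where f="(*)"])
        (auto simp: prod.If_cases Int_absorb1 Diff_eq[symmetric] card_Diff_singleton)
    also have "\<dots> = expectation (\<lambda>\<omega>. of_bool (M \<omega> = n) * (p * (real n * q ^ (n - 1))))"
      by simp
    also have "\<dots> = expectation (\<lambda>\<omega>. of_bool (M \<omega> = n) * (p * (real (M \<omega>) * q ^ (M \<omega> - 1))))"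
      by (intro Bochner_Integration.integral_cong) auto
    finally show "expectation (\<lambda>\<omega>. of_bool (M \<omega> = n) *
        ((\<Sum>i<M \<omega>. \<psi> (aisle i \<omega>, loc i \<omega>)) * (\<Prod>j<M \<omega>. h (aisle j \<omega>, loc j \<omega>)))) =
      expectation (\<lambda>\<omega>. of_bool (M \<omega> = n) * (p * (real (M \<omega>) * q ^ (M \<omega> - 1))))" .
  qed (rule M_measurable)
  then show ?thesis by (simp add: pgf_deriv_def)
qed

text \<open>
  Up to null sets, all events below are combinations of events of this form: the set \<open>C\<close> restricts
  the visited half-aisles, and \<open>t\<close> bounds the reach in each of them.
\<close>

definition all_items_within :: "(nat \<times> bool) set \<Rightarrow> (nat \<times> bool \<Rightarrow> real) \<Rightarrow> 'a \<Rightarrow> bool" where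
  "all_items_within C t \<omega> \<longleftrightarrow>
    (\<forall>j<M \<omega>. cell_of aisle loc j \<omega> \<in> C \<and> depth (loc j \<omega>) \<le> t (cell_of aisle loc j \<omega>))"

lemma cell_of_measurable [measurable]: "cell_of aisle loc j \<in> measurable \<Omega> (count_space UNIV)"
proof -
  have "Measurable.pred \<Omega> (\<lambda>\<omega>. cell_of aisle loc j \<omega> = c)" for c
    unfolding cell_of_def by (cases c) simp
  then have "{\<omega> \<in> space \<Omega>. cell_of aisle loc j \<omega> = c} \<in> events" for c by (rule predE)
  then show ?thesis
    by (auto simp: measurable_count_space_eq2_countable vimage_def Int_def conj_commute)
qed

lemma all_items_within_measurable [measurable]: "Measurable.pred \<Omega> (all_items_within C t)"
  unfolding all_items_within_def[abs_def] by measurable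

context
  fixes C :: "(nat \<times> bool) set" and t :: "nat \<times> bool \<Rightarrow> real"
  assumes C: "C \<subseteq> {1..k} \<times> UNIV" and t: "\<And>c. 0 \<le> t c" "\<And>c. t c \<le> 1"
begin

lemma finite_C: "finite C"
  using finite_subset[OF C] by simp

definition item_within :: "(nat \<times> bool) set \<Rightarrow> nat \<times> real \<Rightarrow> real" where
  "item_within D x = of_bool ((fst x, snd x \<le> 1/2) \<in> D \<and> depth (snd x) \<le> t (fst x, snd x \<le> 1/2))"

lemma item_within_measurable [measurable]:
  "item_within D \<in> borel_measurable (count_space UNIV \<Otimes>\<^sub>M borel)"
  unfolding item_within_def[abs_def] by measurable

lemma of_bool_all_items_within:
  "of_bool (all_items_within C t \<omega>) = (\<Prod>j<M \<omega>. item_within C (aisle j \<omega>, loc j \<omega>))"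
proof -
  have "(\<Prod>j<n. of_bool (Q j)) = (of_bool (\<forall>j<n. Q j) :: real)" for Q and n :: nat
    by (induction n) (auto simp: less_Suc_eq)
  then show ?thesis by (simp add: all_items_within_def item_within_def cell_of_def)
qed

lemma expectation_item_within:
  assumes "D \<subseteq> C"
  shows "expectation (\<lambda>\<omega>. item_within D (aisle j \<omega>, loc j \<omega>)) = (\<Sum>c\<in>D. t c) / (2 * real k)"
proof -
  let ?A = "\<lambda>c. {\<omega> \<in> space \<Omega>. cell_of aisle loc j \<omega> = c \<and> depth (loc j \<omega>) \<le> t c}"
  have D: "finite D" "\<And>c. c \<in> D \<Longrightarrow> fst c \<in> {1..k}" using finite_C assms C by (auto intro: finite_subset)
  have "item_within D (aisle j \<omega>, loc j \<omega>) = (\<Sum>c\<in>D. indicator (?A c) \<omega>)" if "\<omega> \<in> space \<Omega>" for \<omega>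
  proof -
    let ?b = "cell_of aisle loc j \<omega>"
    have "indicator (?A c) \<omega> = (if c = ?b then of_bool (depth (loc j \<omega>) \<le> t ?b) else 0 :: real)" for c
      using that by auto
    moreover have "item_within D (aisle j \<omega>, loc j \<omega>) = of_bool (?b \<in> D \<and> depth (loc j \<omega>) \<le> t ?b)"
      by (simp add: item_within_def cell_of_def)
    ultimately show ?thesis using D(1) by simp
  qed
  then have "expectation (\<lambda>\<omega>. item_within D (aisle j \<omega>, loc j \<omega>)) =
      expectation (\<lambda>\<omega>. \<Sum>c\<in>D. indicator (?A c) \<omega>)"
    by (intro Bochner_Integration.integral_cong) auto
  also have "\<dots> = (\<Sum>c\<in>D. prob (?A c))"
    by (subst Bochner_Integration.integral_sum)
      (auto simp: less_top[symmetric] intro!: integrable_real_indicator sum.cong arg_cong[where f=prob])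
  also have "\<dots> = (\<Sum>c\<in>D. t c / (2 * real k))"
    using D t by (intro sum.cong refl prob_cell_depth) auto
  finally show ?thesis by (simp add: sum_divide_distrib)
qed

lemma expectation_all_items_within:
  "expectation (\<lambda>\<omega>. of_bool (all_items_within C t \<omega>)) = pgf \<Omega> M ((\<Sum>c\<in>C. t c) / (2 * real k))"
  using expectation_prod_items[OF item_within_measurable _ _ expectation_item_within[OF order.refl]]
  by (simp add: of_bool_all_items_within item_within_def)

lemma expectation_size_all_items_within:
  "expectation (\<lambda>\<omega>. real (M \<omega>) * of_bool (all_items_within C t \<omega>)) =
    (\<Sum>c\<in>C. t c) / (2 * real k) * pgf_deriv \<Omega> M ((\<Sum>c\<in>C. t c) / (2 * real k))"
  using expectation_sum_prod_items[where \<psi>="\<lambda>_. 1", OF item_within_measurable[of C] _ _ _ _ _ _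
      expectation_item_within[OF order.refl], of "(\<Sum>c\<in>C. t c) / (2 * real k)"]
    expectation_item_within[OF order.refl]
  by (simp add: of_bool_all_items_within item_within_def)

text \<open>
  The marked item has to lie in \<open>c\<close> and to respect its bound, which has probability
  \<open>t c / (2 * k)\<close> if \<open>c\<close> is admitted by \<open>C\<close>.
\<close>

lemma expectation_num_cell_all_items_within:
  "expectation (\<lambda>\<omega>. real (num_cell M aisle loc c \<omega>) * of_bool (all_items_within C t \<omega>)) =
    of_bool (c \<in> C) * (t c / (2 * real k)) * pgf_deriv \<Omega> M ((\<Sum>c\<in>C. t c) / (2 * real k))"
proof -
  define \<psi> :: "nat \<times> real \<Rightarrow> real" where "\<psi> x = of_bool ((fst x, snd x \<le> 1/2) = c)" for x
  have [measurable]: "\<psi> \<in> borel_measurable (count_space UNIV \<Otimes>\<^sub>M borel)"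
    unfolding \<psi>_def[abs_def] by (cases c) simp
  have mark: "\<psi> x * item_within C x = item_within (C \<inter> {c}) x" for x
    by (auto simp: \<psi>_def item_within_def)
  have p: "expectation (\<lambda>\<omega>. \<psi> (aisle j \<omega>, loc j \<omega>) * item_within C (aisle j \<omega>, loc j \<omega>))
      = of_bool (c \<in> C) * (t c / (2 * real k))" for j
    unfolding mark using expectation_item_within[of "C \<inter> {c}"] by (cases "c \<in> C") auto
  have "expectation (\<lambda>\<omega>. real (num_cell M aisle loc c \<omega>) * of_bool (all_items_within C t \<omega>)) =
    expectation (\<lambda>\<omega>. (\<Sum>i<M \<omega>. \<psi> (aisle i \<omega>, loc i \<omega>)) * (\<Prod>j<M \<omega>. item_within C (aisle j \<omega>, loc j \<omega>)))"
  proof (rule integral_cong_AE)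
    show "(\<lambda>\<omega>. real (num_cell M aisle loc c \<omega>) * of_bool (all_items_within C t \<omega>)) \<in> borel_measurable \<Omega>"
      using num_cell_measurable[OF M_measurable aisle_measurable loc_measurable] by measurable
    show "(\<lambda>\<omega>. (\<Sum>i<M \<omega>. \<psi> (aisle i \<omega>, loc i \<omega>)) * (\<Prod>j<M \<omega>. item_within C (aisle j \<omega>, loc j \<omega>))) \<in> borel_measurable \<Omega>"
      by (rule measurable_compose_countable[OF _ M_measurable]) measurable
    show "AE \<omega> in \<Omega>. real (num_cell M aisle loc c \<omega>) * of_bool (all_items_within C t \<omega>) =
        (\<Sum>i<M \<omega>. \<psi> (aisle i \<omega>, loc i \<omega>)) * (\<Prod>j<M \<omega>. item_within C (aisle j \<omega>, loc j \<omega>))"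
      using AE_items_in_range
    proof eventually_elim
      case (elim \<omega>)
      then show ?case
        by (subst num_cell_eq_sum) (auto simp: \<psi>_def cell_of_def of_bool_all_items_within)
    qed
  qed
  also have "\<dots> = of_bool (c \<in> C) * (t c / (2 * real k)) * pgf_deriv \<Omega> M ((\<Sum>c\<in>C. t c) / (2 * real k))"
    by (rule expectation_sum_prod_items[OF _ _ _ _ _ _ p expectation_item_within[OF order.refl]])
      (auto simp: item_within_def \<psi>_def)
  finally show ?thesis .
qed


end

section \<open>One interval of visited aisles\<close>

abbreviation "R \<equiv> reach M aisle loc"

abbreviation "N \<equiv> num_cell M aisle loc"

definition aisle_span :: "nat \<Rightarrow> nat \<Rightarrow> 'a \<Rightarrow> real" where
  "aisle_span i m \<omega> = of_bool (last_aisle M aisle \<omega> = i + m \<and> first_aisle M aisle \<omega> = i)"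

lemmas [measurable] =
  last_aisle_measurable[OF M_measurable aisle_measurable]
  first_aisle_measurable[OF M_measurable aisle_measurable]
  reach_measurable[OF M_measurable aisle_measurable loc_measurable]
  num_cell_measurable[OF M_measurable aisle_measurable loc_measurable]
  front_sum_measurable[OF M_measurable aisle_measurable loc_measurable]
  back_sum_measurable[OF M_measurable aisle_measurable loc_measurable]

lemma aisle_span_measurable [measurable]: "aisle_span i m \<in> borel_measurable \<Omega>"
  unfolding aisle_span_def[abs_def] by measurable

text \<open>
  Bounds \<open>z\<close> in \<open>c\<close> and \<open>y\<close> in \<open>c'\<close>. The value 1 elsewhere is no restriction,
  because depths are at most 1.
\<close>

definition cap :: "nat \<times> bool \<Rightarrow> real \<Rightarrow> nat \<times> bool \<Rightarrow> real \<Rightarrow> nat \<times> bool \<Rightarrow> real" where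
  "cap c z c' y = ((\<lambda>_. 1)(c := z, c' := y))"

lemma all_items_within_cap:
  assumes good: "\<forall>j. aisle j \<omega> \<in> {1..k} \<and> 0 \<le> loc j \<omega> \<and> loc j \<omega> \<le> 1"
    and cc': "c \<noteq> c'" and zy: "0 \<le> z" "0 \<le> y"
  shows "all_items_within (I \<times> UNIV) (cap c z c' y) \<omega> \<longleftrightarrow>
    (\<forall>j<M \<omega>. aisle j \<omega> \<in> I) \<and> R c \<omega> \<le> z \<and> R c' \<omega> \<le> y"
proof -
  have loc01: "0 \<le> loc j \<omega> \<and> loc j \<omega> \<le> 1" for j using good by auto
  have "depth (loc j \<omega>) \<le> 1" for j using loc01[of j] by (auto simp: depth_def)
  then have "depth (loc j \<omega>) \<le> cap c z c' y b \<longleftrightarrow>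
      (b = c \<longrightarrow> depth (loc j \<omega>) \<le> z) \<and> (b = c' \<longrightarrow> depth (loc j \<omega>) \<le> y)" for j b
    using cc' by (auto simp: cap_def)
  moreover have "cell_of aisle loc j \<omega> \<in> I \<times> UNIV \<longleftrightarrow> aisle j \<omega> \<in> I" for j
    by (auto simp: cell_of_def)
  ultimately show ?thesis
    unfolding all_items_within_def reach_le_iff[of loc \<omega>, OF loc01] using zy by auto
qed

text \<open>
  Inclusion-exclusion for the requirement that neither end aisle may be left out. The bounds on the
  reaches occur in all four terms alike.
\<close>

lemma spans_caps_eq:
  assumes good: "\<forall>j. aisle j \<omega> \<in> {1..k} \<and> 0 \<le> loc j \<omega> \<and> loc j \<omega> \<le> 1"
    and i: "1 \<le> i" and cc': "c \<noteq> c'" and zy: "0 \<le> z" "0 \<le> y"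
  shows "aisle_span i m \<omega> * of_bool (R c \<omega> \<le> z) * of_bool (R c' \<omega> \<le> y) =
    of_bool (all_items_within ({i..i+m} \<times> UNIV) (cap c z c' y) \<omega>)
    - of_bool (all_items_within ({i+1..i+m} \<times> UNIV) (cap c z c' y) \<omega>)
    - of_bool (all_items_within ({i..i+m-1} \<times> UNIV) (cap c z c' y) \<omega>)
    + of_bool (all_items_within ({i+1..i+m-1} \<times> UNIV) (cap c z c' y) \<omega>)"
proof -
  define p where "p = (\<forall>j<M \<omega>. aisle j \<omega> \<in> {i..i+m})"
  define p1 where "p1 = (\<forall>j<M \<omega>. aisle j \<omega> \<in> {i+1..i+m})"
  define p2 where "p2 = (\<forall>j<M \<omega>. aisle j \<omega> \<in> {i..i+m-1})"
  have "(\<forall>j<M \<omega>. aisle j \<omega> \<in> {i+1..i+m-1}) \<longleftrightarrow> p1 \<and> p2"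
    unfolding p1_def p2_def by auto
  moreover have "p1 \<Longrightarrow> p" "p2 \<Longrightarrow> p"
    unfolding p_def p1_def p2_def by (auto simp: Suc_le_eq less_imp_le intro: order_trans[OF _ diff_le_self])
  moreover have "last_aisle M aisle \<omega> = i + m \<and> first_aisle M aisle \<omega> = i \<longleftrightarrow> p \<and> \<not> p1 \<and> \<not> p2"
    using first_last_aisle_eq_iff[of i "i + m" M aisle \<omega>] i by (simp add: p_def p1_def p2_def)
  ultimately show ?thesis
    unfolding all_items_within_cap[OF good cc' zy] aisle_span_def
      p_def[symmetric] p1_def[symmetric] p2_def[symmetric]
    by (cases "p"; cases "p1"; cases "p2") auto
qed

lemma sum_cap:
  assumes "finite I" "c \<in> I \<times> UNIV" "c' \<in> I \<times> UNIV" "c \<noteq> c'"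
  shows "(\<Sum>b\<in>I \<times> UNIV. cap c z c' y b) = 2 * real (card I) - 2 + y + z"
proof -
  have fin: "finite (I \<times> (UNIV :: bool set))" using assms by simp
  have "cap c z c' y b = 1 + ((if b = c then z - 1 else 0) + (if b = c' then y - 1 else 0))" for b
    using assms by (auto simp: cap_def)
  then have "(\<Sum>b\<in>I \<times> UNIV. cap c z c' y b) = real (card (I \<times> (UNIV :: bool set))) + ((z - 1) + (y - 1))"
    using assms fin by (simp add: sum.distrib)
  then show ?thesis using assms by (simp add: card_cartesian_product)
qed

lemma cap_bounds:
  assumes "0 \<le> z" "z \<le> 1" "0 \<le> y" "y \<le> 1"
  shows "0 \<le> cap c z c' y b" "cap c z c' y b \<le> 1"
  using assms by (auto simp: cap_def)

lemma integrable_quadratic_bound: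
  assumes "f \<in> borel_measurable \<Omega>" "AE \<omega> in \<Omega>. \<bar>f \<omega>\<bar> \<le> B * (1 + (real (M \<omega>))\<^sup>2)"
  shows "integrable \<Omega> f"
proof (rule Bochner_Integration.integrable_bound)
  show "integrable \<Omega> (\<lambda>\<omega>. B * (1 + (real (M \<omega>))\<^sup>2))" using M_square_integrable by simp
  show "AE \<omega> in \<Omega>. norm (f \<omega>) \<le> norm (B * (1 + (real (M \<omega>))\<^sup>2))"
    using assms(2) by eventually_elim simp
qed (use assms in auto)

lemma integrable_num_cell: "integrable \<Omega> (\<lambda>\<omega>. real (N c \<omega>))"
  by (rule Bochner_Integration.integrable_bound[OF M_integrable]) (auto intro: num_cell_le)

lemma integrable_mult_of_bool:
  assumes f: "integrable \<Omega> f" and [measurable]: "Measurable.pred \<Omega> p"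
  shows "integrable \<Omega> (\<lambda>\<omega>. f \<omega> * of_bool (p \<omega>) :: real)"
proof (rule Bochner_Integration.integrable_bound[OF f])
  have [measurable]: "f \<in> borel_measurable \<Omega>" using f by auto
  show "(\<lambda>\<omega>. f \<omega> * of_bool (p \<omega>)) \<in> borel_measurable \<Omega>" by measurable
qed (auto simp: of_bool_def)

lemma layer_cake_reach:
  assumes "integrable \<Omega> W"
  shows "((\<lambda>z. real (Suc n) * z ^ n * expectation (\<lambda>\<omega>. W \<omega> * of_bool (R c \<omega> \<le> z)))
    has_integral (expectation W - expectation (\<lambda>\<omega>. W \<omega> * R c \<omega> ^ Suc n))) {0..1}"
  using assms by (intro layer_cake_has_integral) (auto simp: reach_nonneg reach_le_1)

context
  fixes i m :: nat and c :: "nat \<times> bool"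
  assumes i: "1 \<le> i" "i + m \<le> k" and m: "2 \<le> m" and c: "fst c \<in> {i<..<i+m}"
begin

text \<open>
  In the applications \<open>f\<close> is the generating function or its derivative, and \<open>w\<close> accounts for the
  intervals that contain a marked item. The interval enters the argument of \<open>f\<close> through its length
  alone, so the position \<open>i\<close> disappears.
\<close>

lemma expectation_spans_caps_weighted:
  assumes W: "integrable \<Omega> W"
    and cc': "c \<noteq> c'" and zy: "0 \<le> z" "0 \<le> y"
    and E: "\<And>I. I \<subseteq> {1..k} \<Longrightarrow> {i<..<i+m} \<subseteq> I \<Longrightarrow>
      expectation (\<lambda>\<omega>. W \<omega> * of_bool (all_items_within (I \<times> UNIV) (cap c z c' y) \<omega>)) =
      w I * f ((2 * real (card I) - 2 + y + z) / (2 * real k))"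
  shows "expectation (\<lambda>\<omega>. W \<omega> * (aisle_span i m \<omega> * of_bool (R c \<omega> \<le> z) * of_bool (R c' \<omega> \<le> y))) =
    w {i..i+m} * f ((2 * real m + y + z) / (2 * real k))
    - w {i+1..i+m} * f ((2 * real m - 2 + y + z) / (2 * real k))
    - w {i..i+m-1} * f ((2 * real m - 2 + y + z) / (2 * real k))
    + w {i+1..i+m-1} * f ((2 * real m - 4 + y + z) / (2 * real k))"
proof -
  let ?L = "expectation (\<lambda>\<omega>. W \<omega> * (aisle_span i m \<omega> * of_bool (R c \<omega> \<le> z) * of_bool (R c' \<omega> \<le> y)))"
  have "?L =
    expectation (\<lambda>\<omega>. W \<omega> * of_bool (all_items_within ({i..i+m} \<times> UNIV) (cap c z c' y) \<omega>))
    - expectation (\<lambda>\<omega>. W \<omega> * of_bool (all_items_within ({i+1..i+m} \<times> UNIV) (cap c z c' y) \<omega>))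
    - expectation (\<lambda>\<omega>. W \<omega> * of_bool (all_items_within ({i..i+m-1} \<times> UNIV) (cap c z c' y) \<omega>))
    + expectation (\<lambda>\<omega>. W \<omega> * of_bool (all_items_within ({i+1..i+m-1} \<times> UNIV) (cap c z c' y) \<omega>))"
    (is "?L = expectation ?A - expectation ?B - expectation ?C + expectation ?D")
  proof -
    have [measurable]: "W \<in> borel_measurable \<Omega>" using W by auto
    have sub: "{i..i+m} \<times> UNIV \<subseteq> {1..k} \<times> (UNIV :: bool set)" "{i+1..i+m} \<times> UNIV \<subseteq> {1..k} \<times> (UNIV :: bool set)"
      "{i..i+m-1} \<times> UNIV \<subseteq> {1..k} \<times> (UNIV :: bool set)" "{i+1..i+m-1} \<times> UNIV \<subseteq> {1..k} \<times> (UNIV :: bool set)"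
      using i by auto
    have int: "integrable \<Omega> ?A" "integrable \<Omega> ?B" "integrable \<Omega> ?C" "integrable \<Omega> ?D"
      using W by (auto intro!: integrable_mult_of_bool)
    have "?L = expectation (\<lambda>\<omega>. ?A \<omega> - ?B \<omega> - ?C \<omega> + ?D \<omega>)"
    proof (rule integral_cong_AE)
      show "AE \<omega> in \<Omega>. W \<omega> * (aisle_span i m \<omega> * of_bool (R c \<omega> \<le> z) * of_bool (R c' \<omega> \<le> y)) = ?A \<omega> - ?B \<omega> - ?C \<omega> + ?D \<omega>"
        using AE_items_in_range
      proof eventually_elim
        case (elim \<omega>)
        show ?case unfolding spans_caps_eq[OF elim i(1) cc' zy] by (simp only: right_diff_distrib distrib_left)
      qed
    qed measurable
    then show ?thesis using int by simp
  qed
  moreover have "2 * real (card {i..i+m}) - 2 + y + z = 2 * real m + y + z"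
    "2 * real (card {i+1..i+m}) - 2 + y + z = 2 * real m - 2 + y + z"
    "2 * real (card {i..i+m-1}) - 2 + y + z = 2 * real m - 2 + y + z"
    "2 * real (card {i+1..i+m-1}) - 2 + y + z = 2 * real m - 4 + y + z"
    using m by (auto simp: of_nat_diff)
  moreover have "{i..i+m} \<subseteq> {1..k}" "{i+1..i+m} \<subseteq> {1..k}" "{i..i+m-1} \<subseteq> {1..k}" "{i+1..i+m-1} \<subseteq> {1..k}"
    "{i<..<i+m} \<subseteq> {i..i+m}" "{i<..<i+m} \<subseteq> {i+1..i+m}" "{i<..<i+m} \<subseteq> {i..i+m-1}" "{i<..<i+m} \<subseteq> {i+1..i+m-1}"
    using i m by auto
  ultimately show ?thesis by (simp only: E)
qed

context
  fixes c' :: "nat \<times> bool" and z y :: real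
  assumes c': "fst c' \<in> {i<..<i+m}" and cc': "c \<noteq> c'" and z: "0 \<le> z" "z \<le> 1" and y: "0 \<le> y" "y \<le> 1"
begin

lemma sum_cap_interior:
  assumes "I \<subseteq> {1..k}" "{i<..<i+m} \<subseteq> I"
  shows "(\<Sum>b\<in>I \<times> UNIV. cap c z c' y b) = 2 * real (card I) - 2 + y + z"
  using assms c c' cc' by (intro sum_cap) (auto intro: finite_subset simp: mem_Times_iff)

lemma expectation_spans_caps:
  "expectation (\<lambda>\<omega>. aisle_span i m \<omega> * of_bool (R c \<omega> \<le> z) * of_bool (R c' \<omega> \<le> y)) = span_pgf \<Omega> M k m z y"
proof -
  have "expectation (\<lambda>\<omega>. 1 * of_bool (all_items_within (I \<times> UNIV) (cap c z c' y) \<omega>)) =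
      1 * pgf \<Omega> M ((2 * real (card I) - 2 + y + z) / (2 * real k))"
    if "I \<subseteq> {1..k}" "{i<..<i+m} \<subseteq> I" for I
    unfolding mult_1_left sum_cap_interior[OF that, symmetric]
    by (rule expectation_all_items_within) (use that z y in \<open>auto intro: cap_bounds\<close>)
  from expectation_spans_caps_weighted[where W="\<lambda>_. 1" and w="\<lambda>_. 1", OF _ cc' z(1) y(1) this]
  show ?thesis by (simp add: span_pgf_def)
qed

lemma expectation_num_cell_spans_caps:
  "expectation (\<lambda>\<omega>. real (N b \<omega>) * (aisle_span i m \<omega> * of_bool (R c \<omega> \<le> z) * of_bool (R c' \<omega> \<le> y))) =
    cap c z c' y b / (2 * real k) *
     (of_bool (fst b \<in> {i..i+m}) * pgf_deriv \<Omega> M ((2 * real m + y + z) / (2 * real k))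
    - (of_bool (fst b \<in> {i+1..i+m}) + of_bool (fst b \<in> {i..i+m-1}))
        * pgf_deriv \<Omega> M ((2 * real m - 2 + y + z) / (2 * real k))
    + of_bool (fst b \<in> {i+1..i+m-1}) * pgf_deriv \<Omega> M ((2 * real m - 4 + y + z) / (2 * real k)))"
proof -
  have "expectation (\<lambda>\<omega>. real (N b \<omega>) * of_bool (all_items_within (I \<times> UNIV) (cap c z c' y) \<omega>)) =
      of_bool (fst b \<in> I) * (cap c z c' y b / (2 * real k)) *
        pgf_deriv \<Omega> M ((2 * real (card I) - 2 + y + z) / (2 * real k))"
    if "I \<subseteq> {1..k}" "{i<..<i+m} \<subseteq> I" for I
  proof -
    have "b \<in> I \<times> UNIV \<longleftrightarrow> fst b \<in> I" by (cases b) auto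
    moreover have "expectation (\<lambda>\<omega>. real (N b \<omega>) * of_bool (all_items_within (I \<times> UNIV) (cap c z c' y) \<omega>)) =
      of_bool (b \<in> I \<times> UNIV) * (cap c z c' y b / (2 * real k)) *
        pgf_deriv \<Omega> M ((\<Sum>b\<in>I \<times> UNIV. cap c z c' y b) / (2 * real k))"
      by (rule expectation_num_cell_all_items_within) (use that z y in \<open>auto intro: cap_bounds\<close>)
    ultimately show ?thesis by (simp only: sum_cap_interior[OF that])
  qed
  from expectation_spans_caps_weighted[where W="\<lambda>\<omega>. real (N b \<omega>)"
      and w="\<lambda>I. of_bool (fst b \<in> I) * (cap c z c' y b / (2 * real k))",
      OF integrable_num_cell cc' z(1) y(1) this]
  show ?thesis by (simp add: algebra_simps)
qed

end

text \<open>
  A bound on a single reach is the special case in which the other half of the same aisle gets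
  the void bound 1.
\<close>

lemma other_half: "fst (fst c, \<not> snd c) \<in> {i<..<i+m}" "c \<noteq> (fst c, \<not> snd c)"
  using c by (cases c, auto)+

lemma expectation_spans_cap:
  assumes "z \<in> {0..1}"
  shows "expectation (\<lambda>\<omega>. aisle_span i m \<omega> * of_bool (R c \<omega> \<le> z)) = span_pgf \<Omega> M k m z 1"
  using expectation_spans_caps[OF other_half, of z 1] assms by (simp add: reach_le_1)

lemma integrable_aisle_span: "integrable \<Omega> (aisle_span i m)"
  by (rule integrable_const_bound[where B=1]) (auto simp: aisle_span_def)

lemma expectation_spans: "expectation (aisle_span i m) = span_pgf \<Omega> M k m 1 1"
  using expectation_spans_cap[of 1] by (simp add: reach_le_1)

lemma first_moment:
  "(\<lambda>z. span_pgf \<Omega> M k m z 1) integrable_on {0..1}"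
  "expectation (\<lambda>\<omega>. R c \<omega> * aisle_span i m \<omega>) =
    span_pgf \<Omega> M k m 1 1 - integral {0..1} (\<lambda>z. span_pgf \<Omega> M k m z 1)"
proof -
  have "((\<lambda>z. expectation (\<lambda>\<omega>. aisle_span i m \<omega> * of_bool (R c \<omega> \<le> z))) has_integral
     (expectation (aisle_span i m) - expectation (\<lambda>\<omega>. R c \<omega> * aisle_span i m \<omega>))) {0..1}"
    using layer_cake_reach[OF integrable_aisle_span, of 0 c] by (simp add: mult.commute)
  then have "((\<lambda>z. span_pgf \<Omega> M k m z 1) has_integral
     (span_pgf \<Omega> M k m 1 1 - expectation (\<lambda>\<omega>. R c \<omega> * aisle_span i m \<omega>))) {0..1}"
    unfolding expectation_spans
    by (rule has_integral_eq[rotated]) (simp add: expectation_spans_cap)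
  then show "(\<lambda>z. span_pgf \<Omega> M k m z 1) integrable_on {0..1}"
    "expectation (\<lambda>\<omega>. R c \<omega> * aisle_span i m \<omega>) =
    span_pgf \<Omega> M k m 1 1 - integral {0..1} (\<lambda>z. span_pgf \<Omega> M k m z 1)"
    by (auto simp: integral_unique)
qed

lemma second_moment:
  "expectation (\<lambda>\<omega>. (R c \<omega>)\<^sup>2 * aisle_span i m \<omega>) =
    span_pgf \<Omega> M k m 1 1 - 2 * integral {0..1} (\<lambda>z. z * span_pgf \<Omega> M k m z 1)"
proof -
  have "((\<lambda>z. 2 * z * expectation (\<lambda>\<omega>. aisle_span i m \<omega> * of_bool (R c \<omega> \<le> z))) has_integral
     (expectation (aisle_span i m) - expectation (\<lambda>\<omega>. (R c \<omega>)\<^sup>2 * aisle_span i m \<omega>))) {0..1}"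
    using layer_cake_reach[OF integrable_aisle_span, of 1 c] by (simp add: power2_eq_square ac_simps)
  then have "((\<lambda>z. 2 * (z * span_pgf \<Omega> M k m z 1)) has_integral
     (span_pgf \<Omega> M k m 1 1 - expectation (\<lambda>\<omega>. (R c \<omega>)\<^sup>2 * aisle_span i m \<omega>))) {0..1}"
    unfolding expectation_spans
    by (rule has_integral_eq[rotated]) (simp add: expectation_spans_cap)
  then show ?thesis
    using integral_unique[of "\<lambda>z. 2 * (z * span_pgf \<Omega> M k m z 1)"] by simp
qed

end

text \<open>
  Two nested applications of the layer cake formula: with \<open>R c'\<close> as part of the weight, the integrand
  for \<open>R c\<close> at \<open>z\<close> is itself a first moment, namely
  \<open>G m z 1\<close> minus the integral of \<open>G m z\<close>.
\<close>

lemma product_moment: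
  assumes i: "1 \<le> i" "i + m \<le> k" and m: "2 \<le> m" and c: "fst c \<in> {i<..<i+m}"
    and c': "fst c' \<in> {i<..<i+m}" and cc': "c \<noteq> c'"
  shows "expectation (\<lambda>\<omega>. R c \<omega> * R c' \<omega> * aisle_span i m \<omega>) =
    span_pgf \<Omega> M k m 1 1 - 2 * integral {0..1} (\<lambda>z. span_pgf \<Omega> M k m z 1)
      + integral {0..1} (\<lambda>z. integral {0..1} (\<lambda>y. span_pgf \<Omega> M k m z y))"
proof -
  let ?J = "\<lambda>z. integral {0..1} (\<lambda>y. span_pgf \<Omega> M k m z y)"
  have intW: "integrable \<Omega> (\<lambda>\<omega>. aisle_span i m \<omega> * R c' \<omega>)"
    by (rule integrable_const_bound[where B=1])
      (auto simp: aisle_span_def reach_nonneg reach_le_1 abs_mult)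
  have inner: "expectation (\<lambda>\<omega>. aisle_span i m \<omega> * R c' \<omega> * of_bool (R c \<omega> \<le> z)) =
      span_pgf \<Omega> M k m z 1 - ?J z" if z: "z \<in> {0..1}" for z
  proof -
    have intz: "integrable \<Omega> (\<lambda>\<omega>. aisle_span i m \<omega> * of_bool (R c \<omega> \<le> z))"
      by (rule integrable_const_bound[where B=1]) (auto simp: aisle_span_def)
    have "((\<lambda>y. expectation (\<lambda>\<omega>. aisle_span i m \<omega> * of_bool (R c \<omega> \<le> z) * of_bool (R c' \<omega> \<le> y))) has_integral
     (expectation (\<lambda>\<omega>. aisle_span i m \<omega> * of_bool (R c \<omega> \<le> z))
       - expectation (\<lambda>\<omega>. aisle_span i m \<omega> * of_bool (R c \<omega> \<le> z) * R c' \<omega>))) {0..1}"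
      using layer_cake_reach[OF intz, of 0 c'] by simp
    then have "((\<lambda>y. span_pgf \<Omega> M k m z y) has_integral
     (span_pgf \<Omega> M k m z 1 - expectation (\<lambda>\<omega>. aisle_span i m \<omega> * of_bool (R c \<omega> \<le> z) * R c' \<omega>))) {0..1}"
      unfolding expectation_spans_cap[OF i m c z]
      by (rule has_integral_eq[rotated])
        (use expectation_spans_caps[OF i m c c' cc'] z in auto)
    then have "?J z = span_pgf \<Omega> M k m z 1 - expectation (\<lambda>\<omega>. aisle_span i m \<omega> * of_bool (R c \<omega> \<le> z) * R c' \<omega>)"
      by (rule integral_unique)
    moreover have "expectation (\<lambda>\<omega>. aisle_span i m \<omega> * of_bool (R c \<omega> \<le> z) * R c' \<omega>) =
       expectation (\<lambda>\<omega>. aisle_span i m \<omega> * R c' \<omega> * of_bool (R c \<omega> \<le> z))"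
      by (simp add: ac_simps)
    ultimately show ?thesis by simp
  qed
  have "((\<lambda>z. expectation (\<lambda>\<omega>. aisle_span i m \<omega> * R c' \<omega> * of_bool (R c \<omega> \<le> z))) has_integral
     (expectation (\<lambda>\<omega>. aisle_span i m \<omega> * R c' \<omega>) - expectation (\<lambda>\<omega>. aisle_span i m \<omega> * R c' \<omega> * R c \<omega>))) {0..1}"
    using layer_cake_reach[OF intW, of 0 c] by simp
  then have hi: "((\<lambda>z. span_pgf \<Omega> M k m z 1 - ?J z) has_integral
     (expectation (\<lambda>\<omega>. R c' \<omega> * aisle_span i m \<omega>) - expectation (\<lambda>\<omega>. R c \<omega> * R c' \<omega> * aisle_span i m \<omega>))) {0..1}"
    by (subst (asm) has_integral_cong[OF inner]) (auto simp: ac_simps)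
  have g: "(\<lambda>z. span_pgf \<Omega> M k m z 1) integrable_on {0..1}" by (rule first_moment(1)[OF i m c])
  \<comment> \<open>a difference of integrable functions\<close>
  have J: "?J integrable_on {0..1}"
    using integrable_diff[OF g has_integral_integrable[OF hi]] by simp
  have "integral {0..1} (\<lambda>z. span_pgf \<Omega> M k m z 1 - ?J z) =
     integral {0..1} (\<lambda>z. span_pgf \<Omega> M k m z 1) - integral {0..1} ?J"
    by (rule integral_diff[OF g J])
  with integral_unique[OF hi] first_moment(2)[OF i m c'] show ?thesis by simp
qed

text \<open>
  The derivative of \<open>\<lambda>z. span_pgf \<Omega> M k m z 1\<close>; it arises when the marked item lies in an
  interior half-aisle, which belongs to all four intervals of the inclusion-exclusion.
\<close>

definition span_deriv :: "nat \<Rightarrow> real \<Rightarrow> real" where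
  "span_deriv m z = (pgf_deriv \<Omega> M ((2 * real m + 1 + z) / (2 * real k))
     - 2 * pgf_deriv \<Omega> M ((2 * real m - 2 + 1 + z) / (2 * real k))
     + pgf_deriv \<Omega> M ((2 * real m - 4 + 1 + z) / (2 * real k))) / (2 * real k)"

text \<open>
  The analogue of \<open>span_deriv\<close> for a marked item in the first or last aisle of the interval, which
  belongs to only two of the four intervals.
\<close>

definition span_edge :: "nat \<Rightarrow> real \<Rightarrow> real" where
  "span_edge m z = (pgf_deriv \<Omega> M ((2 * real m + 1 + z) / (2 * real k))
     - pgf_deriv \<Omega> M ((2 * real m - 2 + 1 + z) / (2 * real k))) / (2 * real k)"

lemma pgf_affine_has_derivative:
  assumes "0 \<le> s" "s + 1 \<le> 2 * real k" "z \<in> {0..1}"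
  shows "((\<lambda>z. pgf \<Omega> M ((s + z) / (2 * real k))) has_real_derivative
    pgf_deriv \<Omega> M ((s + z) / (2 * real k)) / (2 * real k)) (at z within {0..1})"
proof -
  let ?g = "\<lambda>z. (s + z) / (2 * real k)"
  have sub: "?g ` {0..1} \<subseteq> {0..1}" using assms k_ge_1 by (auto simp: field_simps)
  have "(pgf \<Omega> M has_real_derivative pgf_deriv \<Omega> M (?g z)) (at (?g z) within {0..1})"
    using sub assms by (intro pgf_has_derivative M_integrable M_measurable) auto
  then have "(pgf \<Omega> M has_real_derivative pgf_deriv \<Omega> M (?g z)) (at (?g z) within ?g ` {0..1})"
    using sub by (rule has_field_derivative_subset)
  moreover have "(?g has_real_derivative 1 / (2 * real k)) (at z within {0..1})"
    using k_ge_1 by (auto intro!: derivative_eq_intros)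
  ultimately show ?thesis
    using DERIV_image_chain[of "pgf \<Omega> M" "pgf_deriv \<Omega> M (?g z)" ?g z "{0..1}" "1 / (2 * real k)"]
    by (simp add: comp_def)
qed

lemma span_pgf_has_derivative:
  assumes "2 \<le> m" "m + 1 \<le> k" "z \<in> {0..1}"
  shows "((\<lambda>z. span_pgf \<Omega> M k m z 1) has_real_derivative span_deriv m z) (at z within {0..1})"
proof -
  have m: "2 \<le> real m" "real m + 1 \<le> real k" using assms by simp_all
  have "((\<lambda>z. pgf \<Omega> M ((2 * real m + 1 + z) / (2 * real k))
     - 2 * pgf \<Omega> M ((2 * real m - 2 + 1 + z) / (2 * real k))
     + pgf \<Omega> M ((2 * real m - 4 + 1 + z) / (2 * real k))) has_real_derivative
     pgf_deriv \<Omega> M ((2 * real m + 1 + z) / (2 * real k)) / (2 * real k)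
     - 2 * (pgf_deriv \<Omega> M ((2 * real m - 2 + 1 + z) / (2 * real k)) / (2 * real k))
     + pgf_deriv \<Omega> M ((2 * real m - 4 + 1 + z) / (2 * real k)) / (2 * real k)) (at z within {0..1})"
    using m assms(3)
    by (intro DERIV_add DERIV_diff DERIV_cmult pgf_affine_has_derivative) auto
  then show ?thesis
    by (simp add: span_pgf_def span_deriv_def add_divide_distrib diff_divide_distrib)
qed

lemma span_deriv_has_integral:
  assumes "2 \<le> m" "m + 1 \<le> k"
  shows "(span_deriv m has_integral (span_pgf \<Omega> M k m 1 1 - span_pgf \<Omega> M k m 0 1)) {0..1}"
  using assms span_pgf_has_derivative
  by (intro fundamental_theorem_of_calculus) (auto simp: has_real_derivative_iff_has_vector_derivative)

lemma times_span_deriv_has_integral: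
  assumes "2 \<le> m" "m + 1 \<le> k"
  shows "((\<lambda>z. z * span_deriv m z) has_integral
    (span_pgf \<Omega> M k m 1 1 - integral {0..1} (\<lambda>z. span_pgf \<Omega> M k m z 1))) {0..1}"
proof -
  let ?g = "\<lambda>z. span_pgf \<Omega> M k m z 1"
  have "((\<lambda>z. ?g z + z * span_deriv m z) has_integral (1 * ?g 1 - 0 * ?g 0)) {0..1}"
  proof (rule fundamental_theorem_of_calculus)
    fix z :: real assume z: "z \<in> {0..1}"
    have "((\<lambda>z. z * ?g z) has_real_derivative (1 * ?g z + span_deriv m z * z)) (at z within {0..1})"
      by (intro DERIV_mult DERIV_ident span_pgf_has_derivative assms z)
    then show "((\<lambda>z. z * ?g z) has_vector_derivative (?g z + z * span_deriv m z)) (at z within {0..1})"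
      by (simp add: has_real_derivative_iff_has_vector_derivative mult.commute)
  qed simp
  moreover have "(?g has_integral integral {0..1} ?g) {0..1}"
  proof -
    have "continuous_on {0..1} ?g"
      using span_pgf_has_derivative[OF assms] by (intro DERIV_continuous_on)
    then show ?thesis by (intro integrable_integral integrable_continuous_interval)
  qed
  ultimately have "((\<lambda>z. (?g z + z * span_deriv m z) - ?g z) has_integral
      (1 * ?g 1 - 0 * ?g 0) - integral {0..1} ?g) {0..1}"
    by (rule has_integral_diff)
  then show ?thesis by simp
qed

text \<open>
  The layer cake formula with the number of items in \<open>b\<close> as weight. The full expectation of the weight is
  the value at 1, where the bound is void.
\<close>

lemma num_cell_moment:
  assumes i: "1 \<le> i" "i + m \<le> k" and m: "2 \<le> m" and c: "fst c \<in> {i<..<i+m}"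
    and h: "\<And>z. z \<in> {0..1} \<Longrightarrow> expectation (\<lambda>\<omega>. real (N b \<omega>) * (aisle_span i m \<omega> * of_bool (R c \<omega> \<le> z))) = h z"
  shows "expectation (\<lambda>\<omega>. R c \<omega> * real (N b \<omega>) * aisle_span i m \<omega>) = h 1 - integral {0..1} h"
proof -
  have int: "integrable \<Omega> (\<lambda>\<omega>. real (N b \<omega>) * aisle_span i m \<omega>)"
    unfolding aisle_span_def by (intro integrable_mult_of_bool integrable_num_cell) measurable
  have h1: "expectation (\<lambda>\<omega>. real (N b \<omega>) * aisle_span i m \<omega>) = h 1"
    using h[of 1] by (simp add: reach_le_1)
  have "((\<lambda>z. expectation (\<lambda>\<omega>. real (N b \<omega>) * (aisle_span i m \<omega> * of_bool (R c \<omega> \<le> z)))) has_integral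
     (h 1 - expectation (\<lambda>\<omega>. R c \<omega> * real (N b \<omega>) * aisle_span i m \<omega>))) {0..1}"
    using layer_cake_reach[OF int, of 0 c] unfolding h1 by (simp add: ac_simps)
  then have "(h has_integral (h 1 - expectation (\<lambda>\<omega>. R c \<omega> * real (N b \<omega>) * aisle_span i m \<omega>))) {0..1}"
    by (rule has_integral_eq[rotated]) (simp add: h)
  then show ?thesis by (simp add: integral_unique)
qed

context
  fixes i m :: nat and c :: "nat \<times> bool"
  assumes i: "1 \<le> i" "i + m \<le> k" and m: "2 \<le> m" and c: "fst c \<in> {i<..<i+m}"
begin

lemma expectation_num_cell_spans_cap:
  assumes z: "z \<in> {0..1}"
  shows "expectation (\<lambda>\<omega>. real (N b \<omega>) * (aisle_span i m \<omega> * of_bool (R c \<omega> \<le> z))) =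
    (if b = c then z else 1) / (2 * real k) *
     (of_bool (fst b \<in> {i..i+m}) * pgf_deriv \<Omega> M ((2 * real m + 1 + z) / (2 * real k))
    - (of_bool (fst b \<in> {i+1..i+m}) + of_bool (fst b \<in> {i..i+m-1}))
        * pgf_deriv \<Omega> M ((2 * real m - 2 + 1 + z) / (2 * real k))
    + of_bool (fst b \<in> {i+1..i+m-1}) * pgf_deriv \<Omega> M ((2 * real m - 4 + 1 + z) / (2 * real k)))"
proof -
  have "cap c z (fst c, \<not> snd c) 1 b = (if b = c then z else 1)"
    by (cases c) (auto simp: cap_def)
  then show ?thesis
    using expectation_num_cell_spans_caps[OF i m c other_half[OF i m c], of z 1 b] z
    by (simp only: reach_le_1) auto
qed

lemma other_cell_moment:
  assumes b: "fst b \<in> {i<..<i+m}" "b \<noteq> c"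
  shows "expectation (\<lambda>\<omega>. R c \<omega> * real (N b \<omega>) * aisle_span i m \<omega>) =
    span_deriv m 1 - span_pgf \<Omega> M k m 1 1 + span_pgf \<Omega> M k m 0 1"
proof -
  have "expectation (\<lambda>\<omega>. R c \<omega> * real (N b \<omega>) * aisle_span i m \<omega>) =
      span_deriv m 1 - integral {0..1} (span_deriv m)"
  proof (rule num_cell_moment[OF i m c])
    show "expectation (\<lambda>\<omega>. real (N b \<omega>) * (aisle_span i m \<omega> * of_bool (R c \<omega> \<le> z))) = span_deriv m z"
      if "z \<in> {0..1}" for z
      unfolding expectation_num_cell_spans_cap[OF that] using b by (auto simp: span_deriv_def)
  qed
  then show ?thesis using integral_unique[OF span_deriv_has_integral[OF m]] i by simp
qed

text \<open>
  A bound \<open>z\<close> on the reach of \<open>c\<close> also confines the marked item, which costs a further factor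
  \<open>z\<close> compared with \<open>other_cell_moment\<close>.
\<close>

lemma same_cell_moment:
  "expectation (\<lambda>\<omega>. R c \<omega> * real (N c \<omega>) * aisle_span i m \<omega>) =
    span_deriv m 1 - span_pgf \<Omega> M k m 1 1 + integral {0..1} (\<lambda>z. span_pgf \<Omega> M k m z 1)"
proof -
  have "expectation (\<lambda>\<omega>. R c \<omega> * real (N c \<omega>) * aisle_span i m \<omega>) =
      1 * span_deriv m 1 - integral {0..1} (\<lambda>z. z * span_deriv m z)"
  proof (rule num_cell_moment[OF i m c])
    show "expectation (\<lambda>\<omega>. real (N c \<omega>) * (aisle_span i m \<omega> * of_bool (R c \<omega> \<le> z))) = z * span_deriv m z"
      if "z \<in> {0..1}" for z
      unfolding expectation_num_cell_spans_cap[OF that] using c by (auto simp: span_deriv_def)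
  qed
  then show ?thesis using integral_unique[OF times_span_deriv_has_integral[OF m]] i by simp
qed

text \<open>
  The right-hand side contains neither \<open>i\<close> nor \<open>b\<close> nor \<open>c\<close>: this is the equality of all
  these moments, and it is what makes a single constant sufficient for the end aisles.
\<close>

lemma edge_cell_moment:
  assumes b: "fst b = i \<or> fst b = i + m"
  shows "expectation (\<lambda>\<omega>. R c \<omega> * real (N b \<omega>) * aisle_span i m \<omega>) =
    span_edge m 1 - integral {0..1} (span_edge m)"
proof (rule num_cell_moment[OF i m c])
  show "expectation (\<lambda>\<omega>. real (N b \<omega>) * (aisle_span i m \<omega> * of_bool (R c \<omega> \<le> z))) = span_edge m z"
    if "z \<in> {0..1}" for z
    unfolding expectation_num_cell_spans_cap[OF that] using b c m by (auto simp: span_edge_def)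
qed

end

section \<open>Summing over the intervals of visited aisles\<close>

lemma first_last_aisle_range:
  assumes "\<forall>j. aisle j \<omega> \<in> {1..k} \<and> 0 \<le> loc j \<omega> \<and> loc j \<omega> \<le> 1"
  shows "last_aisle M aisle \<omega> \<le> k" "first_aisle M aisle \<omega> < last_aisle M aisle \<omega> \<Longrightarrow> 1 \<le> first_aisle M aisle \<omega>"
proof -
  show "last_aisle M aisle \<omega> \<le> k" using assms by (auto simp: last_aisle_le_iff)
  assume "first_aisle M aisle \<omega> < last_aisle M aisle \<omega>"
  then have "M \<omega> \<noteq> 0" by (cases "M \<omega> = 0") (auto simp: last_aisle_def)
  moreover have "\<not> aisle j \<omega> \<le> 0" for j using assms by (auto dest!: spec[of _ j])
  ultimately have "\<not> first_aisle M aisle \<omega> \<le> 0"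
    unfolding first_aisle_le_iff by auto
  then show "1 \<le> first_aisle M aisle \<omega>" by simp
qed

text \<open>
  The only nonzero term belongs to the actual interval of visited aisles. Intervals with
  \<open>m < 2\<close> have no interior aisle and are left out of the sum.
\<close>

lemma sum_spans:
  assumes good: "\<forall>j. aisle j \<omega> \<in> {1..k} \<and> 0 \<le> loc j \<omega> \<and> loc j \<omega> \<le> 1"
  shows "(\<Sum>m=2..k-1. \<Sum>i=1..k-m. F i m * aisle_span i m \<omega>) =
    (if first_aisle M aisle \<omega> + 2 \<le> last_aisle M aisle \<omega>
     then F (first_aisle M aisle \<omega>) (last_aisle M aisle \<omega> - first_aisle M aisle \<omega>) else 0)"
proof -
  let ?a = "first_aisle M aisle \<omega>" and ?b = "last_aisle M aisle \<omega>"
  have term_eq: "F i m * aisle_span i m \<omega> =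
      (if m = ?b - ?a then if i = ?a then (if ?a + 2 \<le> ?b then F ?a (?b - ?a) else 0) else 0 else 0)"
    if "2 \<le> m" for i m
    using that by (auto simp: aisle_span_def)
  have "(\<Sum>m=2..k-1. \<Sum>i=1..k-m. F i m * aisle_span i m \<omega>) =
     (\<Sum>m=2..k-1. \<Sum>i=1..k-m. (if m = ?b - ?a then if i = ?a then (if ?a + 2 \<le> ?b then F ?a (?b - ?a) else 0) else 0 else 0))"
    by (intro sum.cong refl term_eq) auto
  also have "\<dots> = (\<Sum>m=2..k-1. if m = ?b - ?a then (\<Sum>i=1..k-m. if i = ?a then (if ?a + 2 \<le> ?b then F ?a (?b - ?a) else 0) else 0) else 0)"
    by (intro sum.cong refl) auto
  also have "\<dots> = (if ?a + 2 \<le> ?b then F ?a (?b - ?a) else 0)"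
    using first_last_aisle_range[OF good] by auto
  finally show ?thesis .
qed

text \<open>
  All functionals of the interior aisles vanish when there are none, so their expectations split along
  the possible intervals. The quadratic bound in the order size is what the finite second moment
  permits.
\<close>

lemma expectation_by_spans:
  assumes [measurable]: "X \<in> borel_measurable \<Omega>" "\<And>i m. F i m \<in> borel_measurable \<Omega>"
    and F: "\<And>i m \<omega>. \<bar>F i m \<omega>\<bar> \<le> B i m * (1 + (real (M \<omega>))\<^sup>2)"
    and X: "AE \<omega> in \<Omega>. X \<omega> = (if first_aisle M aisle \<omega> + 2 \<le> last_aisle M aisle \<omega>
     then F (first_aisle M aisle \<omega>) (last_aisle M aisle \<omega> - first_aisle M aisle \<omega>) \<omega> else 0)"
  shows "integrable \<Omega> X"
    and "expectation X = (\<Sum>m=2..k-1. \<Sum>i=1..k-m. expectation (\<lambda>\<omega>. F i m \<omega> * aisle_span i m \<omega>))"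
proof -
  have int: "integrable \<Omega> (\<lambda>\<omega>. F i m \<omega> * aisle_span i m \<omega>)" for i m
    unfolding aisle_span_def
    by (intro integrable_mult_of_bool integrable_quadratic_bound[where B="B i m"]) (use F in auto)
  have X': "AE \<omega> in \<Omega>. X \<omega> = (\<Sum>m=2..k-1. \<Sum>i=1..k-m. F i m \<omega> * aisle_span i m \<omega>)"
    using X AE_items_in_range by eventually_elim (subst sum_spans; simp)
  show "integrable \<Omega> X"
    by (subst integrable_cong_AE[OF _ _ X']) (auto intro!: Bochner_Integration.integrable_sum int)
  have "expectation X = expectation (\<lambda>\<omega>. \<Sum>m=2..k-1. \<Sum>i=1..k-m. F i m \<omega> * aisle_span i m \<omega>)"
    using X' by (intro integral_cong_AE) auto
  also have "\<dots> = (\<Sum>m=2..k-1. \<Sum>i=1..k-m. expectation (\<lambda>\<omega>. F i m \<omega> * aisle_span i m \<omega>))"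
    by (simp add: int)
  finally show "expectation X = (\<Sum>m=2..k-1. \<Sum>i=1..k-m. expectation (\<lambda>\<omega>. F i m \<omega> * aisle_span i m \<omega>))" .
qed

text \<open>
  Both sums are special cases, so that the equality of their moments needs no reflection of the
  locations.
\<close>

definition half_sum :: "bool \<Rightarrow> 'a \<Rightarrow> real" where
  "half_sum s \<omega> = (\<Sum>j\<in>{first_aisle M aisle \<omega><..<last_aisle M aisle \<omega>}. R (j, s) \<omega>)"

lemma half_sum_eq: "half_sum True = front_sum M aisle loc" "half_sum False = back_sum M aisle loc"
  by (simp_all add: half_sum_def[abs_def] front_sum_def[abs_def] back_sum_def[abs_def] reach_def
      interior_aisles_def)

lemma half_sum_measurable [measurable]: "half_sum s \<in> borel_measurable \<Omega>"
  by (cases s) (simp_all add: half_sum_eq)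

lemma interior_empty: "\<not> a + 2 \<le> b \<Longrightarrow> {a<..<b} = {}" for a b :: nat
  by auto

lemma sum_reach_bound: "\<bar>\<Sum>c\<in>S. R c \<omega>\<bar> \<le> real (card S)"
  using sum_mono[of S "\<lambda>c. \<bar>R c \<omega>\<bar>" "\<lambda>_. 1"] sum_abs[of "\<lambda>c. R c \<omega>" S]
  by (simp add: reach_nonneg reach_le_1 abs_of_nonneg)

lemma integrable_reach_bounded:
  assumes [measurable]: "f \<in> borel_measurable \<Omega>" and "\<And>\<omega>. \<bar>f \<omega>\<bar> \<le> B * (1 + (real (M \<omega>))\<^sup>2)"
  shows "integrable \<Omega> (\<lambda>\<omega>. f \<omega> * aisle_span i m \<omega>)"
  unfolding aisle_span_def
  by (intro integrable_mult_of_bool integrable_quadratic_bound[where B=B]) (use assms in auto)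

lemma le_quadratic: "x \<le> B \<Longrightarrow> 0 \<le> B \<Longrightarrow> x \<le> B * (1 + (real n)\<^sup>2)"
  by (smt (verit) mult_le_cancel_left1 zero_le_power2)

lemma le_quadratic_mult: "x \<le> B * real n \<Longrightarrow> 0 \<le> B \<Longrightarrow> x \<le> B * (1 + (real n)\<^sup>2)"
proof -
  assume "x \<le> B * real n" "0 \<le> B"
  moreover have "real n \<le> 1 + (real n)\<^sup>2" by (cases n) (auto simp: power2_eq_square algebra_simps)
  ultimately show ?thesis by (meson mult_left_mono order_trans)
qed

text \<open>
  There are \<open>k - m\<close> positions of an interval of length \<open>m\<close>, each with \<open>m - 1\<close> interior aisles. In
  the last statement the position \<open>i\<close> has the weight \<open>i + m\<close>.
\<close>

lemma expectation_half_sum: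
  assumes a: "\<And>i m c. 1 \<le> i \<Longrightarrow> i + m \<le> k \<Longrightarrow> 2 \<le> m \<Longrightarrow> fst c \<in> {i<..<i+m} \<Longrightarrow>
      expectation (\<lambda>\<omega>. R c \<omega> * aisle_span i m \<omega>) = a m"
  shows "integrable \<Omega> (half_sum s)"
    and "expectation (half_sum s) = (\<Sum>m=2..k-1. (real m - 1) * (real k - real m) * a m)"
    and "integrable \<Omega> (\<lambda>\<omega>. real (last_aisle M aisle \<omega>) * half_sum s \<omega>)"
    and "expectation (\<lambda>\<omega>. real (last_aisle M aisle \<omega>) * half_sum s \<omega>) =
      (\<Sum>m=2..k-1. 1 / 2 * (real k - real m) * (real k + real m + 1) * (real m - 1) * a m)"
proof -
  define F where "F i m \<omega> = (\<Sum>c\<in>{i<..<i+m} \<times> {s}. R c \<omega>)" for i m \<omega>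
  have hs: "AE \<omega> in \<Omega>. half_sum s \<omega> = (if first_aisle M aisle \<omega> + 2 \<le> last_aisle M aisle \<omega>
     then F (first_aisle M aisle \<omega>) (last_aisle M aisle \<omega> - first_aisle M aisle \<omega>) \<omega> else 0)"
    by (rule AE_I2) (auto simp: half_sum_def F_def interior_empty sum.cartesian_product')
  have card: "card ({i<..<i+m} \<times> {s}) = m - 1" for i m by (simp add: card_cartesian_product)
  have [measurable]: "F i m \<in> borel_measurable \<Omega>" for i m unfolding F_def[abs_def] by measurable
  have Fb: "\<bar>F i m \<omega>\<bar> \<le> real (m - 1)" for i m \<omega>
    using sum_reach_bound[where S="{i<..<i+m} \<times> {s}"] unfolding F_def card .
  have EF: "expectation (\<lambda>\<omega>. F i m \<omega> * aisle_span i m \<omega>) = (real m - 1) * a m"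
    if "m \<in> {2..k-1}" "i \<in> {1..k-m}" for i m
  proof -
    have "expectation (\<lambda>\<omega>. F i m \<omega> * aisle_span i m \<omega>) =
      (\<Sum>c\<in>{i<..<i+m} \<times> {s}. expectation (\<lambda>\<omega>. R c \<omega> * aisle_span i m \<omega>))"
      unfolding F_def sum_distrib_right
      by (intro Bochner_Integration.integral_sum integrable_reach_bounded[where B=1] le_quadratic)
        (auto simp: reach_nonneg reach_le_1)
    also have "\<dots> = (\<Sum>c\<in>{i<..<i+m} \<times> {s}. a m)"
      using that by (intro sum.cong refl a) auto
    finally show ?thesis using that by (simp add: card of_nat_diff)
  qed
  show "integrable \<Omega> (half_sum s)"
    by (rule expectation_by_spans(1)[where F=F and B="\<lambda>i m. real (m - 1)", OF _ _ le_quadratic[OF Fb] hs]) auto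
  have "expectation (half_sum s) = (\<Sum>m=2..k-1. \<Sum>i=1..k-m. expectation (\<lambda>\<omega>. F i m \<omega> * aisle_span i m \<omega>))"
    by (rule expectation_by_spans(2)[where F=F and B="\<lambda>i m. real (m - 1)", OF _ _ le_quadratic[OF Fb] hs]) auto
  also have "\<dots> = (\<Sum>m=2..k-1. \<Sum>i=1..k-m. (real m - 1) * a m)"
    by (intro sum.cong refl EF) auto
  also have "\<dots> = (\<Sum>m=2..k-1. (real m - 1) * (real k - real m) * a m)"
    by (intro sum.cong refl) (auto simp: of_nat_diff)
  finally show "expectation (half_sum s) = (\<Sum>m=2..k-1. (real m - 1) * (real k - real m) * a m)" .
  have Fb': "\<bar>real (i + m) * F i m \<omega>\<bar> \<le> real (i + m) * real (m - 1)" for i m \<omega>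
    unfolding abs_mult by (rule mult_mono[OF _ Fb]) auto
  have hs': "AE \<omega> in \<Omega>. real (last_aisle M aisle \<omega>) * half_sum s \<omega> =
    (if first_aisle M aisle \<omega> + 2 \<le> last_aisle M aisle \<omega>
     then real (first_aisle M aisle \<omega> + (last_aisle M aisle \<omega> - first_aisle M aisle \<omega>)) *
       F (first_aisle M aisle \<omega>) (last_aisle M aisle \<omega> - first_aisle M aisle \<omega>) \<omega> else 0)"
    using hs by eventually_elim simp
  show "integrable \<Omega> (\<lambda>\<omega>. real (last_aisle M aisle \<omega>) * half_sum s \<omega>)"
    by (rule expectation_by_spans(1)[where F="\<lambda>i m \<omega>. real (i + m) * F i m \<omega>" and B="\<lambda>i m. real (i + m) * real (m - 1)", OF _ _ le_quadratic[OF Fb'] hs']) auto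
  have "expectation (\<lambda>\<omega>. real (last_aisle M aisle \<omega>) * half_sum s \<omega>) =
     (\<Sum>m=2..k-1. \<Sum>i=1..k-m. expectation (\<lambda>\<omega>. (real (i + m) * F i m \<omega>) * aisle_span i m \<omega>))"
    by (rule expectation_by_spans(2)[where F="\<lambda>i m \<omega>. real (i + m) * F i m \<omega>" and B="\<lambda>i m. real (i + m) * real (m - 1)", OF _ _ le_quadratic[OF Fb'] hs']) auto
  also have "\<dots> = (\<Sum>m=2..k-1. \<Sum>i=1..k-m. real (i + m) * ((real m - 1) * a m))"
    by (intro sum.cong refl) (simp only: mult.assoc integral_mult_right_zero EF)
  also have "\<dots> = (\<Sum>m=2..k-1. 1 / 2 * (real k - real m) * (real k + real m + 1) * (real m - 1) * a m)"
  proof (intro sum.cong refl)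
    fix m assume m: "m \<in> {2..k-1}"
    have "(\<Sum>i=1..n. real (i + m)) = real n * (real n + 2 * real m + 1) / 2" for n
      by (induction n) (auto simp: field_simps)
    moreover have "real (k - m) = real k - real m" using m by (intro of_nat_diff) auto
    ultimately have "(\<Sum>i=1..k-m. real (i + m)) = (real k - real m) * (real k + real m + 1) / 2"
      by (simp only:) (simp add: algebra_simps)
    then show "(\<Sum>i=1..k-m. real (i + m) * ((real m - 1) * a m)) =
       1 / 2 * (real k - real m) * (real k + real m + 1) * (real m - 1) * a m"
      by (simp add: sum_distrib_right[symmetric] del: of_nat_add)
  qed
  finally show "expectation (\<lambda>\<omega>. real (last_aisle M aisle \<omega>) * half_sum s \<omega>) =
      (\<Sum>m=2..k-1. 1 / 2 * (real k - real m) * (real k + real m + 1) * (real m - 1) * a m)" .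
qed

text \<open>
  The square expands into pairs of interior half-aisles: \<open>2 * (m - 1)\<close> equal pairs, and
  for each half-aisle \<open>2 * m - 3\<close> different partners.
\<close>

lemma expectation_total_square:
  assumes b: "\<And>i m c. 1 \<le> i \<Longrightarrow> i + m \<le> k \<Longrightarrow> 2 \<le> m \<Longrightarrow> fst c \<in> {i<..<i+m} \<Longrightarrow>
      expectation (\<lambda>\<omega>. (R c \<omega>)\<^sup>2 * aisle_span i m \<omega>) = b m"
    and c: "\<And>i m d d'. 1 \<le> i \<Longrightarrow> i + m \<le> k \<Longrightarrow> 2 \<le> m \<Longrightarrow> fst d \<in> {i<..<i+m} \<Longrightarrow>
      fst d' \<in> {i<..<i+m} \<Longrightarrow> d \<noteq> d' \<Longrightarrow>
      expectation (\<lambda>\<omega>. R d \<omega> * R d' \<omega> * aisle_span i m \<omega>) = c m"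
  shows "integrable \<Omega> (\<lambda>\<omega>. (half_sum True \<omega> + half_sum False \<omega>)\<^sup>2)"
    and "expectation (\<lambda>\<omega>. (half_sum True \<omega> + half_sum False \<omega>)\<^sup>2) =
      (\<Sum>m=2..k-1. (2 * real m - 2) * (real k - real m) * b m)
       + (\<Sum>m=2..k-1. (2 * real m - 2) * (2 * real m - 3) * (real k - real m) * c m)"
proof -
  let ?S = "\<lambda>i m. {i<..<i+m} \<times> (UNIV :: bool set)"
  define F where "F i m \<omega> = (\<Sum>c\<in>?S i m. R c \<omega>)\<^sup>2" for i m \<omega>
  have hs: "AE \<omega> in \<Omega>. (half_sum True \<omega> + half_sum False \<omega>)\<^sup>2 = (if first_aisle M aisle \<omega> + 2 \<le> last_aisle M aisle \<omega>
     then F (first_aisle M aisle \<omega>) (last_aisle M aisle \<omega> - first_aisle M aisle \<omega>) \<omega> else 0)"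
    by (rule AE_I2) (auto simp: half_sum_def F_def interior_empty sum.cartesian_product' UNIV_bool
        sum.distrib add.commute)
  have card: "card (?S i m) = 2 * (m - 1)" for i m by (simp add: card_cartesian_product)
  have [measurable]: "F i m \<in> borel_measurable \<Omega>" for i m unfolding F_def[abs_def] by measurable
  have Fb: "\<bar>F i m \<omega>\<bar> \<le> (real (2 * (m - 1)))\<^sup>2" for i m \<omega>
    using power_mono[OF sum_reach_bound[where S="?S i m"], where n=2] unfolding F_def card by simp
  have EF: "expectation (\<lambda>\<omega>. F i m \<omega> * aisle_span i m \<omega>) =
      (2 * real m - 2) * b m + (2 * real m - 2) * (2 * real m - 3) * c m"
    if m: "m \<in> {2..k-1}" and i: "i \<in> {1..k-m}" for i m
  proof -
    have eq: "F i m \<omega> * aisle_span i m \<omega> = (\<Sum>c\<in>?S i m. \<Sum>c'\<in>?S i m. R c \<omega> * R c' \<omega> * aisle_span i m \<omega>)" for \<omega>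
      unfolding F_def power2_eq_square sum_product unfolding sum_distrib_right ..
    have int: "integrable \<Omega> (\<lambda>\<omega>. R c \<omega> * R c' \<omega> * aisle_span i m \<omega>)" for c c'
      by (intro integrable_reach_bounded[where B=1] le_quadratic)
        (auto simp: abs_mult reach_nonneg reach_le_1 mult_le_one)
    have "expectation (\<lambda>\<omega>. F i m \<omega> * aisle_span i m \<omega>) =
      (\<Sum>c\<in>?S i m. \<Sum>c'\<in>?S i m. expectation (\<lambda>\<omega>. R c \<omega> * R c' \<omega> * aisle_span i m \<omega>))"
      unfolding eq by (simp add: int)
    also have "\<dots> = (\<Sum>d\<in>?S i m. \<Sum>d'\<in>?S i m. if d' = d then b m else c m)"
    proof (intro sum.cong refl)
      fix d d' assume "d \<in> ?S i m" "d' \<in> ?S i m"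
      then show "expectation (\<lambda>\<omega>. R d \<omega> * R d' \<omega> * aisle_span i m \<omega>) = (if d' = d then b m else c m)"
        using b[of i m d] c[of i m d d'] m i by (auto simp: power2_eq_square mem_Times_iff)
    qed
    also have "\<dots> = (\<Sum>d\<in>?S i m. b m + (2 * real m - 3) * c m)"
    proof (intro sum.cong refl)
      fix d assume d: "d \<in> ?S i m"
      have "(\<Sum>d'\<in>?S i m. if d' = d then b m else c m) = b m + (\<Sum>d'\<in>?S i m - {d}. c m)"
        using d by (subst sum.remove[of _ d]) (auto intro!: sum.cong)
      also have "(\<Sum>d'\<in>?S i m - {d}. c m) = (2 * real m - 3) * c m"
        using d m by (simp add: card_Diff_singleton card of_nat_diff algebra_simps)
      finally show "(\<Sum>d'\<in>?S i m. if d' = d then b m else c m) = b m + (2 * real m - 3) * c m" .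
    qed
    also have "\<dots> = (2 * real m - 2) * b m + (2 * real m - 2) * (2 * real m - 3) * c m"
      using m by (simp add: card of_nat_diff algebra_simps)
    finally show ?thesis .
  qed
  show "integrable \<Omega> (\<lambda>\<omega>. (half_sum True \<omega> + half_sum False \<omega>)\<^sup>2)"
    by (rule expectation_by_spans(1)[where F=F and B="\<lambda>i m. (real (2 * (m - 1)))\<^sup>2", OF _ _ le_quadratic[OF Fb] hs]) auto
  have "expectation (\<lambda>\<omega>. (half_sum True \<omega> + half_sum False \<omega>)\<^sup>2) =
      (\<Sum>m=2..k-1. \<Sum>i=1..k-m. expectation (\<lambda>\<omega>. F i m \<omega> * aisle_span i m \<omega>))"
    by (rule expectation_by_spans(2)[where F=F and B="\<lambda>i m. (real (2 * (m - 1)))\<^sup>2", OF _ _ le_quadratic[OF Fb] hs]) auto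
  also have "\<dots> = (\<Sum>m=2..k-1. \<Sum>i=1..k-m. (2 * real m - 2) * b m + (2 * real m - 2) * (2 * real m - 3) * c m)"
    by (intro sum.cong refl EF) auto
  also have "\<dots> = (\<Sum>m=2..k-1. (2 * real m - 2) * (real k - real m) * b m
       + (2 * real m - 2) * (2 * real m - 3) * (real k - real m) * c m)"
    by (intro sum.cong refl) (auto simp: of_nat_diff algebra_simps)
  finally show "expectation (\<lambda>\<omega>. (half_sum True \<omega> + half_sum False \<omega>)\<^sup>2) =
      (\<Sum>m=2..k-1. (2 * real m - 2) * (real k - real m) * b m)
       + (\<Sum>m=2..k-1. (2 * real m - 2) * (2 * real m - 3) * (real k - real m) * c m)"
    by (simp add: sum.distrib)
qed

lemma size_eq_sum_num_cell:
  assumes good: "\<forall>j. aisle j \<omega> \<in> {1..k} \<and> 0 \<le> loc j \<omega> \<and> loc j \<omega> \<le> 1"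
  shows "real (M \<omega>) = (\<Sum>b\<in>{first_aisle M aisle \<omega>..last_aisle M aisle \<omega>} \<times> UNIV. real (N b \<omega>))"
proof -
  let ?B = "{first_aisle M aisle \<omega>..last_aisle M aisle \<omega>} \<times> (UNIV :: bool set)"
  have cell: "cell_of aisle loc j \<omega> \<in> ?B" if "j < M \<omega>" for j
    using that first_aisle_le_iff[of M aisle \<omega> "aisle j \<omega>"] last_aisle_le_iff[of M aisle \<omega> "last_aisle M aisle \<omega>"]
    by (auto simp: cell_of_def)
  have "(\<Sum>b\<in>?B. real (N b \<omega>)) = (\<Sum>b\<in>?B. \<Sum>j<M \<omega>. of_bool (cell_of aisle loc j \<omega> = b))"
    using good by (intro sum.cong refl num_cell_eq_sum) auto
  also have "\<dots> = (\<Sum>j<M \<omega>. \<Sum>b\<in>?B. if b = cell_of aisle loc j \<omega> then 1 else 0)"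
    by (subst sum.swap) (auto intro!: sum.cong)
  also have "\<dots> = (\<Sum>j<M \<omega>. 1)" using cell by (intro sum.cong refl) simp
  finally show ?thesis by simp
qed

text \<open>
  The order size is the sum of the counts over all \<open>2 * (m + 1)\<close> half-aisles of the interval. Seen from
  an interior half-aisle these are the half-aisle itself, \<open>2 * m - 3\<close> other interior ones and the four
  of the end aisles.
\<close>

lemma expectation_size_half_sum:
  assumes d: "\<And>i m c b. 1 \<le> i \<Longrightarrow> i + m \<le> k \<Longrightarrow> 2 \<le> m \<Longrightarrow> fst c \<in> {i<..<i+m} \<Longrightarrow>
      fst b \<in> {i<..<i+m} \<Longrightarrow> b \<noteq> c \<Longrightarrow>
      expectation (\<lambda>\<omega>. R c \<omega> * real (N b \<omega>) * aisle_span i m \<omega>) = d m"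
    and e: "\<And>i m c. 1 \<le> i \<Longrightarrow> i + m \<le> k \<Longrightarrow> 2 \<le> m \<Longrightarrow> fst c \<in> {i<..<i+m} \<Longrightarrow>
      expectation (\<lambda>\<omega>. R c \<omega> * real (N c \<omega>) * aisle_span i m \<omega>) = e m"
    and f: "\<And>i m c b. 1 \<le> i \<Longrightarrow> i + m \<le> k \<Longrightarrow> 2 \<le> m \<Longrightarrow> fst c \<in> {i<..<i+m} \<Longrightarrow>
      fst b = i \<or> fst b = i + m \<Longrightarrow>
      expectation (\<lambda>\<omega>. R c \<omega> * real (N b \<omega>) * aisle_span i m \<omega>) = f m"
  shows "integrable \<Omega> (\<lambda>\<omega>. real (M \<omega>) * half_sum s \<omega>)"
    and "expectation (\<lambda>\<omega>. real (M \<omega>) * half_sum s \<omega>) =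
         (\<Sum>m=2..k-1. (real k - real m) * (real m - 1) * (2 * real m - 3) * d m)
       + (\<Sum>m=2..k-1. (real k - real m) * (real m - 1) * e m)
       + (\<Sum>m=2..k-1. 4 * (real k - real m) * (real m - 1) * f m)"
proof -
  let ?S = "\<lambda>i m. {i<..<i+m} \<times> {s}" and ?B = "\<lambda>i m. {i..i+m} \<times> (UNIV :: bool set)"
  define F where "F i m \<omega> = (\<Sum>c\<in>?S i m. \<Sum>b\<in>?B i m. R c \<omega> * real (N b \<omega>))" for i m \<omega>
  have hs: "AE \<omega> in \<Omega>. real (M \<omega>) * half_sum s \<omega> = (if first_aisle M aisle \<omega> + 2 \<le> last_aisle M aisle \<omega>
     then F (first_aisle M aisle \<omega>) (last_aisle M aisle \<omega> - first_aisle M aisle \<omega>) \<omega> else 0)"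
    using AE_items_in_range
  proof eventually_elim
    case (elim \<omega>)
    show ?case
      unfolding size_eq_sum_num_cell[OF elim]
      by (auto simp: half_sum_def F_def interior_empty sum.cartesian_product'
          sum_distrib_left[symmetric] sum_distrib_right[symmetric] mult.commute)
  qed
  have card: "card (?S i m) = m - 1" for i m by (simp add: card_cartesian_product)
  have [measurable]: "F i m \<in> borel_measurable \<Omega>" for i m unfolding F_def[abs_def] by measurable
  have RN: "\<bar>R c \<omega> * real (N b \<omega>)\<bar> \<le> real (M \<omega>)" for c b \<omega>
    using mult_mono[of "R c \<omega>" 1 "real (N b \<omega>)" "real (M \<omega>)"]
    by (simp add: abs_mult reach_nonneg reach_le_1 num_cell_le)
  have Fb: "\<bar>F i m \<omega>\<bar> \<le> real (card (?S i m)) * real (card (?B i m)) * real (M \<omega>)" for i m \<omega>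
  proof -
    have "\<bar>F i m \<omega>\<bar> \<le> (\<Sum>c\<in>?S i m. \<Sum>b\<in>?B i m. real (M \<omega>))"
      unfolding F_def by (intro order_trans[OF sum_abs] sum_mono order_trans[OF sum_abs] RN)
    then show ?thesis by simp
  qed
  have EF: "expectation (\<lambda>\<omega>. F i m \<omega> * aisle_span i m \<omega>) =
      (real m - 1) * ((2 * real m - 3) * d m + e m + 4 * f m)"
    if m: "m \<in> {2..k-1}" and i: "i \<in> {1..k-m}" for i m
  proof -
    have int: "integrable \<Omega> (\<lambda>\<omega>. R c \<omega> * real (N b \<omega>) * aisle_span i m \<omega>)" for c b
      by (intro integrable_reach_bounded[where B=1] le_quadratic_mult order_trans[OF RN]) auto
    have "expectation (\<lambda>\<omega>. F i m \<omega> * aisle_span i m \<omega>) =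
      (\<Sum>c\<in>?S i m. \<Sum>b\<in>?B i m. expectation (\<lambda>\<omega>. R c \<omega> * real (N b \<omega>) * aisle_span i m \<omega>))"
      unfolding F_def sum_distrib_right by (simp add: int)
    also have "\<dots> = (\<Sum>c\<in>?S i m. (2 * real m - 3) * d m + e m + 4 * f m)"
    proof (intro sum.cong refl)
      fix c assume c: "c \<in> ?S i m"
      let ?E = "\<lambda>b. expectation (\<lambda>\<omega>. R c \<omega> * real (N b \<omega>) * aisle_span i m \<omega>)"
      let ?I = "{i<..<i+m} \<times> (UNIV :: bool set)" and ?X = "{i, i+m} \<times> (UNIV :: bool set)"
      have c': "c \<in> ?I" using c by auto
      have "?B i m = ?I \<union> ?X" "?I \<inter> ?X = {}" using m by auto
      then have "(\<Sum>b\<in>?B i m. ?E b) = (\<Sum>b\<in>?I. ?E b) + (\<Sum>b\<in>?X. ?E b)"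
        by (simp add: sum.union_disjoint)
      also have "(\<Sum>b\<in>?I. ?E b) = ?E c + (\<Sum>b\<in>?I - {c}. ?E b)"
        using c' by (simp add: sum.remove)
      also have "?E c = e m" using c' m i by (intro e) auto
      also have "(\<Sum>b\<in>?I - {c}. ?E b) = (\<Sum>b\<in>?I - {c}. d m)"
        using c' m i by (intro sum.cong refl d) auto
      also have "\<dots> = (2 * real m - 3) * d m"
        using c' m by (simp add: card_Diff_singleton card_cartesian_product of_nat_diff algebra_simps)
      also have "(\<Sum>b\<in>?X. ?E b) = (\<Sum>b\<in>?X. f m)"
        using c' m i by (intro sum.cong refl f) auto
      also have "\<dots> = 4 * f m"
        using m by (simp add: card_cartesian_product)
      finally show "(\<Sum>b\<in>?B i m. ?E b) = (2 * real m - 3) * d m + e m + 4 * f m" by simp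
    qed
    also have "\<dots> = (real m - 1) * ((2 * real m - 3) * d m + e m + 4 * f m)"
      using m by (simp add: card of_nat_diff)
    finally show ?thesis .
  qed
  show "integrable \<Omega> (\<lambda>\<omega>. real (M \<omega>) * half_sum s \<omega>)"
    by (rule expectation_by_spans(1)[OF _ _ le_quadratic_mult[OF Fb] hs]) auto
  have "expectation (\<lambda>\<omega>. real (M \<omega>) * half_sum s \<omega>) =
     (\<Sum>m=2..k-1. \<Sum>i=1..k-m. expectation (\<lambda>\<omega>. F i m \<omega> * aisle_span i m \<omega>))"
    by (rule expectation_by_spans(2)[OF _ _ le_quadratic_mult[OF Fb] hs]) auto
  also have "\<dots> = (\<Sum>m=2..k-1. \<Sum>i=1..k-m. (real m - 1) * ((2 * real m - 3) * d m + e m + 4 * f m))"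
    by (intro sum.cong refl EF) auto
  also have "\<dots> = (\<Sum>m=2..k-1. (real k - real m) * (real m - 1) * (2 * real m - 3) * d m
       + (real k - real m) * (real m - 1) * e m + 4 * (real k - real m) * (real m - 1) * f m)"
    by (intro sum.cong refl) (auto simp: of_nat_diff algebra_simps)
  finally show "expectation (\<lambda>\<omega>. real (M \<omega>) * half_sum s \<omega>) =
         (\<Sum>m=2..k-1. (real k - real m) * (real m - 1) * (2 * real m - 3) * d m)
       + (\<Sum>m=2..k-1. (real k - real m) * (real m - 1) * e m)
       + (\<Sum>m=2..k-1. 4 * (real k - real m) * (real m - 1) * f m)"
    by (simp add: sum.distrib)
qed

section \<open>The last visited aisle\<close>

lemma pgf_last_aisle_le:
  assumes "r \<le> k"
  shows "expectation (\<lambda>\<omega>. of_bool (last_aisle M aisle \<omega> \<le> r)) = pgf \<Omega> M (real r / real k)"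
    and "expectation (\<lambda>\<omega>. real (M \<omega>) * of_bool (last_aisle M aisle \<omega> \<le> r)) =
      real r / real k * pgf_deriv \<Omega> M (real r / real k)"
proof -
  let ?W = "\<lambda>\<omega>. of_bool (all_items_within ({1..r} \<times> UNIV) (\<lambda>_. 1) \<omega>) :: real"
  have sub: "{1..r} \<times> UNIV \<subseteq> {1..k} \<times> (UNIV :: bool set)" using assms by auto
  have sum: "(\<Sum>c\<in>{1..r} \<times> (UNIV :: bool set). 1) / (2 * real k) = real r / real k"
    by (simp add: card_cartesian_product)
  have eq: "AE \<omega> in \<Omega>. of_bool (last_aisle M aisle \<omega> \<le> r) = ?W \<omega>"
    using AE_items_in_range
  proof eventually_elim
    case (elim \<omega>)
    then have "depth (loc j \<omega>) \<le> 1" "1 \<le> aisle j \<omega>" for j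
      by (auto simp: depth_def)
    then show ?case by (auto simp: last_aisle_le_iff all_items_within_def cell_of_def)
  qed
  have "expectation (\<lambda>\<omega>. of_bool (last_aisle M aisle \<omega> \<le> r)) = expectation ?W"
    by (rule integral_cong_AE[OF _ _ eq]) measurable
  also have "\<dots> = pgf \<Omega> M (real r / real k)"
    using expectation_all_items_within[OF sub, of "\<lambda>_. 1"] unfolding sum by simp
  finally show "expectation (\<lambda>\<omega>. of_bool (last_aisle M aisle \<omega> \<le> r)) = pgf \<Omega> M (real r / real k)" .
  from eq have "AE \<omega> in \<Omega>. real (M \<omega>) * of_bool (last_aisle M aisle \<omega> \<le> r) = real (M \<omega>) * ?W \<omega>"
    by eventually_elim simp
  then have "expectation (\<lambda>\<omega>. real (M \<omega>) * of_bool (last_aisle M aisle \<omega> \<le> r)) =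
      expectation (\<lambda>\<omega>. real (M \<omega>) * ?W \<omega>)"
    by (rule integral_cong_AE[rotated 2]) measurable
  also have "\<dots> = real r / real k * pgf_deriv \<Omega> M (real r / real k)"
    using expectation_size_all_items_within[OF sub, of "\<lambda>_. 1"] unfolding sum by simp
  finally show "expectation (\<lambda>\<omega>. real (M \<omega>) * of_bool (last_aisle M aisle \<omega> \<le> r)) =
      real r / real k * pgf_deriv \<Omega> M (real r / real k)" .
qed

text \<open>
  Summation of tails: \<open>r\<close> contributes \<open>w r\<close> exactly if the last aisle exceeds \<open>r\<close>. The weights 1 and
  \<open>2 * r + 1\<close> give the first and second power.
\<close>

lemma expectation_weighted_last_aisle:
  fixes w :: "nat \<Rightarrow> real"
  assumes W: "integrable \<Omega> W"
  shows "expectation (\<lambda>\<omega>. W \<omega> * (\<Sum>r<last_aisle M aisle \<omega>. w r)) =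
    (\<Sum>r<k. w r) * expectation W - (\<Sum>r<k. w r * expectation (\<lambda>\<omega>. W \<omega> * of_bool (last_aisle M aisle \<omega> \<le> r)))"
proof -
  have [measurable]: "W \<in> borel_measurable \<Omega>" using W by auto
  have int: "integrable \<Omega> (\<lambda>\<omega>. W \<omega> * of_bool (last_aisle M aisle \<omega> \<le> r))" for r
    by (rule integrable_mult_of_bool[OF W]) measurable
  have [measurable]: "(\<lambda>\<omega>. \<Sum>r<last_aisle M aisle \<omega>. w r) \<in> borel_measurable \<Omega>"
    by (rule measurable_compose_countable[of "\<lambda>n _. \<Sum>r<n. w r"]) measurable
  have "AE \<omega> in \<Omega>. W \<omega> * (\<Sum>r<last_aisle M aisle \<omega>. w r) =
      (\<Sum>r<k. w r) * W \<omega> - (\<Sum>r<k. w r * (W \<omega> * of_bool (last_aisle M aisle \<omega> \<le> r)))"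
    using AE_items_in_range
  proof eventually_elim
    case (elim \<omega>)
    let ?n = "last_aisle M aisle \<omega>"
    have "(\<Sum>r<k. w r * of_bool (?n \<le> r)) = (\<Sum>r\<in>{..<k} - {..<?n}. w r)"
      by (rule sum.mono_neutral_cong_right) auto
    also have "\<dots> = (\<Sum>r<k. w r) - (\<Sum>r<?n. w r)"
      using first_last_aisle_range(1)[OF elim] by (intro sum_diff) auto
    finally have "(\<Sum>r<?n. w r) = (\<Sum>r<k. w r) - (\<Sum>r<k. w r * of_bool (?n \<le> r))" by linarith
    moreover have "W \<omega> * (\<Sum>r<k. w r * of_bool (?n \<le> r)) = (\<Sum>r<k. w r * (W \<omega> * of_bool (?n \<le> r)))"
      by (simp only: sum_distrib_left mult.left_commute)
    ultimately show ?case by (simp only: right_diff_distrib mult.commute[of "W \<omega>" "sum w {..<k}"])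
  qed
  then have "expectation (\<lambda>\<omega>. W \<omega> * (\<Sum>r<last_aisle M aisle \<omega>. w r)) =
     expectation (\<lambda>\<omega>. (\<Sum>r<k. w r) * W \<omega> - (\<Sum>r<k. w r * (W \<omega> * of_bool (last_aisle M aisle \<omega> \<le> r))))"
    by (intro integral_cong_AE) auto
  also have "\<dots> = (\<Sum>r<k. w r) * expectation W - (\<Sum>r<k. w r * expectation (\<lambda>\<omega>. W \<omega> * of_bool (last_aisle M aisle \<omega> \<le> r)))"
    using W int by (subst Bochner_Integration.integral_diff) auto
  finally show ?thesis .
qed

lemma sum_odd_real: "(\<Sum>r<n. 2 * real r + 1) = (real n)\<^sup>2"
  by (induction n) (auto simp: power2_eq_square algebra_simps)

lemma last_aisle_moments:
  "expectation (\<lambda>\<omega>. real (last_aisle M aisle \<omega>)) = real k - (\<Sum>r<k. pgf \<Omega> M (real r / real k))"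
  "expectation (\<lambda>\<omega>. (real (last_aisle M aisle \<omega>))\<^sup>2) =
     (real k)\<^sup>2 - (\<Sum>r<k. (2 * real r + 1) * pgf \<Omega> M (real r / real k))"
  "expectation (\<lambda>\<omega>. real (M \<omega>) * real (last_aisle M aisle \<omega>)) =
     real k * expectation (\<lambda>\<omega>. real (M \<omega>)) - (\<Sum>r<k. real r / real k * deriv01 (pgf \<Omega> M) (real r / real k))"
proof -
  note W = expectation_weighted_last_aisle
  show "expectation (\<lambda>\<omega>. real (last_aisle M aisle \<omega>)) = real k - (\<Sum>r<k. pgf \<Omega> M (real r / real k))"
    using W[of "\<lambda>_. 1" "\<lambda>_. 1"] by (simp add: pgf_last_aisle_le prob_space)
  show "expectation (\<lambda>\<omega>. (real (last_aisle M aisle \<omega>))\<^sup>2) =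
     (real k)\<^sup>2 - (\<Sum>r<k. (2 * real r + 1) * pgf \<Omega> M (real r / real k))"
    using W[of "\<lambda>_. 1" "\<lambda>r. 2 * real r + 1"] unfolding sum_odd_real by (simp add: pgf_last_aisle_le prob_space)
  have "deriv01 (pgf \<Omega> M) (real r / real k) = pgf_deriv \<Omega> M (real r / real k)" if "r < k" for r
    using that by (intro deriv01_eq pgf_has_derivative M_integrable M_measurable) (auto simp: field_simps)
  then show "expectation (\<lambda>\<omega>. real (M \<omega>) * real (last_aisle M aisle \<omega>)) =
     real k * expectation (\<lambda>\<omega>. real (M \<omega>)) - (\<Sum>r<k. real r / real k * deriv01 (pgf \<Omega> M) (real r / real k))"
    using W[OF M_integrable, of "\<lambda>_. 1"] by (simp add: pgf_last_aisle_le)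
qed

section \<open>Picking times\<close>

abbreviation order_sources :: "source set" where
  "order_sources \<equiv> - range Item_Pick"

text \<open>
  Functions of all random sources except the picking times. The restriction keeps the argument in the
  product space over the remaining sources.
\<close>

definition order_determined :: "('a \<Rightarrow> real) \<Rightarrow> bool" where
  "order_determined F \<longleftrightarrow> (\<exists>f \<in> borel_measurable (PiM order_sources (\<lambda>_. borel)).
     F = (\<lambda>\<omega>. f (restrict (\<lambda>s. source_value s \<omega>) order_sources)))"

lemma order_determined_mult:
  assumes "order_determined F" "order_determined G"
  shows "order_determined (\<lambda>\<omega>. F \<omega> * G \<omega>)"
proof -
  from assms obtain f g where fg: "f \<in> borel_measurable (PiM order_sources (\<lambda>_. borel))"
      "g \<in> borel_measurable (PiM order_sources (\<lambda>_. borel))"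
    and FG: "F = (\<lambda>\<omega>. f (restrict (\<lambda>s. source_value s \<omega>) order_sources))"
      "G = (\<lambda>\<omega>. g (restrict (\<lambda>s. source_value s \<omega>) order_sources))"
    unfolding order_determined_def by blast
  show ?thesis unfolding order_determined_def FG
    by (rule bexI[of _ "\<lambda>y. f y * g y"]) (use fg in auto)
qed

text \<open>
  The statistics are evaluated on the space of source values by applying their own definitions to
  the coordinate functions, where rounding down recovers the integers that were embedded into the reals.
\<close>

lemma order_determined_statistics:
  "order_determined (\<lambda>_. 1)"
  "order_determined (\<lambda>\<omega>. of_bool (M \<omega> = n))"
  "order_determined (\<lambda>\<omega>. real (last_aisle M aisle \<omega>))"
  "order_determined (front_sum M aisle loc)"
  "order_determined (back_sum M aisle loc)"
proof -
  let ?N = "PiM order_sources (\<lambda>_. borel :: real measure)"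
  define M' where "M' y = nat \<lfloor>y Order_Size\<rfloor>" for y :: "source \<Rightarrow> real"
  define aisle' where "aisle' j y = nat \<lfloor>y (Item_Aisle j)\<rfloor>" for j and y :: "source \<Rightarrow> real"
  define loc' where "loc' j y = y (Item_Loc j)" for j and y :: "source \<Rightarrow> real"
  define \<rho> where "\<rho> \<omega> = restrict (\<lambda>s. source_value s \<omega>) order_sources" for \<omega>
  have meas: "M' \<in> measurable ?N (count_space UNIV)" "aisle' j \<in> measurable ?N (count_space UNIV)"
    "loc' j \<in> borel_measurable ?N" for j
  proof -
    have [measurable]: "(\<lambda>y. y Order_Size) \<in> borel_measurable ?N"
      "(\<lambda>y. y (Item_Aisle j)) \<in> borel_measurable ?N" "(\<lambda>y. y (Item_Loc j)) \<in> borel_measurable ?N"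
      by (auto intro!: measurable_component_singleton)
    show "M' \<in> measurable ?N (count_space UNIV)" "aisle' j \<in> measurable ?N (count_space UNIV)"
      "loc' j \<in> borel_measurable ?N"
      unfolding M'_def[abs_def] aisle'_def[abs_def] loc'_def[abs_def] by measurable
  qed
  have eqs: "M' (\<rho> \<omega>) = M \<omega>" "aisle' j (\<rho> \<omega>) = aisle j \<omega>" "loc' j (\<rho> \<omega>) = loc j \<omega>" for j \<omega>
    by (auto simp: M'_def aisle'_def loc'_def \<rho>_def)
  have last_eq: "last_aisle M' aisle' (\<rho> \<omega>) = last_aisle M aisle \<omega>" for \<omega>
    by (simp add: last_aisle_def num_items_def eqs)
  have first_eq: "first_aisle M' aisle' (\<rho> \<omega>) = first_aisle M aisle \<omega>" for \<omega>
    by (simp add: first_aisle_def num_items_def eqs)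
  have items_eq: "front_items M' aisle' loc' i (\<rho> \<omega>) = front_items M aisle loc i \<omega>"
    "back_items M' aisle' loc' i (\<rho> \<omega>) = back_items M aisle loc i \<omega>" for i \<omega>
    by (simp_all add: front_items_def back_items_def eqs)
  have sums_eq: "front_sum M' aisle' loc' (\<rho> \<omega>) = front_sum M aisle loc \<omega>"
    "back_sum M' aisle' loc' (\<rho> \<omega>) = back_sum M aisle loc \<omega>" for \<omega>
    unfolding front_sum_def back_sum_def interior_aisles_def front_reach_def back_reach_def
      items_eq eqs last_eq first_eq by (rule refl)+
  note [measurable] = meas last_aisle_measurable[where aisle=aisle', OF meas(1,2)]
  have od: "order_determined (\<lambda>\<omega>. f (\<rho> \<omega>))" if "f \<in> borel_measurable ?N" for f
    using that unfolding order_determined_def \<rho>_def by blast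
  have "(\<lambda>y. of_bool (M' y = n) :: real) \<in> borel_measurable ?N" by measurable
  from od[OF this] show "order_determined (\<lambda>\<omega>. of_bool (M \<omega> = n))" by (simp add: eqs)
  have "(\<lambda>y. real (last_aisle M' aisle' y)) \<in> borel_measurable ?N" by measurable
  from od[OF this] show "order_determined (\<lambda>\<omega>. real (last_aisle M aisle \<omega>))" by (simp add: last_eq)
  from od[of "\<lambda>_. 1"] show "order_determined (\<lambda>_. 1)" by simp
  from od[OF front_sum_measurable[where aisle=aisle' and loc=loc', OF meas]] show "order_determined (front_sum M aisle loc)"
    by (simp add: sums_eq)
  from od[OF back_sum_measurable[where aisle=aisle' and loc=loc', OF meas]] show "order_determined (back_sum M aisle loc)"
    by (simp add: sums_eq)
qed

lemma pick_P:
  fixes p :: "real \<Rightarrow> real"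
  assumes [measurable]: "p \<in> borel_measurable borel" and int: "integrable \<Omega> (\<lambda>\<omega>. p (P \<omega>))"
  shows "integrable \<Omega> (\<lambda>\<omega>. p (pick j \<omega>))" "expectation (\<lambda>\<omega>. p (pick j \<omega>)) = expectation (\<lambda>\<omega>. p (P \<omega>))"
proof -
  show "integrable \<Omega> (\<lambda>\<omega>. p (pick j \<omega>))"
    using int integrable_distr_eq[of "pick j" \<Omega> borel p] integrable_distr_eq[of P \<Omega> borel p]
    by (simp add: pick_distr)
  show "expectation (\<lambda>\<omega>. p (pick j \<omega>)) = expectation (\<lambda>\<omega>. p (P \<omega>))"
    using integral_distr[of "pick j" \<Omega> borel p] integral_distr[of P \<Omega> borel p]
    by (simp add: pick_distr)
qed

lemma AE_picks_nonneg: "AE \<omega> in \<Omega>. \<forall>j. 0 \<le> pick j \<omega>"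
proof -
  have "AE \<omega> in \<Omega>. 0 \<le> pick j \<omega>" for j
  proof -
    have "AE x in distr \<Omega> borel P. 0 \<le> x" using P_nonneg by (subst AE_distr_iff) auto
    then show ?thesis unfolding pick_distr[of j, symmetric] by (subst (asm) AE_distr_iff) auto
  qed
  then show ?thesis by (simp add: AE_all_countable)
qed

lemma P_integrable: "integrable \<Omega> P"
proof (rule Bochner_Integration.integrable_bound)
  show "integrable \<Omega> (\<lambda>\<omega>. 1 + (P \<omega>)\<^sup>2)" using P_square_integrable by simp
  have "\<bar>x\<bar> \<le> 1 + x\<^sup>2" for x :: real
    using sum_squares_bound[of "\<bar>x\<bar>" 1] by (simp add: abs_if split: if_splits)
  then show "AE \<omega> in \<Omega>. norm (P \<omega>) \<le> norm (1 + (P \<omega>)\<^sup>2)" by (simp add: abs_of_nonneg add_nonneg_nonneg)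
qed measurable

lemma expectation_P_nonneg: "0 \<le> expectation P"
  by (rule integral_nonneg_AE) (rule P_nonneg)

lemma expectation_order_times_picks:
  fixes p :: "nat \<Rightarrow> real \<Rightarrow> real"
  assumes F: "order_determined F" "integrable \<Omega> F" and J: "finite J"
    and p_meas [measurable]: "\<And>j. p j \<in> borel_measurable borel" and int: "\<And>j. integrable \<Omega> (\<lambda>\<omega>. p j (P \<omega>))"
  shows "integrable \<Omega> (\<lambda>\<omega>. F \<omega> * (\<Prod>j\<in>J. p j (pick j \<omega>)))"
    and "expectation (\<lambda>\<omega>. F \<omega> * (\<Prod>j\<in>J. p j (pick j \<omega>))) =
      expectation F * (\<Prod>j\<in>J. expectation (\<lambda>\<omega>. p j (P \<omega>)))"
proof -
  obtain f where f: "f \<in> borel_measurable (PiM order_sources (\<lambda>_. borel))"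
    and F_eq: "F = (\<lambda>\<omega>. f (restrict (\<lambda>s. source_value s \<omega>) order_sources))"
    using F(1) unfolding order_determined_def by blast
  \<comment> \<open>\<open>None\<close> stands for the order as a whole, \<open>Some j\<close> for the picking time of item \<open>j\<close>\<close>
  define K where "K x = (case x of None \<Rightarrow> order_sources | Some j \<Rightarrow> {Item_Pick j})" for x
  define Y where "Y x y = (case x of None \<Rightarrow> f y | Some j \<Rightarrow> p j (y (Item_Pick j)))" for x and y :: "source \<Rightarrow> real"
  define Z where "Z x \<omega> = (case x of None \<Rightarrow> F \<omega> | Some j \<Rightarrow> p j (pick j \<omega>))" for x \<omega>
  let ?I = "insert None (Some ` J)"
  have "indep_vars (\<lambda>x. PiM (K x) (\<lambda>_. borel)) (\<lambda>x \<omega>. restrict (\<lambda>s. source_value s \<omega>) (K x)) ?I"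
    by (rule indep_vars_restrict[OF independent]) (auto simp: disjoint_family_on_def K_def)
  then have "indep_vars (\<lambda>_. borel) (\<lambda>x \<omega>. Y x (restrict (\<lambda>s. source_value s \<omega>) (K x))) ?I"
  proof (rule indep_vars_compose2)
    show "Y x \<in> borel_measurable (PiM (K x) (\<lambda>_. borel))" for x
    proof (cases x)
      case None
      then show ?thesis using f by (simp add: Y_def[abs_def] K_def)
    next
      case (Some j)
      have "(\<lambda>y :: source \<Rightarrow> real. p j (y (Item_Pick j))) \<in> borel_measurable (PiM {Item_Pick j} (\<lambda>_. borel))"
      proof -
        have [measurable]: "(\<lambda>y :: source \<Rightarrow> real. y (Item_Pick j)) \<in> borel_measurable (PiM {Item_Pick j} (\<lambda>_. borel))"
          by (rule measurable_component_singleton) simp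
        show ?thesis by measurable
      qed
      then show ?thesis using Some by (simp add: Y_def[abs_def] K_def)
    qed
  qed
  also have "(\<lambda>x \<omega>. Y x (restrict (\<lambda>s. source_value s \<omega>) (K x))) = Z"
    by (intro ext) (auto simp: Y_def Z_def K_def F_eq split: option.split)
  finally have ind: "indep_vars (\<lambda>_. borel) Z ?I" .
  have intZ: "integrable \<Omega> (Z x)" for x
    using F(2) pick_P(1)[OF p_meas int] by (cases x) (auto simp: Z_def[abs_def])
  have prodZ: "(\<Prod>x\<in>?I. h x) = h None * (\<Prod>j\<in>J. h (Some j))" for h :: "nat option \<Rightarrow> real"
    using J by (simp add: prod.reindex comp_def)
  show "integrable \<Omega> (\<lambda>\<omega>. F \<omega> * (\<Prod>j\<in>J. p j (pick j \<omega>)))"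
    using indep_vars_integrable[OF _ ind intZ] J unfolding prodZ by (simp add: Z_def)
  show "expectation (\<lambda>\<omega>. F \<omega> * (\<Prod>j\<in>J. p j (pick j \<omega>))) =
      expectation F * (\<Prod>j\<in>J. expectation (\<lambda>\<omega>. p j (P \<omega>)))"
    using indep_vars_lebesgue_integral[OF _ ind intZ] J unfolding prodZ
    by (simp add: Z_def[abs_def] pick_P(2)[OF p_meas int])
qed

lemma sum_picks_measurable [measurable]: "(\<lambda>\<omega>. \<Sum>j<M \<omega>. pick j \<omega>) \<in> borel_measurable \<Omega>"
  by (rule measurable_compose_countable[OF _ M_measurable]) measurable

text \<open>
  Wald's identity, with an additional factor that may depend on the order but not on the
  picking times.
\<close>

lemma expectation_sum_picks_times:
  assumes G: "order_determined G" "integrable \<Omega> G" "\<And>\<omega>. 0 \<le> G \<omega>"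
    and MG: "integrable \<Omega> (\<lambda>\<omega>. real (M \<omega>) * G \<omega>)"
  shows "integrable \<Omega> (\<lambda>\<omega>. (\<Sum>j<M \<omega>. pick j \<omega>) * G \<omega>)"
    and "expectation (\<lambda>\<omega>. (\<Sum>j<M \<omega>. pick j \<omega>) * G \<omega>) = expectation P * expectation (\<lambda>\<omega>. real (M \<omega>) * G \<omega>)"
proof -
  have [measurable]: "G \<in> borel_measurable \<Omega>" using G by auto
  have int: "integrable \<Omega> (\<lambda>\<omega>. of_bool (M \<omega> = n) * G \<omega>)" for n
    using integrable_mult_of_bool[OF G(2), of "\<lambda>\<omega>. M \<omega> = n"] by (simp add: mult.commute)
  note slice = expectation_order_times_picks[OF order_determined_mult[OF order_determined_statistics(2) G(1)]
      int, of "{j}" "\<lambda>_ x. x" for j n, simplified, OF P_integrable]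
  have eq: "of_bool (M \<omega> = n) * ((\<Sum>j<M \<omega>. pick j \<omega>) * G \<omega>) =
      (\<Sum>j<n. of_bool (M \<omega> = n) * G \<omega> * pick j \<omega>)" for n \<omega>
  proof -
    have "(\<Sum>j<n. pick j \<omega>) * G \<omega> = (\<Sum>j<n. G \<omega> * pick j \<omega>)"
      by (subst mult.commute) (rule sum_distrib_left)
    then show ?thesis by (cases "M \<omega> = n") simp_all
  qed
  have "has_bochner_integral \<Omega> (\<lambda>\<omega>. (\<Sum>j<M \<omega>. pick j \<omega>) * G \<omega>)
     (expectation (\<lambda>\<omega>. expectation P * (real (M \<omega>) * G \<omega>)))"
  proof (rule has_bochner_integral_slices[where M=M])
    show "AE \<omega> in \<Omega>. 0 \<le> (\<Sum>j<M \<omega>. pick j \<omega>) * G \<omega>"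
      using AE_picks_nonneg by eventually_elim (simp add: G sum_nonneg)
    show "AE \<omega> in \<Omega>. 0 \<le> expectation P * (real (M \<omega>) * G \<omega>)"
      by (simp add: G expectation_P_nonneg)
    show "integrable \<Omega> (\<lambda>\<omega>. expectation P * (real (M \<omega>) * G \<omega>))" using MG by simp
    show "integrable \<Omega> (\<lambda>\<omega>. of_bool (M \<omega> = n) * ((\<Sum>j<M \<omega>. pick j \<omega>) * G \<omega>))" for n
      unfolding eq by (intro Bochner_Integration.integrable_sum slice(1))
    fix n
    have "expectation (\<lambda>\<omega>. of_bool (M \<omega> = n) * ((\<Sum>j<M \<omega>. pick j \<omega>) * G \<omega>)) =
      (\<Sum>j<n. expectation (\<lambda>\<omega>. of_bool (M \<omega> = n) * G \<omega>) * expectation P)"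
      unfolding eq by (subst Bochner_Integration.integral_sum) (auto simp: slice)
    also have "\<dots> = expectation (\<lambda>\<omega>. (expectation P * real n) * (of_bool (M \<omega> = n) * G \<omega>))"
      by simp
    also have "\<dots> = expectation (\<lambda>\<omega>. of_bool (M \<omega> = n) * (expectation P * (real (M \<omega>) * G \<omega>)))"
      by (intro Bochner_Integration.integral_cong) auto
    finally show "expectation (\<lambda>\<omega>. of_bool (M \<omega> = n) * ((\<Sum>j<M \<omega>. pick j \<omega>) * G \<omega>)) =
      expectation (\<lambda>\<omega>. of_bool (M \<omega> = n) * (expectation P * (real (M \<omega>) * G \<omega>)))" .
  qed (auto intro!: M_measurable)
  then show "integrable \<Omega> (\<lambda>\<omega>. (\<Sum>j<M \<omega>. pick j \<omega>) * G \<omega>)"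
    "expectation (\<lambda>\<omega>. (\<Sum>j<M \<omega>. pick j \<omega>) * G \<omega>) = expectation P * expectation (\<lambda>\<omega>. real (M \<omega>) * G \<omega>)"
    by (simp_all add: has_bochner_integral_iff)
qed

lemma expectation_sum_picks_square:
  shows "integrable \<Omega> (\<lambda>\<omega>. (\<Sum>j<M \<omega>. pick j \<omega>)\<^sup>2)"
    and "expectation (\<lambda>\<omega>. (\<Sum>j<M \<omega>. pick j \<omega>)\<^sup>2) =
      expectation (\<lambda>\<omega>. real (M \<omega>) * (real (M \<omega>) - 1)) * (expectation P)\<^sup>2
       + expectation (\<lambda>\<omega>. real (M \<omega>)) * expectation (\<lambda>\<omega>. (P \<omega>)\<^sup>2)"
proof -
  let ?A = "expectation (\<lambda>\<omega>. (P \<omega>)\<^sup>2)" and ?B = "(expectation P)\<^sup>2"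
  have int: "integrable \<Omega> (\<lambda>\<omega>. of_bool (M \<omega> = n) :: real)" for n
    by (rule integrable_const_bound[where B=1]) auto
  note slice = expectation_order_times_picks[OF order_determined_statistics(2) int]
  have pair: "integrable \<Omega> (\<lambda>\<omega>. of_bool (M \<omega> = n) * (pick i \<omega> * pick j \<omega>)) \<and>
      expectation (\<lambda>\<omega>. of_bool (M \<omega> = n) * (pick i \<omega> * pick j \<omega>)) =
      expectation (\<lambda>\<omega>. of_bool (M \<omega> = n)) * (if j = i then ?A else ?B)" for n i j
  proof (cases "j = i")
    case True
    then show ?thesis using slice[of "{i}" "\<lambda>_ x. x\<^sup>2" n] P_square_integrable
      by (simp add: power2_eq_square)
  next
    case False
    then show ?thesis using slice[of "{i, j}" "\<lambda>_ x. x" n] P_integrable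
      by (simp add: power2_eq_square)
  qed
  have eq: "of_bool (M \<omega> = n) * (\<Sum>j<M \<omega>. pick j \<omega>)\<^sup>2 =
      (\<Sum>i<n. \<Sum>j<n. of_bool (M \<omega> = n) * (pick i \<omega> * pick j \<omega>))" for n \<omega>
    by (auto simp: power2_eq_square sum_product)
  have sq: "integrable \<Omega> (\<lambda>\<omega>. real (M \<omega>) * (real (M \<omega>) - 1))"
    using M_square_integrable M_integrable by (simp add: right_diff_distrib power2_eq_square)
  have "has_bochner_integral \<Omega> (\<lambda>\<omega>. (\<Sum>j<M \<omega>. pick j \<omega>)\<^sup>2)
     (expectation (\<lambda>\<omega>. real (M \<omega>) * (real (M \<omega>) - 1) * ?B + real (M \<omega>) * ?A))"
  proof (rule has_bochner_integral_slices[where M=M])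
    have "0 \<le> real n * (real n - 1)" for n by (cases n) auto
    then show "AE \<omega> in \<Omega>. 0 \<le> real (M \<omega>) * (real (M \<omega>) - 1) * ?B + real (M \<omega>) * ?A"
      by (auto intro!: add_nonneg_nonneg mult_nonneg_nonneg)
    show "integrable \<Omega> (\<lambda>\<omega>. real (M \<omega>) * (real (M \<omega>) - 1) * ?B + real (M \<omega>) * ?A)"
      using sq M_integrable by simp
    show "integrable \<Omega> (\<lambda>\<omega>. of_bool (M \<omega> = n) * (\<Sum>j<M \<omega>. pick j \<omega>)\<^sup>2)" for n
      unfolding eq using pair by (intro Bochner_Integration.integrable_sum) auto
    fix n
    have "expectation (\<lambda>\<omega>. of_bool (M \<omega> = n) * (\<Sum>j<M \<omega>. pick j \<omega>)\<^sup>2) =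
      (\<Sum>i<n. \<Sum>j<n. expectation (\<lambda>\<omega>. of_bool (M \<omega> = n)) * (if j = i then ?A else ?B))"
      unfolding eq
      by (simp only: Bochner_Integration.integral_sum Bochner_Integration.integrable_sum
          conjunct1[OF pair] conjunct2[OF pair])
    also have "\<dots> = (\<Sum>i<n. expectation (\<lambda>\<omega>. of_bool (M \<omega> = n)) * (?A + (real n - 1) * ?B))"
    proof (intro sum.cong refl)
      fix i assume i: "i \<in> {..<n}"
      have "(\<Sum>j<n. if j = i then ?A else ?B) = ?A + (\<Sum>j\<in>{..<n} - {i}. ?B)"
        using i by (subst sum.remove[of _ i]) (auto intro!: sum.cong)
      also have "\<dots> = ?A + (real n - 1) * ?B"
        using i by (simp add: card_Diff_singleton of_nat_diff)
      finally show "(\<Sum>j<n. expectation (\<lambda>\<omega>. of_bool (M \<omega> = n)) * (if j = i then ?A else ?B)) =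
         expectation (\<lambda>\<omega>. of_bool (M \<omega> = n)) * (?A + (real n - 1) * ?B)"
        by (simp add: sum_distrib_left[symmetric])
    qed
    also have "\<dots> = expectation (\<lambda>\<omega>. of_bool (M \<omega> = n) * (real n * (real n - 1) * ?B + real n * ?A))"
      by (simp only: integral_mult_left_zero sum_constant card_lessThan) (simp add: algebra_simps)
    also have "\<dots> = expectation (\<lambda>\<omega>. of_bool (M \<omega> = n) * (real (M \<omega>) * (real (M \<omega>) - 1) * ?B + real (M \<omega>) * ?A))"
      by (intro Bochner_Integration.integral_cong) auto
    finally show "expectation (\<lambda>\<omega>. of_bool (M \<omega> = n) * (\<Sum>j<M \<omega>. pick j \<omega>)\<^sup>2) =
      expectation (\<lambda>\<omega>. of_bool (M \<omega> = n) * (real (M \<omega>) * (real (M \<omega>) - 1) * ?B + real (M \<omega>) * ?A))" .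
  qed (auto intro!: M_measurable)
  then show "integrable \<Omega> (\<lambda>\<omega>. (\<Sum>j<M \<omega>. pick j \<omega>)\<^sup>2)"
    "expectation (\<lambda>\<omega>. (\<Sum>j<M \<omega>. pick j \<omega>)\<^sup>2) =
      expectation (\<lambda>\<omega>. real (M \<omega>) * (real (M \<omega>) - 1)) * (expectation P)\<^sup>2
       + expectation (\<lambda>\<omega>. real (M \<omega>)) * expectation (\<lambda>\<omega>. (P \<omega>)\<^sup>2)"
    using sq M_integrable by (simp_all add: has_bochner_integral_iff)
qed

section \<open>Moments of the total picking time\<close>

abbreviation "total_pick \<omega> \<equiv> \<Sum>j<M \<omega>. pick j \<omega>"

abbreviation "interior_sum \<omega> \<equiv> front_sum M aisle loc \<omega> + back_sum M aisle loc \<omega>"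

abbreviation "last_no \<omega> \<equiv> real (last_aisle M aisle \<omega>)"

lemma midpoint_time_eq:
  "midpoint_time l w\<^sub>a v M aisle loc pick \<omega> =
    total_pick \<omega> + l / v * interior_sum \<omega> + 2 * l / v + 2 * w\<^sub>a / v * (last_no \<omega> - 1)"
  by (simp add: midpoint_time_def front_sum_def back_sum_def sum.distrib)

text \<open>
  Since \<open>T\<close> is \<open>X + 2 * l / v\<close> for the variable part \<open>X\<close>, its square is
  \<open>X\<^sup>2 + 4 * l / v * (T - 2 * l / v) + 4 * l\<^sup>2 / v\<^sup>2\<close>, which explains the last term and the
  constant one. The others are the squares and mixed products in \<open>X\<close>, where the back half-aisles
  double the contribution of the front ones.
\<close>

lemma moments_of_midpoint_time:
  assumes fin: "integrable \<Omega> (front_sum M aisle loc)" "integrable \<Omega> (back_sum M aisle loc)"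
      "integrable \<Omega> (\<lambda>\<omega>. (interior_sum \<omega>)\<^sup>2)"
      "integrable \<Omega> (\<lambda>\<omega>. last_no \<omega> * front_sum M aisle loc \<omega>)" "integrable \<Omega> (\<lambda>\<omega>. last_no \<omega> * back_sum M aisle loc \<omega>)"
      "integrable \<Omega> (\<lambda>\<omega>. real (M \<omega>) * front_sum M aisle loc \<omega>)" "integrable \<Omega> (\<lambda>\<omega>. real (M \<omega>) * back_sum M aisle loc \<omega>)"
    and sym: "expectation (back_sum M aisle loc) = expectation (front_sum M aisle loc)"
      "expectation (\<lambda>\<omega>. last_no \<omega> * back_sum M aisle loc \<omega>) = expectation (\<lambda>\<omega>. last_no \<omega> * front_sum M aisle loc \<omega>)"
      "expectation (\<lambda>\<omega>. real (M \<omega>) * back_sum M aisle loc \<omega>) = expectation (\<lambda>\<omega>. real (M \<omega>) * front_sum M aisle loc \<omega>)"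
  defines "T \<equiv> midpoint_time l w\<^sub>a v M aisle loc pick"
  shows "expectation T = expectation (\<lambda>\<omega>. real (M \<omega>)) * expectation P
      + 2 * l / v * expectation (front_sum M aisle loc) + 2 * w\<^sub>a / v * (expectation last_no - 1) + 2 * l / v" (is ?first)
    and "expectation (\<lambda>\<omega>. (T \<omega>)\<^sup>2) =
         expectation (\<lambda>\<omega>. real (M \<omega>) * (real (M \<omega>) - 1)) * (expectation P)\<^sup>2
       + expectation (\<lambda>\<omega>. real (M \<omega>)) * expectation (\<lambda>\<omega>. (P \<omega>)\<^sup>2)
       + l\<^sup>2 / v\<^sup>2 * expectation (\<lambda>\<omega>. (interior_sum \<omega>)\<^sup>2)
       + 4 * w\<^sub>a\<^sup>2 / v\<^sup>2 * (expectation (\<lambda>\<omega>. (last_no \<omega>)\<^sup>2) - 2 * expectation last_no + 1)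
       + 4 * l\<^sup>2 / v\<^sup>2
       + 4 * l / v * expectation P * expectation (\<lambda>\<omega>. real (M \<omega>) * front_sum M aisle loc \<omega>)
       + 4 * w\<^sub>a / v * expectation P * (expectation (\<lambda>\<omega>. real (M \<omega>) * last_no \<omega>) - expectation (\<lambda>\<omega>. real (M \<omega>)))
       + 8 * w\<^sub>a * l / v\<^sup>2 * (expectation (\<lambda>\<omega>. last_no \<omega> * front_sum M aisle loc \<omega>) - expectation (front_sum M aisle loc))
       + 4 * l / v * (expectation T - 2 * l / v)" (is ?second)
proof -
  define \<alpha> where "\<alpha> = l / v"
  define \<beta> where "\<beta> = 2 * w\<^sub>a / v"
  have last_le: "AE \<omega> in \<Omega>. last_no \<omega> \<le> real k"
    using AE_items_in_range by eventually_elim (simp add: first_last_aisle_range(1))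
  have int_last: "integrable \<Omega> last_no" "integrable \<Omega> (\<lambda>\<omega>. (last_no \<omega>)\<^sup>2)"
  proof -
    show "integrable \<Omega> last_no"
      using last_le by (intro integrable_const_bound[where B="real k"]) auto
    have "AE \<omega> in \<Omega>. (last_no \<omega>)\<^sup>2 \<le> (real k)\<^sup>2"
      using last_le by eventually_elim (rule power_mono, auto)
    then show "integrable \<Omega> (\<lambda>\<omega>. (last_no \<omega>)\<^sup>2)"
      by (intro integrable_const_bound[where B="(real k)\<^sup>2"]) auto
  qed
  have int_Mlast: "integrable \<Omega> (\<lambda>\<omega>. real (M \<omega>) * last_no \<omega>)"
  proof (rule integrable_quadratic_bound[where B="real k"])
    show "AE \<omega> in \<Omega>. \<bar>real (M \<omega>) * last_no \<omega>\<bar> \<le> real k * (1 + (real (M \<omega>))\<^sup>2)"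
      using last_le
    proof eventually_elim
      case (elim \<omega>)
      then have "real (M \<omega>) * last_no \<omega> \<le> real (M \<omega>) * real k" by (rule mult_left_mono) simp
      then show ?case using le_quadratic_mult[of "real (M \<omega>) * last_no \<omega>" "real k" "M \<omega>"]
        by (simp add: abs_mult mult.commute[of "real k"])
    qed
  qed measurable
  have nonneg: "0 \<le> front_sum M aisle loc \<omega>" "0 \<le> back_sum M aisle loc \<omega>" for \<omega>
    unfolding half_sum_eq[symmetric] half_sum_def by (auto intro!: sum_nonneg reach_nonneg)
  note od = order_determined_statistics
  note Q1 = expectation_sum_picks_times[of "\<lambda>_. 1", OF od(1), simplified, OF M_integrable]
  note Qlast = expectation_sum_picks_times[OF od(3) int_last(1) _ int_Mlast, simplified]
  note Qf = expectation_sum_picks_times[OF od(4) fin(1) nonneg(1) fin(6)]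
  note Qb = expectation_sum_picks_times[OF od(5) fin(2) nonneg(2) fin(7)]
  note Q2 = expectation_sum_picks_square
  have T: "T \<omega> = total_pick \<omega> + \<alpha> * (front_sum M aisle loc \<omega> + back_sum M aisle loc \<omega>) + 2 * \<alpha> + \<beta> * (last_no \<omega> - 1)" for \<omega>
    unfolding T_def midpoint_time_eq \<alpha>_def \<beta>_def by simp
  have int_T: "integrable \<Omega> T"
    unfolding T[abs_def] using Q1 int_last fin by simp
  have ET: "expectation T = expectation P * expectation (\<lambda>\<omega>. real (M \<omega>))
      + 2 * \<alpha> * expectation (front_sum M aisle loc) + 2 * \<alpha> + \<beta> * (expectation last_no - 1)"
    unfolding T[abs_def] using Q1 int_last fin sym by (simp add: prob_space algebra_simps)
  show ?first
    unfolding ET \<alpha>_def \<beta>_def by (simp add: algebra_simps)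
  have sq: "(T \<omega>)\<^sup>2 = (total_pick \<omega>)\<^sup>2 + \<alpha>\<^sup>2 * (interior_sum \<omega>)\<^sup>2 + \<beta>\<^sup>2 * ((last_no \<omega>)\<^sup>2 - 2 * last_no \<omega> + 1) - 4 * \<alpha>\<^sup>2
     + 2 * \<alpha> * (total_pick \<omega> * front_sum M aisle loc \<omega> + total_pick \<omega> * back_sum M aisle loc \<omega>)
     + 2 * \<beta> * (total_pick \<omega> * last_no \<omega> - total_pick \<omega>)
     + 2 * \<alpha> * \<beta> * (last_no \<omega> * front_sum M aisle loc \<omega> + last_no \<omega> * back_sum M aisle loc \<omega>
         - (front_sum M aisle loc \<omega> + back_sum M aisle loc \<omega>))
     + 4 * \<alpha> * T \<omega>" for \<omega>
    unfolding T by (simp add: power2_eq_square algebra_simps)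
  have "expectation (\<lambda>\<omega>. (T \<omega>)\<^sup>2) = expectation (\<lambda>\<omega>. (total_pick \<omega>)\<^sup>2)
     + \<alpha>\<^sup>2 * expectation (\<lambda>\<omega>. (interior_sum \<omega>)\<^sup>2)
     + \<beta>\<^sup>2 * (expectation (\<lambda>\<omega>. (last_no \<omega>)\<^sup>2) - 2 * expectation last_no + 1) - 4 * \<alpha>\<^sup>2
     + 2 * \<alpha> * (2 * (expectation P * expectation (\<lambda>\<omega>. real (M \<omega>) * front_sum M aisle loc \<omega>)))
     + 2 * \<beta> * (expectation P * expectation (\<lambda>\<omega>. real (M \<omega>) * last_no \<omega>) - expectation P * expectation (\<lambda>\<omega>. real (M \<omega>)))
     + 2 * \<alpha> * \<beta> * (2 * expectation (\<lambda>\<omega>. last_no \<omega> * front_sum M aisle loc \<omega>) - 2 * expectation (front_sum M aisle loc))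
     + 4 * \<alpha> * expectation T"
    unfolding sq using Q1 Q2(1) Qlast Qf Qb int_last fin sym int_T by (simp add: prob_space)
  also have "\<dots> = expectation (\<lambda>\<omega>. (total_pick \<omega>)\<^sup>2)
     + \<alpha>\<^sup>2 * expectation (\<lambda>\<omega>. (interior_sum \<omega>)\<^sup>2)
     + \<beta>\<^sup>2 * (expectation (\<lambda>\<omega>. (last_no \<omega>)\<^sup>2) - 2 * expectation last_no + 1) + 4 * \<alpha>\<^sup>2
     + 4 * \<alpha> * expectation P * expectation (\<lambda>\<omega>. real (M \<omega>) * front_sum M aisle loc \<omega>)
     + 2 * \<beta> * expectation P * (expectation (\<lambda>\<omega>. real (M \<omega>) * last_no \<omega>) - expectation (\<lambda>\<omega>. real (M \<omega>)))
     + 4 * \<alpha> * \<beta> * (expectation (\<lambda>\<omega>. last_no \<omega> * front_sum M aisle loc \<omega>) - expectation (front_sum M aisle loc))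
     + 4 * \<alpha> * (expectation T - 2 * \<alpha>)"
    by (simp add: power2_eq_square algebra_simps)
  finally show ?second
    unfolding Q2(2) \<alpha>_def \<beta>_def by (simp add: power_divide power_mult_distrib power2_eq_square[of v] mult.assoc)
qed

end

theorem theorem5p3:
  fixes \<Omega> :: "'a measure"
    and k :: nat
    and l w\<^sub>a v :: real
    and M :: "'a \<Rightarrow> nat"
    and aisle :: "nat \<Rightarrow> 'a \<Rightarrow> nat"
    and loc :: "nat \<Rightarrow> 'a \<Rightarrow> real"
    and P :: "'a \<Rightarrow> real"
    and pick :: "nat \<Rightarrow> 'a \<Rightarrow> real"
  defines "E \<equiv> \<lambda>X :: 'a \<Rightarrow> real. \<integral>\<omega>. X \<omega> \<partial>\<Omega>"
    and "T \<equiv> midpoint_time l w\<^sub>a v M aisle loc pick"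
    and "kp \<equiv> \<lambda>\<omega>. real (last_aisle M aisle \<omega>)"
    and "Sf \<equiv> front_sum M aisle loc"
    and "Sb \<equiv> back_sum M aisle loc"
    and "Af \<equiv> front_reach M aisle loc"
    and "Ab \<equiv> back_reach M aisle loc"
    and "Nf \<equiv> \<lambda>i \<omega>. real (num_front M aisle loc i \<omega>)"
    and "Nb \<equiv> \<lambda>i \<omega>. real (num_back M aisle loc i \<omega>)"
    and "spans \<equiv> \<lambda>m \<omega>. of_bool (last_aisle M aisle \<omega> = m + 1 \<and> first_aisle M aisle \<omega> = 1) :: real"
    and "PM \<equiv> pgf \<Omega> M"
    and "G \<equiv> span_pgf \<Omega> M k"
    and "g \<equiv> \<lambda>m z. span_pgf \<Omega> M k m z 1"
  defines "a \<equiv> \<lambda>m. E (\<lambda>\<omega>. Af 2 \<omega> * spans m \<omega>)"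
    and "b \<equiv> \<lambda>m. E (\<lambda>\<omega>. (Af 2 \<omega>)\<^sup>2 * spans m \<omega>)"
    and "c \<equiv> \<lambda>m. E (\<lambda>\<omega>. Af 2 \<omega> * Ab 2 \<omega> * spans m \<omega>)"
    and "d \<equiv> \<lambda>m. E (\<lambda>\<omega>. Af 2 \<omega> * Nb 2 \<omega> * spans m \<omega>)"
    and "e \<equiv> \<lambda>m. E (\<lambda>\<omega>. Af 2 \<omega> * Nf 2 \<omega> * spans m \<omega>)"
    and "f \<equiv> \<lambda>m. E (\<lambda>\<omega>. Af 2 \<omega> * Nf 1 \<omega> * spans m \<omega>)"
  assumes model: "order_picking \<Omega> k l w\<^sub>a v M aisle loc P pick"
  shows
    "E T = E (\<lambda>\<omega>. real (M \<omega>)) * E P + 2 * l / v * E Sf + 2 * w\<^sub>a / v * (E kp - 1) + 2 * l / v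
     \<and>
     E (\<lambda>\<omega>. (T \<omega>)\<^sup>2) =
         E (\<lambda>\<omega>. real (M \<omega>) * (real (M \<omega>) - 1)) * (E P)\<^sup>2
       + E (\<lambda>\<omega>. real (M \<omega>)) * E (\<lambda>\<omega>. (P \<omega>)\<^sup>2)
       + l\<^sup>2 / v\<^sup>2 * E (\<lambda>\<omega>. (Sf \<omega> + Sb \<omega>)\<^sup>2)
       + 4 * w\<^sub>a\<^sup>2 / v\<^sup>2 * (E (\<lambda>\<omega>. (kp \<omega>)\<^sup>2) - 2 * E kp + 1)
       + 4 * l\<^sup>2 / v\<^sup>2
       + 4 * l / v * E P * E (\<lambda>\<omega>. real (M \<omega>) * Sf \<omega>)
       + 4 * w\<^sub>a / v * E P * (E (\<lambda>\<omega>. real (M \<omega>) * kp \<omega>) - E (\<lambda>\<omega>. real (M \<omega>)))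
       + 8 * w\<^sub>a * l / v\<^sup>2 * (E (\<lambda>\<omega>. kp \<omega> * Sf \<omega>) - E Sf)
       + 4 * l / v * (E T - 2 * l / v)
     \<and>
     E kp = real k - (\<Sum>r<k. PM (real r / real k))
     \<and>
     E (\<lambda>\<omega>. (kp \<omega>)\<^sup>2) = (real k)\<^sup>2 - (\<Sum>r<k. (2 * real r + 1) * PM (real r / real k))
     \<and>
     E (\<lambda>\<omega>. real (M \<omega>) * kp \<omega>) =
       real k * E (\<lambda>\<omega>. real (M \<omega>)) - (\<Sum>r<k. real r / real k * deriv01 PM (real r / real k))
     \<and>
     E Sf = (\<Sum>m=2..k-1. (real m - 1) * (real k - real m) * a m)
     \<and>
     E (\<lambda>\<omega>. (Sf \<omega> + Sb \<omega>)\<^sup>2) =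
         (\<Sum>m=2..k-1. (2 * real m - 2) * (real k - real m) * b m)
       + (\<Sum>m=2..k-1. (2 * real m - 2) * (2 * real m - 3) * (real k - real m) * c m)
     \<and>
     E (\<lambda>\<omega>. kp \<omega> * Sf \<omega>) =
       (\<Sum>m=2..k-1. 1 / 2 * (real k - real m) * (real k + real m + 1) * (real m - 1) * a m)
     \<and>
     E (\<lambda>\<omega>. real (M \<omega>) * Sf \<omega>) =
         (\<Sum>m=2..k-1. (real k - real m) * (real m - 1) * (2 * real m - 3) * d m)
       + (\<Sum>m=2..k-1. (real k - real m) * (real m - 1) * e m)
       + (\<Sum>m=2..k-1. 4 * (real k - real m) * (real m - 1) * f m)
     \<and>
     (\<forall>m\<in>{2..k-1}.
         g m 1 = measure \<Omega> {\<omega> \<in> space \<Omega>. last_aisle M aisle \<omega> = m + 1 \<and> first_aisle M aisle \<omega> = 1}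
       \<and> a m = g m 1 - integral {0..1} (\<lambda>z. g m z)
       \<and> b m = g m 1 - 2 * integral {0..1} (\<lambda>z. z * g m z)
       \<and> c m = g m 1 - 2 * integral {0..1} (\<lambda>z. g m z)
                + integral {0..1} (\<lambda>z. integral {0..1} (\<lambda>y. G m z y))
       \<and> d m = deriv01 (g m) 1 - g m 1 + g m 0
       \<and> e m = deriv01 (g m) 1 - g m 1 + integral {0..1} (\<lambda>z. g m z))"
proof -
  interpret order_picking \<Omega> k l w\<^sub>a v M aisle loc P pick by (rule model)
  \<comment> \<open>the constants are moments for \<open>i = 1\<close>; they agree with those for every \<open>i\<close> and all half-aisles of the same kind\<close>
  let ?c = "(2, True) :: nat \<times> bool"
  have c: "fst ?c \<in> {1<..<1+m}" if "2 \<le> m" for m :: nat using that by simp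
  have a: "expectation (\<lambda>\<omega>. R c \<omega> * aisle_span i m \<omega>) = a m"
    if "1 \<le> i" "i + m \<le> k" "2 \<le> m" "fst c \<in> {i<..<i+m}" for i m c
  proof -
    have "a m = expectation (\<lambda>\<omega>. R ?c \<omega> * aisle_span 1 m \<omega>)"
      by (simp add: a_def E_def Af_def spans_def reach_def aisle_span_def)
    then show ?thesis
      using first_moment(2)[OF that] first_moment(2)[of 1 m ?c] that by simp
  qed
  have b: "expectation (\<lambda>\<omega>. (R c \<omega>)\<^sup>2 * aisle_span i m \<omega>) = b m"
    if "1 \<le> i" "i + m \<le> k" "2 \<le> m" "fst c \<in> {i<..<i+m}" for i m c
  proof -
    have "b m = expectation (\<lambda>\<omega>. (R ?c \<omega>)\<^sup>2 * aisle_span 1 m \<omega>)"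
      by (simp add: b_def E_def Af_def spans_def reach_def aisle_span_def)
    then show ?thesis
      using second_moment[OF that] second_moment[of 1 m ?c] that by simp
  qed
  have c_eq: "c m = expectation (\<lambda>\<omega>. R ?c \<omega> * R (2, False) \<omega> * aisle_span 1 m \<omega>)" for m
    by (simp add: c_def E_def Af_def Ab_def spans_def reach_def aisle_span_def)
  have cc: "expectation (\<lambda>\<omega>. R d \<omega> * R d' \<omega> * aisle_span i m \<omega>) = c m"
    if "1 \<le> i" "i + m \<le> k" "2 \<le> m" "fst d \<in> {i<..<i+m}" "fst d' \<in> {i<..<i+m}" "d \<noteq> d'" for i m d d'
    using product_moment[OF that] product_moment[of 1 m ?c "(2, False)"] that by (simp add: c_eq)
  have d_eq: "d m = expectation (\<lambda>\<omega>. R ?c \<omega> * real (N (2, False) \<omega>) * aisle_span 1 m \<omega>)" for m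
    by (simp add: d_def E_def Af_def Nb_def spans_def reach_def num_cell_def aisle_span_def)
  have d: "expectation (\<lambda>\<omega>. R c \<omega> * real (N b \<omega>) * aisle_span i m \<omega>) = d m"
    if "1 \<le> i" "i + m \<le> k" "2 \<le> m" "fst c \<in> {i<..<i+m}" "fst b \<in> {i<..<i+m}" "b \<noteq> c" for i m c b
    using other_cell_moment[OF that] other_cell_moment[of 1 m ?c "(2, False)"] that by (simp add: d_eq)
  have e_eq: "e m = expectation (\<lambda>\<omega>. R ?c \<omega> * real (N ?c \<omega>) * aisle_span 1 m \<omega>)" for m
    by (simp add: e_def E_def Af_def Nf_def spans_def reach_def num_cell_def aisle_span_def)
  have e: "expectation (\<lambda>\<omega>. R c \<omega> * real (N c \<omega>) * aisle_span i m \<omega>) = e m"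
    if "1 \<le> i" "i + m \<le> k" "2 \<le> m" "fst c \<in> {i<..<i+m}" for i m c
    using same_cell_moment[OF that] same_cell_moment[of 1 m ?c] that by (simp add: e_eq)
  have f_eq: "f m = expectation (\<lambda>\<omega>. R ?c \<omega> * real (N (1, True) \<omega>) * aisle_span 1 m \<omega>)" for m
    by (simp add: f_def E_def Af_def Nf_def spans_def reach_def num_cell_def aisle_span_def)
  have f: "expectation (\<lambda>\<omega>. R c \<omega> * real (N b \<omega>) * aisle_span i m \<omega>) = f m"
    if "1 \<le> i" "i + m \<le> k" "2 \<le> m" "fst c \<in> {i<..<i+m}" "fst b = i \<or> fst b = i + m" for i m c b
    using edge_cell_moment[OF that] edge_cell_moment[of 1 m ?c "(1, True)"] that by (simp add: f_eq)
  note half = expectation_half_sum[OF a]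
  note front_half = half[of True, unfolded half_sum_eq] and back_half = half[of False, unfolded half_sum_eq]
  note size_half = expectation_size_half_sum[OF d e f]
  note size_front = size_half[of True, unfolded half_sum_eq]
    and size_back = size_half[of False, unfolded half_sum_eq]
  note total = expectation_total_square[OF b cc, unfolded half_sum_eq]
  note T_moments = moments_of_midpoint_time[OF front_half(1) back_half(1) total(1) front_half(3) back_half(3)
      size_front(1) size_back(1) trans[OF back_half(2) front_half(2)[symmetric]]
      trans[OF back_half(4) front_half(4)[symmetric]] trans[OF size_back(2) size_front(2)[symmetric]]]
  have prob_span: "span_pgf \<Omega> M k m 1 1 =
      measure \<Omega> {\<omega> \<in> space \<Omega>. last_aisle M aisle \<omega> = m + 1 \<and> first_aisle M aisle \<omega> = 1}"
    if "m \<in> {2..k-1}" for m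
  proof -
    have "span_pgf \<Omega> M k m 1 1 = expectation (aisle_span 1 m)"
    proof -
      have "1 + m \<le> k" "2 \<le> m" using that by auto
      then show ?thesis using expectation_spans[of 1 m ?c] by simp
    qed
    also have "\<dots> = expectation (indicator {\<omega> \<in> space \<Omega>. last_aisle M aisle \<omega> = m + 1 \<and> first_aisle M aisle \<omega> = 1})"
      by (intro Bochner_Integration.integral_cong) (auto simp: aisle_span_def indicator_def)
    finally show ?thesis by (simp add: Int_def conj_commute)
  qed
  have per_span: "g m 1 = measure \<Omega> {\<omega> \<in> space \<Omega>. last_aisle M aisle \<omega> = m + 1 \<and> first_aisle M aisle \<omega> = 1}
       \<and> a m = g m 1 - integral {0..1} (\<lambda>z. g m z)
       \<and> b m = g m 1 - 2 * integral {0..1} (\<lambda>z. z * g m z)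
       \<and> c m = g m 1 - 2 * integral {0..1} (\<lambda>z. g m z)
                + integral {0..1} (\<lambda>z. integral {0..1} (\<lambda>y. G m z y))
       \<and> d m = deriv01 (g m) 1 - g m 1 + g m 0
       \<and> e m = deriv01 (g m) 1 - g m 1 + integral {0..1} (\<lambda>z. g m z)" if m: "m \<in> {2..k-1}" for m
  proof -
    have i: "(1::nat) \<le> 1" "1 + m \<le> k" "2 \<le> m" using m by auto
    have "deriv01 (g m) 1 = span_deriv m 1"
      unfolding g_def using i by (intro deriv01_eq span_pgf_has_derivative) auto
    then show ?thesis
      using prob_span[OF m] a[OF i c[OF i(3)]] first_moment(2)[OF i c[OF i(3)]]
        b[OF i c[OF i(3)]] second_moment[OF i c[OF i(3)]]
        c_eq[of m] product_moment[OF i c[OF i(3)], of "(2, False)"]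
        d_eq[of m] other_cell_moment[OF i c[OF i(3)], of "(2, False)"]
        e_eq[of m] same_cell_moment[OF i c[OF i(3)]] i
      by (simp add: g_def G_def)
  qed
  show ?thesis
    unfolding E_def T_def kp_def Sf_def Sb_def PM_def
    using T_moments last_aisle_moments front_half(2,4) total(2) size_front(2) per_span
    by (intro conjI ballI) (assumption | blast)+
qed

end
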